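(* Let $\Gamma_1,\Gamma_2$ be countable measurably freely indecomposable (MFI) groups that are not measure equivalent to each other, and let $\Gamma'_1$ be a subgroup of finite index $\kappa\ge 2$ in $\Gamma_1$. Then for any stably orbit equivalent free p.m.p. actions $\alpha$ of $\Gamma_1\ast\Gamma_2$ on $X$ and $\beta$ of $\Gamma'_1\ast\underbrace{\Gamma_2\ast\Gamma_2\ast\cdots\ast\Gamma_2}_{\kappa\text{ copies}}$ on $Y$, the restriction $\alpha|\Gamma_2$ is not ergodic.
   Context: p.m.p. = probability measure preserving; spaces are standard Borel with non-atomic finite measure; all equivalence relations are Borel with countable classes, measure preserving, and all identities are up to null sets. An equivalence relation $\mathcal R$ is defined on a Borel subset $D(\mathcal R)\subset X$, its domain. For $U\subset D(\mathcal R)$, $\mathcal R|U=\mathcal R\cap (U\times U)$. A complete section of $\mathcal R$ is a Borel subset of $D(\mathcal R)$ meeting (almost) every class. Free products: a countable family $(\mathcal R_i)_{i\in I}$ with domains $D(\mathcal R_i)\subset X$ is freely independent if there is no sequence $x_1,\dots,x_n$ ($n\ge 2$) with $x_n=x_1$, $x_j\ne x_{j+1}$, $(x_j,x_{j+1})\in\mathcal R_{i_j}$ and $i_j\neq i_{j+1}$ for all consecutive indices. $\mathcal R=\ast_{i\in I}\mathcal R_i$ (free product decomposition) means that the $\mathcal R_i$ are subrelations of $\mathcal R$, freely independent, and generate $\mathcal R$ (in particular $D(\mathcal R)=\bigcup_i D(\mathcal R_i)$). Inessential: a free product decomposition $\mathcal R=\ast_{j\in J}\mathcal R_j$ is inessential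 if there is a Borel complete section $U$ of $\mathcal R$ with a Borel $\mathcal R|U$-invariant partition $U=\coprod_{j\in J}U_j$, $U_j\subset D(\mathcal R_j)$, such that $\mathcal R|U_j=\mathcal R_j|U_j$ for each $j$. FI: $\mathcal R$ is freely indecomposable (FI) if every free product decomposition of $\mathcal R$ (into countably many pieces) is inessential. A countable group is measurably freely indecomposable (MFI) if the orbit equivalence relation of each of its free p.m.p. actions is FI. SOE: two measure preserving relations $\mathcal R$ on $(X,\mu)$ and $\mathcal S$ on $(Y,\nu)$ are stably orbit equivalent (SOE) if there are complete sections $A\subset D(\mathcal R)$, $B\subset D(\mathcal S)$ and a Borel isomorphism $\Theta:A\to B$ carrying the normalized measure $\mu|A/\mu(A)$ to $\nu|B/\nu(B)$ and $\mathcal R|A$ to $\mathcal S|B$ (a.e.). Two actions are SOE if their orbit equivalence relations are. Two countable groups are measure equivalent (ME) if they admit SOE free p.m.p. actions. *)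

theory Defs
  imports "HOL-Probability.Probability" "HOL-Algebra.Group_Action"
begin

section \<open>Free products of groups\<close>

text \<open>
  The free product of a family of groups is realised on reduced words: lists of letters
  \<open>(i, g)\<close> with \<open>g\<close> a non-trivial element of the \<open>i\<close>-th factor, neighbouring letters having
  different indices. The product of two words reduces their concatenation, one letter at a time.
\<close>

definition reduced_words :: "'i set \<Rightarrow> ('i \<Rightarrow> 'g monoid) \<Rightarrow> ('i \<times> 'g) list set" where
  "reduced_words I G =
    {w. (\<forall>(i, g)\<in>set w. i \<in> I \<and> g \<in> carrier (G i) \<and> g \<noteq> \<one>\<^bsub>G i\<^esub>) \<and> distinct_adj (map fst w)}"

fun letter_mult :: "('i \<Rightarrow> 'g monoid) \<Rightarrow> 'i \<times> 'g \<Rightarrow> ('i \<times> 'g) list \<Rightarrow> ('i \<times> 'g) list" where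
  "letter_mult G (i, g) [] = (if g = \<one>\<^bsub>G i\<^esub> then [] else [(i, g)])"
| "letter_mult G (i, g) ((j, h) # w) =
    (if g = \<one>\<^bsub>G i\<^esub> then (j, h) # w
     else if i = j then (if g \<otimes>\<^bsub>G i\<^esub> h = \<one>\<^bsub>G i\<^esub> then w else (i, g \<otimes>\<^bsub>G i\<^esub> h) # w)
     else (i, g) # (j, h) # w)"

definition free_product :: "'i set \<Rightarrow> ('i \<Rightarrow> 'g monoid) \<Rightarrow> ('i \<times> 'g) list monoid" where
  "free_product I G =
    \<lparr>carrier = reduced_words I G, mult = (\<lambda>u v. foldr (letter_mult G) u v), one = []\<rparr>"

definition free_product_incl :: "('i \<Rightarrow> 'g monoid) \<Rightarrow> 'i \<Rightarrow> 'g \<Rightarrow> ('i \<times> 'g) list" where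
  "free_product_incl G i g = (if g = \<one>\<^bsub>G i\<^esub> then [] else [(i, g)])"

lemma Nil_reduced: "[] \<in> reduced_words I G"
  by (simp add: reduced_words_def)

lemma Cons_reduced_iff:
  "(i, g) # w \<in> reduced_words I G \<longleftrightarrow>
    i \<in> I \<and> g \<in> carrier (G i) \<and> g \<noteq> \<one>\<^bsub>G i\<^esub> \<and> w \<in> reduced_words I G \<and> (w = [] \<or> fst (hd w) \<noteq> i)"
  by (cases w) (auto simp: reduced_words_def distinct_adj_Cons)

lemma letter_mult_one: "letter_mult G (i, \<one>\<^bsub>G i\<^esub>) w = w"
  by (cases w) auto

lemma letter_mult_reduced:
  assumes "\<And>i. i \<in> I \<Longrightarrow> group (G i)" "i \<in> I" "g \<in> carrier (G i)" "w \<in> reduced_words I G"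
  shows "letter_mult G (i, g) w \<in> reduced_words I G"
proof (cases w)
  case Nil
  then show ?thesis using assms by (auto simp: Cons_reduced_iff Nil_reduced)
next
  case (Cons x v)
  obtain j h where x: "x = (j, h)" by (cases x)
  interpret group "G i" using assms by blast
  have v: "(j, h) # v \<in> reduced_words I G" using assms(4) by (simp add: Cons x)
  show ?thesis
  proof (cases "j = i")
    case True
    then have "h \<in> carrier (G i)" using v by (simp add: Cons_reduced_iff)
    then show ?thesis using assms(2,3) v by (simp add: Cons x True Cons_reduced_iff)
  next
    case False
    then show ?thesis using assms(2,3) v by (simp add: Cons x Cons_reduced_iff)
  qed
qed

lemma letter_mult_mult:
  assumes "\<And>i. i \<in> I \<Longrightarrow> group (G i)" "i \<in> I" "g \<in> carrier (G i)" "h \<in> carrier (G i)"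
    "w \<in> reduced_words I G"
  shows "letter_mult G (i, g) (letter_mult G (i, h) w) = letter_mult G (i, g \<otimes>\<^bsub>G i\<^esub> h) w"
proof -
  interpret group "G i" using assms by blast
  show ?thesis
  proof (cases w)
    case Nil
    then show ?thesis using assms by auto
  next
    case (Cons x v)
    obtain j k where x: "x = (j, k)" by (cases x)
    show ?thesis
    proof (cases "i = j")
      case False
      then show ?thesis using assms by (auto simp: Cons x)
    next
      case True
      have k: "k \<in> carrier (G i)" "k \<noteq> \<one>\<^bsub>G i\<^esub>" and v: "v = [] \<or> fst (hd v) \<noteq> i"
        using assms True by (auto simp: Cons x Cons_reduced_iff)
      have hk: "letter_mult G (i, g) v = (if g = \<one>\<^bsub>G i\<^esub> then v else (i, g) # v)"
        using v by (cases v) auto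
      have "g \<otimes>\<^bsub>G i\<^esub> (h \<otimes>\<^bsub>G i\<^esub> k) = (g \<otimes>\<^bsub>G i\<^esub> h) \<otimes>\<^bsub>G i\<^esub> k"
        using assms k by (simp add: m_assoc)
      moreover have "h \<otimes>\<^bsub>G i\<^esub> k = \<one>\<^bsub>G i\<^esub> \<Longrightarrow> (g \<otimes>\<^bsub>G i\<^esub> h) \<otimes>\<^bsub>G i\<^esub> k = g"
        using assms k by (simp add: m_assoc)
      moreover have "g \<otimes>\<^bsub>G i\<^esub> h = \<one>\<^bsub>G i\<^esub> \<Longrightarrow> (g \<otimes>\<^bsub>G i\<^esub> h) \<otimes>\<^bsub>G i\<^esub> k = k"
        using assms k by simp
      ultimately show ?thesis
        using assms(2-4) k hk
        by (cases "g = \<one>\<^bsub>G i\<^esub>"; cases "h = \<one>\<^bsub>G i\<^esub>") (auto simp: Cons x True[symmetric])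
    qed
  qed
qed

lemma foldr_letter_mult_reduced:
  assumes "\<And>i. i \<in> I \<Longrightarrow> group (G i)" "u \<in> reduced_words I G" "w \<in> reduced_words I G"
  shows "foldr (letter_mult G) u w \<in> reduced_words I G"
  using assms(2)
proof (induction u)
  case (Cons x u)
  then show ?case
    using letter_mult_reduced[OF assms(1)] by (cases x) (auto simp: Cons_reduced_iff)
qed (use assms in auto)

lemma foldr_letter_mult:
  assumes "\<And>i. i \<in> I \<Longrightarrow> group (G i)" "i \<in> I" "g \<in> carrier (G i)"
    "v \<in> reduced_words I G" "w \<in> reduced_words I G"
  shows "foldr (letter_mult G) (letter_mult G (i, g) v) w
    = letter_mult G (i, g) (foldr (letter_mult G) v w)"
proof (cases v)
  case Nil
  then show ?thesis by (simp add: letter_mult_one)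
next
  case (Cons x v')
  obtain j h where x: "x = (j, h)" by (cases x)
  have h: "h \<in> carrier (G j)" "j \<in> I" "v' \<in> reduced_words I G"
    using assms by (auto simp: Cons x Cons_reduced_iff)
  have r: "foldr (letter_mult G) v' w \<in> reduced_words I G"
    using foldr_letter_mult_reduced assms h by metis
  have "i = j \<Longrightarrow> letter_mult G (i, g) (letter_mult G (i, h) (foldr (letter_mult G) v' w))
      = letter_mult G (i, g \<otimes>\<^bsub>G i\<^esub> h) (foldr (letter_mult G) v' w)"
    using letter_mult_mult[OF assms(1)] assms(2,3) h r by simp
  then show ?thesis by (auto simp: Cons x letter_mult_one)
qed

lemma foldr_letter_mult_assoc:
  assumes "\<And>i. i \<in> I \<Longrightarrow> group (G i)"
    "u \<in> reduced_words I G" "v \<in> reduced_words I G" "w \<in> reduced_words I G"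
  shows "foldr (letter_mult G) (foldr (letter_mult G) u v) w
    = foldr (letter_mult G) u (foldr (letter_mult G) v w)"
  using assms(2)
proof (induction u)
  case (Cons x u)
  obtain i g where x: "x = (i, g)" by (cases x)
  have "g \<in> carrier (G i)" "i \<in> I" "u \<in> reduced_words I G"
    using Cons.prems by (auto simp: x Cons_reduced_iff)
  then show ?case
    using foldr_letter_mult[where I = I and G = G and i = i and g = g, OF assms(1)]
      foldr_letter_mult_reduced[where I = I and G = G, OF assms(1)] assms(3,4)
      Cons.IH by (simp add: x)
qed simp

lemma foldr_letter_mult_Nil: "u \<in> reduced_words I G \<Longrightarrow> foldr (letter_mult G) u [] = u"
proof (induction u)
  case (Cons x u)
  then show ?case by (cases x; cases u) (auto simp: Cons_reduced_iff)
qed simp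

lemma reduced_words_inv:
  assumes "\<And>i. i \<in> I \<Longrightarrow> group (G i)" "u \<in> reduced_words I G"
  shows "\<exists>v\<in>reduced_words I G. foldr (letter_mult G) v u = []"
  using assms(2)
proof (induction u)
  case Nil
  then show ?case by (auto intro: bexI[of _ "[]"] simp: Nil_reduced)
next
  case (Cons x u)
  obtain i g where x: "x = (i, g)" by (cases x)
  have g: "g \<in> carrier (G i)" "g \<noteq> \<one>\<^bsub>G i\<^esub>" "i \<in> I" and u: "u \<in> reduced_words I G"
    using Cons.prems by (auto simp: x Cons_reduced_iff)
  interpret group "G i" using assms(1) g(3) by blast
  obtain v where v: "v \<in> reduced_words I G" "foldr (letter_mult G) v u = []"
    using Cons.IH u by blast
  have i: "[(i, inv\<^bsub>G i\<^esub> g)] \<in> reduced_words I G"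
    using g by (simp add: Cons_reduced_iff Nil_reduced)
  have "foldr (letter_mult G) (foldr (letter_mult G) v [(i, inv\<^bsub>G i\<^esub> g)]) (x # u)
      = foldr (letter_mult G) v (foldr (letter_mult G) [(i, inv\<^bsub>G i\<^esub> g)] (x # u))"
    by (rule foldr_letter_mult_assoc[OF assms(1) v(1) i Cons.prems])
  also have "foldr (letter_mult G) [(i, inv\<^bsub>G i\<^esub> g)] (x # u) = u"
    using g by (simp add: x)
  finally show ?case
    using v foldr_letter_mult_reduced[OF assms(1) v(1) i] by auto
qed

lemma group_free_product:
  assumes "\<And>i. i \<in> I \<Longrightarrow> group (G i)"
  shows "group (free_product I G)"
proof (rule groupI)
  fix u v w
  assume "u \<in> carrier (free_product I G)" "v \<in> carrier (free_product I G)"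
    "w \<in> carrier (free_product I G)"
  then show "u \<otimes>\<^bsub>free_product I G\<^esub> v \<otimes>\<^bsub>free_product I G\<^esub> w
    = u \<otimes>\<^bsub>free_product I G\<^esub> (v \<otimes>\<^bsub>free_product I G\<^esub> w)"
    using foldr_letter_mult_assoc[OF assms] by (simp add: free_product_def)
qed (use foldr_letter_mult_reduced[OF assms] reduced_words_inv[OF assms]
      in \<open>auto simp: free_product_def Nil_reduced\<close>)

lemma free_product_incl_hom:
  assumes "\<And>i. i \<in> I \<Longrightarrow> group (G i)" "i \<in> I"
  shows "free_product_incl G i \<in> hom (G i) (free_product I G)"
proof -
  interpret group "G i" using assms by blast
  show ?thesis
    by (rule homI)
      (auto simp: assms(2) free_product_def free_product_incl_def Cons_reduced_iff Nil_reduced)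
qed


section \<open>Countable measure preserving equivalence relations\<close>

text \<open>
  A standard Borel space is a Polish type with its Borel sets. A relation \<open>R\<close> on a subset of
  \<open>space M\<close> has \<open>Domain R\<close> as its domain; equality of relations is only ever required after
  restriction to a conull Borel set.
\<close>

definition nonatomic :: "'x measure \<Rightarrow> bool" where
  "nonatomic M \<longleftrightarrow>
    (\<forall>A\<in>sets M. 0 < emeasure M A \<longrightarrow>
      (\<exists>B\<in>sets M. B \<subseteq> A \<and> 0 < emeasure M B \<and> emeasure M B < emeasure M A))"

definition standard_prob_space :: "'x::polish_space measure \<Rightarrow> bool" where
  "standard_prob_space M \<longleftrightarrow> prob_space M \<and> sets M = sets borel \<and> nonatomic M"

definition restr :: "('x \<times> 'x) set \<Rightarrow> 'x set \<Rightarrow> ('x \<times> 'x) set" where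
  "restr R U = R \<inter> (U \<times> U)"

definition mp_eqrel :: "'x measure \<Rightarrow> ('x \<times> 'x) set \<Rightarrow> bool" where
  "mp_eqrel M R \<longleftrightarrow>
    Domain R \<in> sets M \<and> R \<in> sets (M \<Otimes>\<^sub>M M) \<and> equiv (Domain R) R \<and>
    (\<forall>x. countable (R `` {x})) \<and>
    (\<forall>A\<in>sets M. \<forall>f\<in>measurable (restrict_space M A) M.
      inj_on f A \<and> f ` A \<in> sets M \<and> (\<forall>x\<in>A. (x, f x) \<in> R) \<longrightarrow> emeasure M (f ` A) = emeasure M A)"

definition complete_section :: "'x measure \<Rightarrow> ('x \<times> 'x) set \<Rightarrow> 'x set \<Rightarrow> bool" where
  "complete_section M R U \<longleftrightarrow>
    U \<in> sets M \<and> U \<subseteq> Domain R \<and> (AE x in M. x \<in> Domain R \<longrightarrow> R `` {x} \<inter> U \<noteq> {})"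

definition freely_independent :: "'j set \<Rightarrow> ('j \<Rightarrow> ('x \<times> 'x) set) \<Rightarrow> bool" where
  "freely_independent J Rs \<longleftrightarrow>
    \<not> (\<exists>n\<ge>2. \<exists>(x :: nat \<Rightarrow> 'x) (i :: nat \<Rightarrow> 'j). x n = x 1 \<and>
        (\<forall>k\<in>{1..<n}. i k \<in> J \<and> x k \<noteq> x (k + 1) \<and> (x k, x (k + 1)) \<in> Rs (i k)) \<and>
        (\<forall>k\<in>{1..<n - 1}. i k \<noteq> i (k + 1)))"

text \<open>
  For equivalence relations, the transitive closure of the union is the equivalence relation
  which they generate on the union of their domains.
\<close>

definition free_product_decomposition ::
    "'x measure \<Rightarrow> ('x \<times> 'x) set \<Rightarrow> 'j set \<Rightarrow> ('j \<Rightarrow> ('x \<times> 'x) set) \<Rightarrow> bool" where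
  "free_product_decomposition M R J Rs \<longleftrightarrow>
    (\<forall>j\<in>J. mp_eqrel M (Rs j)) \<and>
    (\<exists>X0\<in>sets M. space M - X0 \<in> null_sets M \<and>
      (\<forall>j\<in>J. restr (Rs j) X0 \<subseteq> R) \<and>
      freely_independent J (\<lambda>j. restr (Rs j) X0) \<and>
      restr R X0 = (\<Union>j\<in>J. restr (Rs j) X0)\<^sup>+)"

text \<open>
  No further null set occurs here: since a complete section needs to meet only almost every
  class, an exceptional null set can be removed from \<open>U\<close>.
\<close>

definition inessential ::
    "'x measure \<Rightarrow> ('x \<times> 'x) set \<Rightarrow> 'j set \<Rightarrow> ('j \<Rightarrow> ('x \<times> 'x) set) \<Rightarrow> bool" where
  "inessential M R J Rs \<longleftrightarrow>
    (\<exists>U Us. complete_section M R U \<and> U = (\<Union>j\<in>J. Us j) \<and> disjoint_family_on Us J \<and>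
      (\<forall>j\<in>J. Us j \<in> sets M \<and> Us j \<subseteq> Domain (Rs j) \<and> restr R U `` Us j \<subseteq> Us j \<and>
        restr R (Us j) = restr (Rs j) (Us j)))"

definition freely_indecomposable :: "'x measure \<Rightarrow> ('x \<times> 'x) set \<Rightarrow> bool" where
  "freely_indecomposable M R \<longleftrightarrow>
    (\<forall>(J :: nat set) Rs. free_product_decomposition M R J Rs \<longrightarrow> inessential M R J Rs)"

definition stably_orbit_equivalent ::
    "'x measure \<Rightarrow> ('x \<times> 'x) set \<Rightarrow> 'y measure \<Rightarrow> ('y \<times> 'y) set \<Rightarrow> bool" where
  "stably_orbit_equivalent M R N S \<longleftrightarrow>
    (\<exists>A B \<Theta>. complete_section M R A \<and> complete_section N S B \<and>
      bij_betw \<Theta> A B \<and>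
      \<Theta> \<in> measurable (restrict_space M A) (restrict_space N B) \<and>
      the_inv_into A \<Theta> \<in> measurable (restrict_space N B) (restrict_space M A) \<and>
      (\<forall>C\<in>sets M. C \<subseteq> A \<longrightarrow> measure N (\<Theta> ` C) / measure N B = measure M C / measure M A) \<and>
      (\<exists>A0\<in>sets M. A0 \<subseteq> A \<and> A - A0 \<in> null_sets M \<and>
        (\<forall>x\<in>A0. \<forall>y\<in>A0. (x, y) \<in> R \<longleftrightarrow> (\<Theta> x, \<Theta> y) \<in> S)))"


section \<open>Actions\<close>

definition free_pmp_action :: "'g monoid \<Rightarrow> 'x::polish_space measure \<Rightarrow> ('g \<Rightarrow> 'x \<Rightarrow> 'x) \<Rightarrow> bool" where
  "free_pmp_action G M \<phi> \<longleftrightarrow>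
    standard_prob_space M \<and> group_action G (space M) \<phi> \<and>
    (\<forall>g\<in>carrier G. \<phi> g \<in> measurable M M \<and> distr M M (\<phi> g) = M) \<and>
    (AE x in M. \<forall>g\<in>carrier G. \<phi> g x = x \<longrightarrow> g = \<one>\<^bsub>G\<^esub>)"

definition orbit_relation :: "'g monoid \<Rightarrow> 'x measure \<Rightarrow> ('g \<Rightarrow> 'x \<Rightarrow> 'x) \<Rightarrow> ('x \<times> 'x) set" where
  "orbit_relation G M \<phi> = {(x, y). x \<in> space M \<and> y \<in> orbit G \<phi> x}"

definition ergodic_action :: "'g monoid \<Rightarrow> 'x measure \<Rightarrow> ('g \<Rightarrow> 'x \<Rightarrow> 'x) \<Rightarrow> bool" where
  "ergodic_action G M \<phi> \<longleftrightarrow>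
    (\<forall>A\<in>sets M. (\<forall>g\<in>carrier G. \<phi> g -` A \<inter> space M = A) \<longrightarrow>
      A \<in> null_sets M \<or> space M - A \<in> null_sets M)"

text \<open>
  The next two definitions quantify over all free p.m.p. actions of a group. As types cannot be
  quantified, the underlying standard Borel space is the real line, with an arbitrary non-atomic
  Borel probability measure. This loses no action: a standard Borel space carrying a non-atomic
  probability measure is uncountable, hence Borel isomorphic to the real line.
\<close>

definition MFI :: "'g monoid \<Rightarrow> bool" where
  "MFI G \<longleftrightarrow>
    (\<forall>(M :: real measure) \<phi>. free_pmp_action G M \<phi> \<longrightarrow>
      freely_indecomposable M (orbit_relation G M \<phi>))"

definition measure_equivalent :: "'g monoid \<Rightarrow> 'h monoid \<Rightarrow> bool" where
  "measure_equivalent G H \<longleftrightarrow>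
    (\<exists>(M :: real measure) (N :: real measure) \<phi> \<psi>.
      free_pmp_action G M \<phi> \<and> free_pmp_action H N \<psi> \<and>
      stably_orbit_equivalent M (orbit_relation G M \<phi>) N (orbit_relation H N \<psi>))"

end

theory Submission
  imports Defs
begin

text \<open>
  A cocycle from the orbit relation of a free p.m.p. action into a free product makes the relation
  act on the Bass-Serre tree. Rooting every vertex of the tree at a point of the orbit, by a minimal
  word in the length-lexicographic order, cuts the tree into connected regions, one for each point;
  contracting them exhibits the relation as the free product of its intersections with conjugates of
  the factors and of relations with classes of at most two points. If the relation is freely
  indecomposable with infinite classes, only the former can carry mass, so on some set of positive
  measure the relation is conjugated into one factor (a Kurosh theorem).

  Suppose that \<open>\<Gamma>2\<close> acts ergodically on \<open>M\<close>. Then its relation is conjugated into a factor \<open>j\<close> of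
  \<open>\<Lambda>\<close> on a set meeting almost all of its orbits. As there are two copies of \<open>\<Gamma>2\<close> in \<open>\<Lambda>\<close>, one of
  them is a factor \<open>k\<close> different from \<open>j\<close>. The relation of \<open>k\<close> is conjugated into \<open>\<Gamma>1\<close> or \<open>\<Gamma>2\<close>
  in the same way. If into \<open>\<Gamma>2\<close>, it is carried on into the factor \<open>j\<close>, which is impossible since the
  factors are malnormal. If into \<open>\<Gamma>1\<close>, conjugating \<open>\<Gamma>1\<close> back into a factor of \<open>\<Lambda>\<close> must return to
  \<open>k\<close>, and the two relations agree on a set of positive measure, so \<open>\<Gamma>1\<close> and \<open>\<Gamma>2\<close> are measure
  equivalent.
\<close>


section \<open>Reduced words\<close>

text \<open>A coset of a factor may touch several regions of the tree, and the orbit points rooting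
  these regions see it through different words. Only points sharing one word are related by a
  genuine conjugate of the factor, so one word is selected per coset and every other point is tied
  to a selected point by a two-point relation. The map to the target space is injective only up to a
  countable label, because a stable orbit equivalence relates sections only. So the cocycle also has
  a kernel; its classes form one more piece, which becomes trivial once the label is fixed.
  Ergodicity enters twice: it makes \<open>\<Gamma>2\<close> infinite, so that trivial relations
  carry no mass, and it lets elements of \<open>\<Gamma>2\<close> move almost every point reached
  from the factor \<open>k\<close> into the set where \<open>\<Gamma>2\<close> is conjugated into
  the factor \<open>j\<close>; otherwise these two sets could lie in disjoint unions of orbits. A
  factor that receives the relation of \<open>k\<close> is infinite because an injective image of
  infinite orbits lies in its orbits.\<close>

lemma carrier_free_product [simp]: "carrier (free_product I G) = reduced_words I G"
  and one_free_product [simp]: "\<one>\<^bsub>free_product I G\<^esub> = []"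
  and mult_free_product: "u \<otimes>\<^bsub>free_product I G\<^esub> v = foldr (letter_mult G) u v"
  by (simp_all add: free_product_def)

section \<open>Words modulo one factor on the left\<close>

text \<open>The shortest word in the coset of the factor \<open>j\<close> through \<open>w\<close>;
  \<open>avoids j\<close> singles out the words that are already such representatives.\<close>

definition strip :: "'i \<Rightarrow> ('i \<times> 'g) list \<Rightarrow> ('i \<times> 'g) list" where
  "strip j w = (if w \<noteq> [] \<and> fst (hd w) = j then tl w else w)"

definition avoids :: "'i \<Rightarrow> ('i \<times> 'g) list \<Rightarrow> bool" where
  "avoids j w \<longleftrightarrow> w = [] \<or> fst (hd w) \<noteq> j"

lemma avoids_Nil [simp]: "avoids j []"
  by (simp add: avoids_def)

lemma avoids_Cons [simp]: "avoids j ((i, g) # w) \<longleftrightarrow> i \<noteq> j"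
  by (simp add: avoids_def)

lemma strip_avoids: "avoids j w \<Longrightarrow> strip j w = w"
  by (auto simp: strip_def avoids_def)

lemma Cons_reduced_iff_avoids:
  "(i, g) # w \<in> reduced_words I G \<longleftrightarrow>
    i \<in> I \<and> g \<in> carrier (G i) \<and> g \<noteq> \<one>\<^bsub>G i\<^esub> \<and> w \<in> reduced_words I G \<and> avoids i w"
  by (auto simp: Cons_reduced_iff avoids_def)

lemma strip_reduced: "w \<in> reduced_words I G \<Longrightarrow> strip j w \<in> reduced_words I G"
  by (cases w) (auto simp: strip_def Cons_reduced_iff)

lemma avoids_strip: "w \<in> reduced_words I G \<Longrightarrow> avoids j (strip j w)"
  by (cases w) (auto simp: strip_def Cons_reduced_iff avoids_def)

lemma reduced_appendD:
  assumes "u @ v \<in> reduced_words I G"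
  shows "u \<in> reduced_words I G" "v \<in> reduced_words I G"
  using assms by (auto simp: reduced_words_def distinct_adj_append_iff)

definition inv_word :: "('i \<Rightarrow> 'g monoid) \<Rightarrow> ('i \<times> 'g) list \<Rightarrow> ('i \<times> 'g) list" where
  "inv_word G w = rev (map (\<lambda>(j, g). (j, inv\<^bsub>G j\<^esub> g)) w)"

locale group_family =
  fixes I :: "'i set" and G :: "'i \<Rightarrow> 'g monoid"
  assumes group_factor: "i \<in> I \<Longrightarrow> group (G i)"
begin

abbreviation W where "W \<equiv> free_product I G"
abbreviation RW where "RW \<equiv> reduced_words I G"
abbreviation incl where "incl \<equiv> free_product_incl G"
abbreviation mult_W (infixl "\<cdot>\<^sub>W" 70) where "u \<cdot>\<^sub>W v \<equiv> u \<otimes>\<^bsub>W\<^esub> v"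

sublocale W: group "free_product I G"
  using group_factor by (rule group_free_product)

lemma incl_closed: "j \<in> I \<Longrightarrow> g \<in> carrier (G j) \<Longrightarrow> incl j g \<in> RW"
  by (auto simp: free_product_incl_def Cons_reduced_iff Nil_reduced)

lemma W_closed [simp]: "u \<in> RW \<Longrightarrow> v \<in> RW \<Longrightarrow> u \<cdot>\<^sub>W v \<in> RW"
  using W.m_closed by simp

lemma W_inv_closed [simp]: "u \<in> RW \<Longrightarrow> inv\<^bsub>W\<^esub> u \<in> RW"
  using W.inv_closed by simp

lemma W_one_left [simp]: "[] \<cdot>\<^sub>W u = u"
  by (simp add: mult_free_product)

lemma W_one_right [simp]: "u \<in> RW \<Longrightarrow> u \<cdot>\<^sub>W [] = u"
  using W.r_one by simp

lemma incl_mult: "incl j g \<cdot>\<^sub>W w = letter_mult G (j, g) w"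
  by (simp add: free_product_incl_def mult_free_product letter_mult_one)

lemma incl_one: "incl j \<one>\<^bsub>G j\<^esub> = []"
  by (simp add: free_product_incl_def)

lemma incl_incl:
  assumes "j \<in> I" "g \<in> carrier (G j)" "h \<in> carrier (G j)"
  shows "incl j g \<cdot>\<^sub>W incl j h = incl j (g \<otimes>\<^bsub>G j\<^esub> h)"
  using free_product_incl_hom[where I = I and G = G, OF group_factor assms(1)] assms
  by (simp add: hom_mult)

lemma incl_mult_mult:
  assumes "j \<in> I" "g \<in> carrier (G j)" "h \<in> carrier (G j)" "w \<in> RW"
  shows "incl j g \<cdot>\<^sub>W (incl j h \<cdot>\<^sub>W w) = incl j (g \<otimes>\<^bsub>G j\<^esub> h) \<cdot>\<^sub>W w"
  using assms incl_closed by (simp add: W.m_assoc[symmetric] incl_incl)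

lemma incl_mult_avoids:
  assumes "avoids j w"
  shows "incl j g \<cdot>\<^sub>W w = (if g = \<one>\<^bsub>G j\<^esub> then w else (j, g) # w)"
  using assms by (cases w) (auto simp: incl_mult)

lemma incl_strip:
  assumes "j \<in> I" "w \<in> RW"
  obtains g where "g \<in> carrier (G j)" "w = incl j g \<cdot>\<^sub>W strip j w"
proof (cases "avoids j w")
  case True
  then show ?thesis
    using that[of "\<one>\<^bsub>G j\<^esub>"] group_factor[OF assms(1)]
    by (simp add: incl_mult_avoids strip_avoids group.is_monoid monoid.one_closed)
next
  case False
  then obtain g v where w: "w = (j, g) # v" by (cases w) (auto simp: avoids_def)
  with assms have "avoids j v" "g \<in> carrier (G j)" "g \<noteq> \<one>\<^bsub>G j\<^esub>"
    by (auto simp: Cons_reduced_iff_avoids)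
  then show ?thesis using that[of g] by (simp add: w strip_def incl_mult_avoids)
qed

text \<open>Multiplying by the factor on the left stays in the coset, hence keeps its shortest
  representative.\<close>

lemma strip_incl_mult:
  assumes "j \<in> I" "g \<in> carrier (G j)" "w \<in> RW"
  shows "strip j (incl j g \<cdot>\<^sub>W w) = strip j w"
proof -
  obtain h where h: "h \<in> carrier (G j)" "w = incl j h \<cdot>\<^sub>W strip j w"
    using incl_strip assms by blast
  have "incl j g \<cdot>\<^sub>W w = incl j (g \<otimes>\<^bsub>G j\<^esub> h) \<cdot>\<^sub>W strip j w"
    using incl_mult_mult[OF assms(1,2) h(1) strip_reduced[OF assms(3)], of j] h(2) by simp
  then show ?thesis
    using avoids_strip[OF assms(3), of j] by (simp add: incl_mult_avoids strip_avoids) (simp add: strip_def)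
qed

lemma Cons_eq_incl_mult:
  assumes "(j, g) # w \<in> RW"
  shows "(j, g) # w = incl j g \<cdot>\<^sub>W w"
  using assms by (auto simp: Cons_reduced_iff_avoids incl_mult_avoids)

lemma append_eq_mult:
  assumes "u @ v \<in> RW"
  shows "u @ v = u \<cdot>\<^sub>W v"
  using assms
proof (induction u)
  case Nil
  then show ?case by (simp add: mult_free_product)
next
  case (Cons x u)
  obtain j g where x: "x = (j, g)" by (cases x)
  have *: "(j, g) # (u @ v) \<in> RW" using Cons.prems x by simp
  then have "u @ v \<in> RW" by (simp add: Cons_reduced_iff)
  then show ?case using Cons.IH Cons_eq_incl_mult[OF *]
    by (simp add: x mult_free_product[of _ _ "(j,g) # u"] incl_mult) (simp add: mult_free_product)
qed

section \<open>Inverses and conjugates letter by letter\<close>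

lemma inv_word_reduced:
  assumes "w \<in> RW" shows "inv_word G w \<in> RW"
proof -
  have "\<forall>(i, g)\<in>set w. i \<in> I \<and> g \<in> carrier (G i) \<and> g \<noteq> \<one>\<^bsub>G i\<^esub>" "distinct_adj (map fst w)"
    using assms by (auto simp: reduced_words_def)
  moreover have "inv\<^bsub>G i\<^esub> g \<in> carrier (G i) \<and> inv\<^bsub>G i\<^esub> g \<noteq> \<one>\<^bsub>G i\<^esub>"
    if "i \<in> I" "g \<in> carrier (G i)" "g \<noteq> \<one>\<^bsub>G i\<^esub>" for i g
  proof -
    interpret group "G i" by (rule group_factor[OF that(1)])
    show ?thesis using that by simp
  qed
  moreover have "map fst (inv_word G w) = rev (map fst w)"
    by (simp add: inv_word_def rev_map case_prod_beta comp_def)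
  ultimately show ?thesis
    by (fastforce simp: reduced_words_def inv_word_def)
qed

lemma inv_word_mult: "w \<in> RW \<Longrightarrow> inv_word G w \<cdot>\<^sub>W w = []"
proof (induction w)
  case Nil
  then show ?case by (simp add: inv_word_def mult_free_product)
next
  case (Cons x w)
  obtain j g where x: "x = (j, g)" by (cases x)
  have j: "j \<in> I" "g \<in> carrier (G j)" "w \<in> RW" using Cons.prems by (auto simp: x Cons_reduced_iff)
  interpret Gj: group "G j" by (rule group_factor[OF j(1)])
  have e: "inv_word G (x # w) = inv_word G w @ [(j, inv\<^bsub>G j\<^esub> g)]"
    by (simp add: inv_word_def x)
  have r: "inv_word G w @ [(j, inv\<^bsub>G j\<^esub> g)] \<in> RW"
    using inv_word_reduced[OF Cons.prems] by (simp add: e)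
  note r' = reduced_appendD[OF r]
  have "inv_word G (x # w) \<cdot>\<^sub>W (x # w)
      = (inv_word G w \<cdot>\<^sub>W incl j (inv\<^bsub>G j\<^esub> g)) \<cdot>\<^sub>W (incl j g \<cdot>\<^sub>W w)"
  proof -
    have "incl j (inv\<^bsub>G j\<^esub> g) = [(j, inv\<^bsub>G j\<^esub> g)]"
      using r'(2) by (simp add: free_product_incl_def Cons_reduced_iff)
    then have "inv_word G (x # w) = inv_word G w \<cdot>\<^sub>W incl j (inv\<^bsub>G j\<^esub> g)"
      using append_eq_mult[OF r] e by simp
    then show ?thesis
      by (rule arg_cong2[of _ _ _ _ "(\<cdot>\<^sub>W)"])
        (use Cons_eq_incl_mult[of j g w] Cons.prems x in simp)
  qed
  also have "\<dots> = inv_word G w \<cdot>\<^sub>W (incl j (inv\<^bsub>G j\<^esub> g) \<cdot>\<^sub>W (incl j g \<cdot>\<^sub>W w))"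
    using r' j incl_closed by (simp add: W.m_assoc)
  also have "\<dots> = inv_word G w \<cdot>\<^sub>W w"
    using j by (simp add: incl_mult_mult incl_one)
  finally show ?case using Cons j by simp
qed

lemma inv_word: "w \<in> RW \<Longrightarrow> inv\<^bsub>W\<^esub> w = inv_word G w"
  using inv_word_mult inv_word_reduced W.inv_equality by simp

lemma inv_word_inv_word: "w \<in> RW \<Longrightarrow> inv_word G (inv_word G w) = w"
  using inv_word inv_word_reduced W.inv_inv by (metis carrier_free_product)

lemma inv_word_append: "inv_word G (u @ v) = inv_word G v @ inv_word G u"
  by (simp add: inv_word_def)

text \<open>As neither \<open>u\<close> nor \<open>v\<close> starts with \<open>j\<close>, the
  middle letter neither merges nor cancels. This normal form is behind both the tree argument and
  malnormality.\<close>

lemma conjugate_reduced: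
  assumes "u \<in> RW" "v \<in> RW" "avoids j u" "avoids j v" "j \<in> I" "g \<in> carrier (G j)" "g \<noteq> \<one>\<^bsub>G j\<^esub>"
  shows "inv_word G u @ (j, g) # v \<in> RW"
proof -
  have "inv_word G u \<in> RW" by (rule inv_word_reduced[OF assms(1)])
  moreover have "(j, g) # v \<in> RW" using assms by (simp add: Cons_reduced_iff_avoids)
  moreover have "inv_word G u \<noteq> [] \<Longrightarrow> fst (last (inv_word G u)) \<noteq> j"
    using assms(3) by (cases u) (auto simp: inv_word_def avoids_def)
  ultimately show ?thesis
    by (auto simp: reduced_words_def distinct_adj_append_iff last_map)
qed

text \<open>A suffix-closed \<open>P\<close> is a connected region of the tree around the empty
  word. The word tested for \<open>j\<close> is the point nearest to \<open>inv w\<close> in the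
  coset of the factor \<open>j\<close> through \<open>u\<close>. If it lies outside
  \<open>P\<close>, then the path from the empty word to \<open>inv w\<close> leaves
  \<open>P\<close> right after \<open>u\<close>, by a letter of index \<open>j\<close>. A path has
  only one first exit, so two different pairs cannot both fail.\<close>

lemma tree_alternative:
  assumes suffix: "\<And>a u. P (a # u) \<Longrightarrow> P u"
    and "u \<in> RW" "v \<in> RW" "w \<in> RW" "j \<in> I" "k \<in> I"
    and "P u" "P v" "avoids j u" "avoids k v" "(j, u) \<noteq> (k, v)"
  shows "P (strip j (u \<cdot>\<^sub>W w) \<cdot>\<^sub>W inv\<^bsub>W\<^esub> w) \<or> P (strip k (v \<cdot>\<^sub>W w) \<cdot>\<^sub>W inv\<^bsub>W\<^esub> w)"
proof -
  have suffix': "P u'" if "P (u'' @ u')" for u' u''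
    using that by (induction u'') (auto dest: suffix)
  have canc: "u \<cdot>\<^sub>W w \<cdot>\<^sub>W inv\<^bsub>W\<^esub> w = u" if "u \<in> RW" for u
    using that assms(4) by (simp add: W.m_assoc)
  \<comment> \<open>Either stripping removes nothing and the nearest point is \<open>u\<close>
    itself, or the path to \<open>inv w\<close> continues from \<open>u\<close> with the letter
    \<open>inv g\<close> of index \<open>j\<close>.\<close>
  have split: "P (strip j (u \<cdot>\<^sub>W w) \<cdot>\<^sub>W inv\<^bsub>W\<^esub> w) \<or>
      (\<exists>g z. g \<in> carrier (G j) \<and> g \<noteq> \<one>\<^bsub>G j\<^esub> \<and> w = inv_word G u @ (j, g) # z \<and> avoids j z \<and> z \<in> RW \<and>
        strip j (u \<cdot>\<^sub>W w) \<cdot>\<^sub>W inv\<^bsub>W\<^esub> w = (j, inv\<^bsub>G j\<^esub> g) # u)"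
    if "j \<in> I" "u \<in> RW" "P u" "avoids j u" for j u
  proof (cases "avoids j (u \<cdot>\<^sub>W w)")
    case True
    then show ?thesis using that canc by (simp add: strip_avoids)
  next
    case False
    then obtain g z where gz: "u \<cdot>\<^sub>W w = (j, g) # z"
      by (cases "u \<cdot>\<^sub>W w") (auto simp: avoids_def)
    have r: "(j, g) # z \<in> RW" using that assms(4) gz[symmetric] by simp
    then have g: "g \<in> carrier (G j)" "g \<noteq> \<one>\<^bsub>G j\<^esub>" "avoids j z" "z \<in> RW"
      by (auto simp: Cons_reduced_iff_avoids)
    interpret Gj: group "G j" by (rule group_factor[OF that(1)])
    have "w = inv\<^bsub>W\<^esub> u \<cdot>\<^sub>W (u \<cdot>\<^sub>W w)"
      using that assms(4) by (simp add: W.m_assoc[symmetric])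
    also have "\<dots> = inv_word G u @ (j, g) # z"
      unfolding gz using append_eq_mult[OF conjugate_reduced[of u z j g]] that g by (simp add: inv_word)
    finally have w: "w = inv_word G u @ (j, g) # z" .
    have "incl j (inv\<^bsub>G j\<^esub> g) \<cdot>\<^sub>W (u \<cdot>\<^sub>W w) = z"
      unfolding gz Cons_eq_incl_mult[OF r] using that g
      by (simp add: incl_mult_mult incl_one)
    then have "strip j (u \<cdot>\<^sub>W w) \<cdot>\<^sub>W inv\<^bsub>W\<^esub> w = incl j (inv\<^bsub>G j\<^esub> g) \<cdot>\<^sub>W (u \<cdot>\<^sub>W w) \<cdot>\<^sub>W inv\<^bsub>W\<^esub> w"
      by (simp add: gz strip_def)
    also have "\<dots> = incl j (inv\<^bsub>G j\<^esub> g) \<cdot>\<^sub>W u"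
      using canc[OF that(2)] that assms(4) g incl_closed by (simp add: W.m_assoc)
    also have "\<dots> = (j, inv\<^bsub>G j\<^esub> g) # u"
      using that g by (simp add: incl_mult_avoids)
    finally show ?thesis using w g by blast
  qed
  show ?thesis
  proof (rule ccontr)
    assume neg: "\<not> ?thesis"
    obtain g z where g: "w = inv_word G u @ (j, g) # z" "g \<in> carrier (G j)" "\<not> P ((j, inv\<^bsub>G j\<^esub> g) # u)"
      using split[of j u] neg assms by metis
    obtain h y where h: "w = inv_word G v @ (k, h) # y" "h \<in> carrier (G k)" "\<not> P ((k, inv\<^bsub>G k\<^esub> h) # v)"
      using split[of k v] neg assms by metis
    \<comment> \<open>If \<open>u\<close> were shorter than \<open>v\<close>, the point just after
      the exit at \<open>u\<close> would be a suffix of \<open>v\<close>, hence in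
      \<open>P\<close>.\<close>
    have *: False if "length u < length v" "P v" "v \<in> RW" "u \<in> RW" "\<not> P ((j, inv\<^bsub>G j\<^esub> g) # u)"
      and eq: "inv_word G u @ (j, g) # z = inv_word G v @ (k, h) # y" for u v :: "('i \<times> 'g) list" and j k g h z y
    proof -
      have len: "length (inv_word G u) < length (inv_word G v)" using that(1) by (simp add: inv_word_def)
      obtain a where a: "inv_word G v = inv_word G u @ (j, g) # a"
      proof -
        have "inv_word G v = take (length (inv_word G v)) (inv_word G u @ (j, g) # z)"
                    unfolding eq by simp
        also have "\<dots> = inv_word G u @ (j, g) # take (length (inv_word G v) - length (inv_word G u) - 1) z"
          using len by (simp add: take_Cons' )
        finally show ?thesis using that by blast
      qed
      have "v = inv_word G (inv_word G u @ (j, g) # a)" using inv_word_inv_word[OF that(3)] a by simp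
      also have "\<dots> = inv_word G a @ ((j, inv\<^bsub>G j\<^esub> g) # u)"
        using inv_word_inv_word[OF that(4)] inv_word_append[of "inv_word G u" "(j, g) # a"]
        by (simp add: inv_word_def)
      finally have "P (inv_word G a @ ((j, inv\<^bsub>G j\<^esub> g) # u))" using that(2) by simp
      then show False using suffix' that(5) by blast
    qed
    have "length u = length v"
      using *[of u v j g z k h y] *[of v u k h y j g z] g h assms by (metis linorder_neqE_nat)
    then have "inv_word G u = inv_word G v \<and> j = k"
      using g(1) h(1) by (simp add: inv_word_def)
    then show False using inv_word_inv_word assms by metis
  qed
qed

text \<open>Malnormality of the factors. Up to an element of the factor, \<open>inv w\<close> is a
  word \<open>u\<close> not starting with \<open>j\<close>. Then \<open>incl k h\<close>, which has
  at most one letter, equals the reduced word \<open>inv_word G u @ (j, g') # u\<close>, so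
  \<open>u\<close> is empty.\<close>

lemma conjugate_in_factor:
  assumes "j \<in> I" "k \<in> I" "g \<in> carrier (G j)" "g \<noteq> \<one>\<^bsub>G j\<^esub>" "h \<in> carrier (G k)" "w \<in> RW"
    and eq: "w \<cdot>\<^sub>W incl j g = incl k h \<cdot>\<^sub>W w"
  shows "j = k" and "\<exists>a\<in>carrier (G j). w = incl j a"
proof -
  interpret Gj: group "G j" by (rule group_factor[OF assms(1)])
  have iw: "inv\<^bsub>W\<^esub> w \<in> RW" using assms by simp
  obtain a where a: "a \<in> carrier (G j)" "inv\<^bsub>W\<^esub> w = incl j a \<cdot>\<^sub>W strip j (inv\<^bsub>W\<^esub> w)"
    using incl_strip[OF assms(1) iw] by blast
  define u where "u = strip j (inv\<^bsub>W\<^esub> w)"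
  have u: "u \<in> RW" "avoids j u" unfolding u_def using iw by (auto intro: strip_reduced avoids_strip)
  have inv_incl: "inv\<^bsub>W\<^esub> (incl j a) = incl j (inv\<^bsub>G j\<^esub> a)"
    using a assms(1) incl_closed by (intro W.inv_equality) (simp_all add: incl_incl incl_one)
  have "w = inv\<^bsub>W\<^esub> (incl j a \<cdot>\<^sub>W u)" using a(2) assms(6) u_def W.inv_inv by (metis carrier_free_product)
  also have "\<dots> = inv\<^bsub>W\<^esub> u \<cdot>\<^sub>W incl j (inv\<^bsub>G j\<^esub> a)"
    using a(1) u assms(1) incl_closed by (simp add: W.inv_mult_group inv_incl)
  finally have w: "w = inv\<^bsub>W\<^esub> u \<cdot>\<^sub>W incl j (inv\<^bsub>G j\<^esub> a)" .
  define g' where "g' = inv\<^bsub>G j\<^esub> a \<otimes>\<^bsub>G j\<^esub> g \<otimes>\<^bsub>G j\<^esub> a"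
  have g': "g' \<in> carrier (G j)" "g' \<noteq> \<one>\<^bsub>G j\<^esub>"
  proof -
    show "g' \<in> carrier (G j)" using a assms by (simp add: g'_def)
    show "g' \<noteq> \<one>\<^bsub>G j\<^esub>"
    proof
      assume "g' = \<one>\<^bsub>G j\<^esub>"
      then have "a \<otimes>\<^bsub>G j\<^esub> g' \<otimes>\<^bsub>G j\<^esub> inv\<^bsub>G j\<^esub> a = \<one>\<^bsub>G j\<^esub>" using a by simp
      moreover have "a \<otimes>\<^bsub>G j\<^esub> g' \<otimes>\<^bsub>G j\<^esub> inv\<^bsub>G j\<^esub> a = g"
        using a assms by (simp add: g'_def Gj.m_assoc Gj.inv_solve_left)
          (simp add: Gj.m_assoc[symmetric])
      ultimately show False using assms by simp
    qed
  qed
  have "incl k h = w \<cdot>\<^sub>W incl j g \<cdot>\<^sub>W inv\<^bsub>W\<^esub> w"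
    using eq assms incl_closed by (simp add: W.m_assoc)
  also have "\<dots> = inv\<^bsub>W\<^esub> u \<cdot>\<^sub>W (incl j (inv\<^bsub>G j\<^esub> a) \<cdot>\<^sub>W (incl j g \<cdot>\<^sub>W (incl j a \<cdot>\<^sub>W u)))"
    using a u assms incl_closed by (subst w) (simp add: W.m_assoc u_def)
  also have "\<dots> = inv\<^bsub>W\<^esub> u \<cdot>\<^sub>W (incl j g' \<cdot>\<^sub>W u)"
    using a u assms by (simp add: incl_mult_mult g'_def Gj.m_assoc)
  also have "\<dots> = inv_word G u @ (j, g') # u"
    using append_eq_mult[OF conjugate_reduced[OF u(1) u(1) u(2) u(2) assms(1) g']] g' u
    by (simp add: incl_mult_avoids inv_word)
  finally have e: "inv_word G u @ (j, g') # u = (if h = \<one>\<^bsub>G k\<^esub> then [] else [(k, h)])"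
    by (simp add: free_product_incl_def)
  then have "u = []" "j = k" by (auto split: if_splits simp: inv_word_def Cons_eq_append_conv append_eq_Cons_conv)
  then show "j = k" by simp
  have "w = incl j (inv\<^bsub>G j\<^esub> a)" using w \<open>u = []\<close> a assms(1) incl_closed
    using W.inv_one by simp
  then show "\<exists>a\<in>carrier (G j). w = incl j a" using a by auto
qed

end


section \<open>Cocycles into a free product and rooted points of the Bass-Serre tree\<close>

text \<open>
  Seen from \<open>x0\<close>, a tree-like family of classes has at each point at most one class leading back
  to \<open>x0\<close>, and the value of \<open>\<gamma>\<close> on that class is not the point itself. Along a reduced cycle
  through \<open>x0\<close> every class leads away from \<open>x0\<close>, so the cycle cannot close.
\<close>

lemma freely_independent_gate:
  fixes Rs :: "'j \<Rightarrow> ('x \<times> 'x) set"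
  assumes sub: "\<And>i. i \<in> J \<Longrightarrow> Rs i \<subseteq> R" and sym: "\<And>i. i \<in> J \<Longrightarrow> sym (Rs i)" and R: "equiv X0 R"
    and gate: "\<And>x0. x0 \<in> X0 \<Longrightarrow> \<exists>\<gamma>.
      (\<forall>i\<in>J. \<forall>x y. (x, y) \<in> Rs i \<and> (x, x0) \<in> R \<longrightarrow> \<gamma> i x = \<gamma> i y) \<and>
      (\<forall>i\<in>J. x0 \<in> Domain (Rs i) \<longrightarrow> \<gamma> i x0 = x0) \<and>
      (\<forall>i\<in>J. \<forall>k\<in>J. \<forall>x. i \<noteq> k \<and> (x, x0) \<in> R \<and> x \<in> Domain (Rs i) \<and> x \<in> Domain (Rs k) \<longrightarrow>
        \<gamma> i x = x \<or> \<gamma> k x = x)"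
  shows "freely_independent J Rs"
  unfolding freely_independent_def
proof (intro notI, elim exE conjE)
  fix n :: nat and x :: "nat \<Rightarrow> 'x" and i :: "nat \<Rightarrow> 'j"
  assume n: "n \<ge> 2" "x n = x 1"
    and steps: "\<forall>k\<in>{1..<n}. i k \<in> J \<and> x k \<noteq> x (k + 1) \<and> (x k, x (k + 1)) \<in> Rs (i k)"
    and diff: "\<forall>k\<in>{1..<n - 1}. i k \<noteq> i (k + 1)"
  have "(x 1, x 2) \<in> R" using bspec[OF steps, of 1] n sub[of "i 1"] by (auto simp: numeral_2_eq_2)
  then have x1: "x 1 \<in> X0" using R by (auto simp: equiv_def refl_on_def)
  obtain \<gamma> where inv: "\<forall>i\<in>J. \<forall>x' y. (x', y) \<in> Rs i \<and> (x', x 1) \<in> R \<longrightarrow> \<gamma> i x' = \<gamma> i y"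
    and at_base: "\<forall>i\<in>J. x 1 \<in> Domain (Rs i) \<longrightarrow> \<gamma> i (x 1) = x 1"
    and alt: "\<forall>i\<in>J. \<forall>k\<in>J. \<forall>x'. i \<noteq> k \<and> (x', x 1) \<in> R \<and> x' \<in> Domain (Rs i) \<and> x' \<in> Domain (Rs k) \<longrightarrow>
        \<gamma> i x' = x' \<or> \<gamma> k x' = x'"
    using gate[OF x1] by (elim exE conjE)
  have inR: "(x k, x 1) \<in> R" if "k \<ge> 1" "k \<le> n" for k
    using that
  proof (induction k rule: dec_induct)
    case base
    then show ?case using R x1 by (auto simp: equiv_def refl_on_def)
  next
    case (step k)
    then have "(x k, x (Suc k)) \<in> R" "(x k, x 1) \<in> R"
      using bspec[OF steps, of k] sub[of "i k"] by auto
    moreover have "sym R" "trans R" using R by (auto simp: equiv_def)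
    ultimately show ?case by (meson symD transD)
  qed
  have fixed: "\<gamma> (i k) (x k) = x k" if "k \<ge> 1" "k < n" for k
    using that
  proof (induction k rule: dec_induct)
    case base
    then show ?case using bspec[OF steps, of 1] n at_base by auto
  next
    case (step k)
    have k: "i k \<in> J" "x k \<noteq> x (Suc k)" "(x k, x (Suc k)) \<in> Rs (i k)" "i (Suc k) \<in> J"
      "(x (Suc k), x (Suc (Suc k))) \<in> Rs (i (Suc k))" "i k \<noteq> i (Suc k)"
      using steps diff step by auto
    have "\<gamma> (i k) (x (Suc k)) = x k" using inv k(1,3) step inR[of k] by auto
    moreover have "x (Suc k) \<in> Domain (Rs (i k))" using symD[OF sym[OF k(1)] k(3)] by (rule DomainI)
    moreover have "x (Suc k) \<in> Domain (Rs (i (Suc k)))" using k(5) by (rule DomainI)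
    ultimately show ?case using alt k(1,2,4,6) inR[of "Suc k"] step by (metis le_SucI less_imp_le)
  qed
  define k where "k = n - 1"
  have k: "k \<ge> 1" "k < n" "Suc k = n" using n by (auto simp: k_def)
  then have s: "i k \<in> J" "x k \<noteq> x (Suc k)" "(x k, x (Suc k)) \<in> Rs (i k)" using steps by auto
  have "\<gamma> (i k) (x (Suc k)) = x k" using inv s(1,3) inR[of k] fixed[of k] k by force
  moreover have "x 1 \<in> Domain (Rs (i k))" using symD[OF sym[OF s(1)] s(3)] k n by auto
  ultimately show False using at_base s(1,2) k(3) n(2) by auto
qed

text \<open>Indices by a factor, a word and a number keep the family of pieces countable, as a free
  product decomposition requires.\<close>

datatype ('i, 'w) piece = Kernel | Local 'i 'w | Link 'i 'w nat

locale cocycle = group_family I G for I :: "'i set" and G :: "'i \<Rightarrow> 'g monoid" +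
  fixes X0 :: "'x set" and R :: "('x \<times> 'x) set" and \<sigma> :: "'x \<Rightarrow> 'x \<Rightarrow> ('i \<times> 'g) list"
  assumes equiv: "equiv X0 R"
    and \<sigma>_closed: "(x, y) \<in> R \<Longrightarrow> \<sigma> x y \<in> RW"
    and \<sigma>_mult: "(x, y) \<in> R \<Longrightarrow> (y, z) \<in> R \<Longrightarrow> \<sigma> x z = \<sigma> x y \<cdot>\<^sub>W \<sigma> y z"
begin

lemma R_refl: "x \<in> X0 \<Longrightarrow> (x, x) \<in> R"
  using equiv by (auto simp: equiv_def refl_on_def)

lemma R_dom: "(x, y) \<in> R \<Longrightarrow> x \<in> X0" "(x, y) \<in> R \<Longrightarrow> y \<in> X0"
  using equiv by (auto simp: equiv_def refl_on_def)

lemma R_sym: "(x, y) \<in> R \<Longrightarrow> (y, x) \<in> R"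
  using equiv by (auto simp: equiv_def sym_def)

lemma R_trans: "(x, y) \<in> R \<Longrightarrow> (y, z) \<in> R \<Longrightarrow> (x, z) \<in> R"
  using equiv by (auto simp: equiv_def elim: transE)

lemma \<sigma>_refl: "x \<in> X0 \<Longrightarrow> \<sigma> x x = []"
  using \<sigma>_mult[of x x x] R_refl[of x] \<sigma>_closed[of x x] W.l_cancel_one[of "\<sigma> x x" "\<sigma> x x"] by simp

lemma \<sigma>_inv: "(x, y) \<in> R \<Longrightarrow> inv\<^bsub>W\<^esub> \<sigma> x y = \<sigma> y x"
  using \<sigma>_mult[of y x y] \<sigma>_refl[of y] R_dom R_sym \<sigma>_closed by (intro W.inv_equality) auto

lemma mult_\<sigma>_\<sigma>:
  assumes "(x, y) \<in> R" "(y, z) \<in> R" "u \<in> RW"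
  shows "u \<cdot>\<^sub>W \<sigma> x y \<cdot>\<^sub>W \<sigma> y z = u \<cdot>\<^sub>W \<sigma> x z"
  using assms \<sigma>_closed \<sigma>_mult by (simp add: W.m_assoc)

text \<open>A pair \<open>(x, u)\<close> stands for the tree vertex with word \<open>u\<close>
  relative to \<open>x\<close>; it is the same vertex as
  \<open>(y, u \<cdot>\<^sub>W \<sigma> x y)\<close>. The relation says that two vertices lie in one
  coset of the factor \<open>j\<close>.\<close>

definition cl :: "'i \<Rightarrow> 'x \<Rightarrow> ('i \<times> 'g) list \<Rightarrow> 'x \<Rightarrow> ('i \<times> 'g) list \<Rightarrow> bool" where
  "cl j x u y v \<longleftrightarrow> (x, y) \<in> R \<and> (\<exists>g\<in>carrier (G j). u \<cdot>\<^sub>W \<sigma> x y = incl j g \<cdot>\<^sub>W v)"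

lemma cl_strip:
  assumes "cl j x u y v" "(x, z) \<in> R" "j \<in> I" "u \<in> RW" "v \<in> RW"
  shows "strip j (u \<cdot>\<^sub>W \<sigma> x z) = strip j (v \<cdot>\<^sub>W \<sigma> y z)"
proof -
  obtain g where g: "g \<in> carrier (G j)" "u \<cdot>\<^sub>W \<sigma> x y = incl j g \<cdot>\<^sub>W v" "(x, y) \<in> R"
    using assms(1) by (auto simp: cl_def)
  have yz: "(y, z) \<in> R" using g(3) assms(2) R_sym R_trans by blast
  have "u \<cdot>\<^sub>W \<sigma> x z = incl j g \<cdot>\<^sub>W v \<cdot>\<^sub>W \<sigma> y z"
    using mult_\<sigma>_\<sigma>[OF g(3) yz assms(4)] g(2) by simp
  also have "\<dots> = incl j g \<cdot>\<^sub>W (v \<cdot>\<^sub>W \<sigma> y z)"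
    using incl_closed[OF assms(3) g(1)] assms yz \<sigma>_closed by (simp add: W.m_assoc)
  finally show ?thesis using strip_incl_mult[OF assms(3) g(1)] assms yz \<sigma>_closed by simp
qed

lemma cl_refl: "x \<in> X0 \<Longrightarrow> j \<in> I \<Longrightarrow> u \<in> RW \<Longrightarrow> cl j x u x u"
  using group_factor[of j] R_refl \<sigma>_refl
  by (auto simp: cl_def incl_one intro!: bexI[of _ "\<one>\<^bsub>G j\<^esub>"] group.is_monoid monoid.one_closed)

lemma cl_trans:
  assumes "cl j x u y v" "cl j y v z w" "j \<in> I" "u \<in> RW" "v \<in> RW" "w \<in> RW"
  shows "cl j x u z w"
proof -
  obtain g where g: "g \<in> carrier (G j)" "u \<cdot>\<^sub>W \<sigma> x y = incl j g \<cdot>\<^sub>W v" "(x, y) \<in> R"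
    using assms(1) by (auto simp: cl_def)
  obtain h where h: "h \<in> carrier (G j)" "v \<cdot>\<^sub>W \<sigma> y z = incl j h \<cdot>\<^sub>W w" "(y, z) \<in> R"
    using assms(2) by (auto simp: cl_def)
  interpret Gj: group "G j" by (rule group_factor[OF assms(3)])
  have "u \<cdot>\<^sub>W \<sigma> x z = incl j g \<cdot>\<^sub>W v \<cdot>\<^sub>W \<sigma> y z"
    using mult_\<sigma>_\<sigma>[OF g(3) h(3) assms(4)] g(2) by simp
  also have "\<dots> = incl j (g \<otimes>\<^bsub>G j\<^esub> h) \<cdot>\<^sub>W w"
    using g h assms \<sigma>_closed incl_closed by (simp add: W.m_assoc incl_mult_mult)
  finally show ?thesis using g h R_trans by (auto simp: cl_def)
qed

lemma cl_sym:
  assumes "cl j x u y v" "j \<in> I" "u \<in> RW" "v \<in> RW"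
  shows "cl j y v x u"
proof -
  obtain g where g: "g \<in> carrier (G j)" "u \<cdot>\<^sub>W \<sigma> x y = incl j g \<cdot>\<^sub>W v" "(x, y) \<in> R"
    using assms(1) by (auto simp: cl_def)
  interpret Gj: group "G j" by (rule group_factor[OF assms(2)])
  have yx: "(y, x) \<in> R" using g R_sym by blast
  have "incl j g \<cdot>\<^sub>W (v \<cdot>\<^sub>W \<sigma> y x) = u \<cdot>\<^sub>W \<sigma> x y \<cdot>\<^sub>W \<sigma> y x"
    using g assms yx \<sigma>_closed incl_closed by (simp add: W.m_assoc)
  also have "\<dots> = u" using mult_\<sigma>_\<sigma>[OF g(3) yx assms(3)] assms \<sigma>_refl R_dom g by simp
  finally have "incl j (inv\<^bsub>G j\<^esub> g) \<cdot>\<^sub>W (incl j g \<cdot>\<^sub>W (v \<cdot>\<^sub>W \<sigma> y x)) = incl j (inv\<^bsub>G j\<^esub> g) \<cdot>\<^sub>W u"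
    by simp
  then show ?thesis
    using g assms yx \<sigma>_closed incl_mult_mult[of j "inv\<^bsub>G j\<^esub> g" g "v \<cdot>\<^sub>W \<sigma> y x"]
    by (auto simp: cl_def incl_one intro!: bexI[of _ "inv\<^bsub>G j\<^esub> g"])
qed

end

text \<open>
  \<open>P u x\<close> says that the vertex of the Bass-Serre tree with word \<open>u\<close> relative to \<open>x\<close> has root \<open>x\<close>.
  The suffix axiom makes the vertices rooted at \<open>x\<close> a connected region.
\<close>

locale rooted = cocycle I G X0 R \<sigma>
  for I :: "'i set" and G :: "'i \<Rightarrow> 'g monoid" and X0 :: "'x set" and R \<sigma> +
  fixes P :: "('i \<times> 'g) list \<Rightarrow> 'x \<Rightarrow> bool" and code :: "('i \<times> 'g) list \<Rightarrow> nat"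
  assumes P_dom: "P u x \<Longrightarrow> x \<in> X0 \<and> u \<in> RW"
    and P_unique: "P u x \<Longrightarrow> (x, y) \<in> R \<Longrightarrow> P (u \<cdot>\<^sub>W \<sigma> x y) y \<Longrightarrow> x = y"
    and P_ex: "x \<in> X0 \<Longrightarrow> u \<in> RW \<Longrightarrow> \<exists>y. (x, y) \<in> R \<and> P (u \<cdot>\<^sub>W \<sigma> x y) y"
    and P_ker: "x \<in> X0 \<Longrightarrow> \<exists>y. (x, y) \<in> R \<and> \<sigma> x y = [] \<and> P [] y"
    and P_suffix: "P (a # u) x \<Longrightarrow> P u x"
    and inj_code: "inj_on code RW"
begin

section \<open>Exits of a region and roots of vertices\<close>

text \<open>The region of \<open>x\<close> touches the coset of the factor \<open>j\<close> through
  \<open>u\<close>. The shortest representative of the coset lies in the region too, by the suffix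
  axiom, so a coset touched by a region has exactly one exit word there.\<close>

definition exit :: "'i \<Rightarrow> 'x \<Rightarrow> ('i \<times> 'g) list \<Rightarrow> bool" where
  "exit j x u \<longleftrightarrow> j \<in> I \<and> avoids j u \<and> P u x"

text \<open>Different regions touch a class of \<open>cl j\<close> with different words. The least
  code singles out one word per class, and the points meeting the class with that word are related
  by one conjugate of the factor.\<close>

definition min_exit :: "'i \<Rightarrow> 'x \<Rightarrow> ('i \<times> 'g) list \<Rightarrow> bool" where
  "min_exit j x u \<longleftrightarrow> exit j x u \<and> (\<forall>y v. exit j y v \<and> cl j x u y v \<longrightarrow> code u \<le> code v)"

lemma exitD: "exit j x u \<Longrightarrow> x \<in> X0 \<and> u \<in> RW \<and> j \<in> I \<and> avoids j u \<and> P u x"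
  using P_dom[of u x] by (auto simp: exit_def)

lemma min_exitD: "min_exit j x u \<Longrightarrow> exit j x u"
  by (simp add: min_exit_def)

lemma exit_strip: "P u x \<Longrightarrow> j \<in> I \<Longrightarrow> exit j x (strip j u)"
proof -
  assume a: "P u x" "j \<in> I"
  have "P (strip j u) x" using a P_suffix[of "hd u" "tl u" x] by (cases u) (auto simp: strip_def)
  moreover have "avoids j (strip j u)" using P_dom[OF a(1)] avoids_strip[of u I G j] by simp
  ultimately show ?thesis using a by (simp add: exit_def)
qed

lemma exit_unique: "exit j x u \<Longrightarrow> exit j x v \<Longrightarrow> cl j x u x v \<Longrightarrow> u = v"
proof -
  assume a: "exit j x u" "exit j x v" "cl j x u x v"
  then obtain g where "g \<in> carrier (G j)" "u = incl j g \<cdot>\<^sub>W v"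
    using \<sigma>_refl exitD[OF a(1)] by (auto simp: cl_def)
  then show "u = v"
    using strip_incl_mult[of j g v] exitD[OF a(1)] exitD[OF a(2)] by (simp add: strip_avoids)
qed

lemma min_exit_unique: "min_exit j x u \<Longrightarrow> min_exit j y v \<Longrightarrow> cl j x u y v \<Longrightarrow> u = v"
proof -
  assume a: "min_exit j x u" "min_exit j y v" "cl j x u y v"
  note e = exitD[OF min_exitD[OF a(1)]] exitD[OF min_exitD[OF a(2)]]
  have "cl j y v x u" using cl_sym a e by blast
  then have "code u = code v" using a unfolding min_exit_def by (meson order_antisym)
  then show "u = v" using e inj_code by (auto dest: inj_onD)
qed

lemma ex_min_exit:
  assumes "exit j x u"
  obtains y v where "min_exit j y v" "cl j x u y v"
proof -
  define A where "A = {n. \<exists>y v. n = code v \<and> exit j y v \<and> cl j x u y v}"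
  have "code u \<in> A" using assms cl_refl[of x j u] exitD[OF assms] unfolding A_def by blast
  then have "(LEAST n. n \<in> A) \<in> A" by (rule LeastI)
  then obtain y v where yv: "(LEAST n. n \<in> A) = code v" "exit j y v" "cl j x u y v" by (auto simp: A_def)
  have "code v \<le> code w" if "exit j z w" "cl j y v z w" for z w
  proof -
    have "cl j x u z w" using cl_trans[OF yv(3) that(2)] exitD[OF assms] exitD[OF that(1)] exitD[OF yv(2)] by blast
    then have "code w \<in> A" using that by (auto simp: A_def)
    then show ?thesis using yv(1) Least_le[of "\<lambda>n. n \<in> A"] by simp
  qed
  then have "min_exit j y v" using yv unfolding min_exit_def by blast
  then show ?thesis using that yv by blast
qed

definition root :: "'x \<Rightarrow> ('i \<times> 'g) list \<Rightarrow> 'x" where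
  "root x u = (SOME y. (x, y) \<in> R \<and> P (u \<cdot>\<^sub>W \<sigma> x y) y)"

lemma root:
  assumes "x \<in> X0" "u \<in> RW"
  shows "(x, root x u) \<in> R" "P (u \<cdot>\<^sub>W \<sigma> x (root x u)) (root x u)"
  using someI_ex[OF P_ex[OF assms]] by (auto simp: root_def)

lemma root_eq:
  assumes "(x, y) \<in> R" "u \<in> RW" "P (u \<cdot>\<^sub>W \<sigma> x y) y"
  shows "root x u = y"
proof -
  have x: "x \<in> X0" using assms R_dom by blast
  have yr: "(y, root x u) \<in> R" using root(1)[OF x assms(2)] assms(1) R_sym R_trans by blast
  have "P (u \<cdot>\<^sub>W \<sigma> x y \<cdot>\<^sub>W \<sigma> y (root x u)) (root x u)"
    using root(2)[OF x assms(2)] mult_\<sigma>_\<sigma>[OF assms(1) yr assms(2)] by simp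
  then show ?thesis using P_unique[OF assms(3) yr] by simp
qed

lemma root_change:
  assumes "(x, y) \<in> R" "u \<in> RW"
  shows "root y (u \<cdot>\<^sub>W \<sigma> x y) = root x u"
proof (rule root_eq)
  have x: "x \<in> X0" using assms R_dom by blast
  show yr: "(y, root x u) \<in> R" using root(1)[OF x assms(2)] assms(1) R_sym R_trans by blast
  show "P (u \<cdot>\<^sub>W \<sigma> x y \<cdot>\<^sub>W \<sigma> y (root x u)) (root x u)"
    using root(2)[OF x assms(2)] mult_\<sigma>_\<sigma>[OF assms(1) yr assms(2)] by simp
qed (use assms \<sigma>_closed in auto)

definition ker :: "('x \<times> 'x) set" where
  "ker = {(x, y) \<in> R. \<sigma> x y = []}"

lemma root_Nil_ker: "(x, y) \<in> ker \<Longrightarrow> root x [] = root y []"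
  using root_change[of x y "[]"] by (auto simp: ker_def Nil_reduced)

text \<open>The root of the vertex \<open>[]\<close> may differ from \<open>x\<close>, but only
  within the kernel class. Any other point of that class roots no vertex at all, since a region
  contains the empty word.\<close>

lemma root_Nil: "x \<in> X0 \<Longrightarrow> (x, root x []) \<in> ker"
  using P_ker[of x] root_eq[of x _ "[]"] by (auto simp: ker_def Nil_reduced)

lemma root_ker: "x \<in> X0 \<Longrightarrow> P [] x \<Longrightarrow> root x [] = x"
  using root_eq[of x x "[]"] R_refl \<sigma>_refl by (auto simp: Nil_reduced)

lemma exit_Nil: "exit j x u \<Longrightarrow> P [] x"
proof -
  assume "exit j x u"
  then have "P u x" by (simp add: exit_def)
  then show "P [] x" by (induction u) (blast dest: P_suffix)+
qed

text \<open>
  Seen from a base point \<open>x0\<close>, every class of \<open>cl j\<close> has a gate: the point of the class that is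
  nearest to \<open>x0\<close> in the Bass-Serre tree. \<open>gate_root\<close> is the root of the gate.
\<close>

definition gate_word :: "'x \<Rightarrow> 'i \<Rightarrow> 'x \<Rightarrow> ('i \<times> 'g) list \<Rightarrow> ('i \<times> 'g) list" where
  "gate_word x0 j x u = strip j (u \<cdot>\<^sub>W \<sigma> x x0)"

definition gate_root :: "'x \<Rightarrow> 'i \<Rightarrow> 'x \<Rightarrow> ('i \<times> 'g) list \<Rightarrow> 'x" where
  "gate_root x0 j x u = root x0 (gate_word x0 j x u)"

definition gate_exit :: "'x \<Rightarrow> 'i \<Rightarrow> 'x \<Rightarrow> ('i \<times> 'g) list \<Rightarrow> ('i \<times> 'g) list" where
  "gate_exit x0 j x u = strip j (gate_word x0 j x u \<cdot>\<^sub>W \<sigma> x0 (gate_root x0 j x u))"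

lemma gate_cong:
  assumes "cl j x u y v" "(x, x0) \<in> R" "j \<in> I" "u \<in> RW" "v \<in> RW"
  shows "gate_root x0 j x u = gate_root x0 j y v" "gate_exit x0 j x u = gate_exit x0 j y v"
  using cl_strip[OF assms] by (simp_all add: gate_root_def gate_exit_def gate_word_def)

lemma gate_word_closed: "u \<in> RW \<Longrightarrow> (x, x0) \<in> R \<Longrightarrow> gate_word x0 j x u \<in> RW"
  using \<sigma>_closed by (simp add: gate_word_def strip_reduced)

lemma gate_exit:
  assumes "exit j x u" "(x, x0) \<in> R"
  shows "exit j (gate_root x0 j x u) (gate_exit x0 j x u)"
    and "cl j x u (gate_root x0 j x u) (gate_exit x0 j x u)"
    and "(x0, gate_root x0 j x u) \<in> R"
proof -
  define r w where "r = gate_root x0 j x u" and "w = gate_word x0 j x u"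
  note u = exitD[OF assms(1)]
  have x0: "x0 \<in> X0" using assms R_dom by blast
  have w: "w \<in> RW" using u assms gate_word_closed by (simp add: w_def)
  have r: "(x0, r) \<in> R" "P (w \<cdot>\<^sub>W \<sigma> x0 r) r"
    using root[OF x0 w] by (simp_all add: r_def w_def gate_root_def)
  show "exit j (gate_root x0 j x u) (gate_exit x0 j x u)"
    using exit_strip[OF r(2)] u by (simp add: r_def w_def gate_exit_def)
  show "(x0, gate_root x0 j x u) \<in> R" using r by (simp add: r_def)
  have wr: "w \<cdot>\<^sub>W \<sigma> x0 r \<in> RW" using w r \<sigma>_closed by simp
  interpret Gj: group "G j" using group_factor u by blast
  obtain g where g: "g \<in> carrier (G j)" "u \<cdot>\<^sub>W \<sigma> x x0 = incl j g \<cdot>\<^sub>W w"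
    using incl_strip[of j "u \<cdot>\<^sub>W \<sigma> x x0"] u assms \<sigma>_closed by (auto simp: w_def gate_word_def)
  obtain h where h: "h \<in> carrier (G j)" "w \<cdot>\<^sub>W \<sigma> x0 r = incl j h \<cdot>\<^sub>W strip j (w \<cdot>\<^sub>W \<sigma> x0 r)"
    using incl_strip[of j "w \<cdot>\<^sub>W \<sigma> x0 r"] u wr by auto
  have "u \<cdot>\<^sub>W \<sigma> x r = incl j g \<cdot>\<^sub>W w \<cdot>\<^sub>W \<sigma> x0 r"
    using mult_\<sigma>_\<sigma>[OF assms(2) r(1), of u] u unfolding g(2)[symmetric] by simp
  also have "\<dots> = incl j g \<cdot>\<^sub>W (incl j h \<cdot>\<^sub>W strip j (w \<cdot>\<^sub>W \<sigma> x0 r))"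
    using w r(1) \<sigma>_closed incl_closed[of j g] u g(1) unfolding h(2)[symmetric]
    by (simp add: W.m_assoc)
  also have "\<dots> = incl j (g \<otimes>\<^bsub>G j\<^esub> h) \<cdot>\<^sub>W strip j (w \<cdot>\<^sub>W \<sigma> x0 r)"
    using incl_mult_mult[OF _ g(1) h(1) strip_reduced[OF wr]] u by blast
  finally have "\<exists>k\<in>carrier (G j). u \<cdot>\<^sub>W \<sigma> x r = incl j k \<cdot>\<^sub>W strip j (w \<cdot>\<^sub>W \<sigma> x0 r)"
    using g h by blast
  then show "cl j x u (gate_root x0 j x u) (gate_exit x0 j x u)"
    using R_trans[OF assms(2) r(1)] by (simp add: cl_def r_def w_def gate_exit_def)
qed

lemma gate_exit_eq:
  assumes "exit j x u" "(x, x0) \<in> R" "cl j x u (gate_root x0 j x u) v" "exit j (gate_root x0 j x u) v"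
  shows "gate_exit x0 j x u = v"
proof (rule exit_unique[OF gate_exit(1)[OF assms(1,2)] assms(4)])
  show "cl j (gate_root x0 j x u) (gate_exit x0 j x u) (gate_root x0 j x u) v"
    using cl_trans[OF cl_sym[OF gate_exit(2)[OF assms(1,2)]] assms(3)]
      exitD[OF assms(1)] exitD[OF assms(4)] exitD[OF gate_exit(1)[OF assms(1,2)]] by blast
qed

text \<open>This is \<open>tree_alternative\<close> for the region of \<open>x\<close> with
  \<open>w = \<sigma> x x0\<close>: relative to \<open>x\<close>, the vertex \<open>[]\<close> of
  the base point has the word \<open>inv w\<close>, so in one of the two cosets the nearest point is
  still rooted at \<open>x\<close>.\<close>

lemma gate_alternative:
  assumes "exit j x u" "exit k x v" "(j, u) \<noteq> (k, v)" "(x, x0) \<in> R"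
  shows "gate_root x0 j x u = x \<or> gate_root x0 k x v = x"
proof -
  have eq: "gate_root x0 j x u = x"
    if "exit j x u" "P (strip j (u \<cdot>\<^sub>W \<sigma> x x0) \<cdot>\<^sub>W inv\<^bsub>W\<^esub> \<sigma> x x0) x" for j u
  proof -
    have "u \<in> RW" using exitD[OF that(1)] by blast
    then show ?thesis
      unfolding gate_root_def
      using root_eq[OF R_sym[OF assms(4)] gate_word_closed] assms(4) that(2)
      by (simp add: \<sigma>_inv gate_word_def)
  qed
  note u = exitD[OF assms(1)] and v = exitD[OF assms(2)]
  have "P (strip j (u \<cdot>\<^sub>W \<sigma> x x0) \<cdot>\<^sub>W inv\<^bsub>W\<^esub> \<sigma> x x0) x \<or>
      P (strip k (v \<cdot>\<^sub>W \<sigma> x x0) \<cdot>\<^sub>W inv\<^bsub>W\<^esub> \<sigma> x x0) x"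
    by (rule tree_alternative[where P = "\<lambda>u. P u x", OF P_suffix])
      (use u v assms(3) \<sigma>_closed[OF assms(4)] in auto)
  then show ?thesis using eq[OF assms(1)] eq[OF assms(2)] by auto
qed

text \<open>Points of the kernel class of \<open>x0\<close> see the tree through the same words as
  \<open>x0\<close>. The whole class is covered because a kernel class containing \<open>x0\<close>
  has its gate at \<open>x0\<close>, so at its other points the second piece must be the one entered
  at \<open>x\<close>.\<close>

lemma gate_base:
  assumes "exit j x u" "(x, x0) \<in> ker"
  shows "gate_root x0 j x u = x"
proof (unfold gate_root_def, rule root_eq)
  note u = exitD[OF assms(1)]
  have x: "(x, x0) \<in> R" "\<sigma> x x0 = []" using assms by (auto simp: ker_def)
  then have s: "\<sigma> x0 x = []" using \<sigma>_inv[of x x0] W.inv_one by simp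
  show "(x0, x) \<in> R" using x R_sym by blast
  show "gate_word x0 j x u \<in> RW" using u x gate_word_closed by blast
  show "P (gate_word x0 j x u \<cdot>\<^sub>W \<sigma> x0 x) x"
    using u x s by (simp add: gate_word_def strip_avoids)
qed

end


section \<open>The free decomposition of an orbit relation induced by a cocycle\<close>

text \<open>\<open>m\<close> sends a point meeting a class with a non-minimal word to a point
  meeting it with the minimal one. Many points may be sent to the same target, and the target may
  itself be linked in another class. The index \<open>e\<close> cuts the linked points into parts on
  which the pairs \<open>{x, m j u x}\<close> are disjoint, so that linking is an equivalence
  relation.\<close>

locale linked = rooted I G X0 R \<sigma> P code
  for I :: "'i set" and G :: "'i \<Rightarrow> 'g monoid" and X0 :: "'x set" and R \<sigma> P code +
  fixes m :: "'i \<Rightarrow> ('i \<times> 'g) list \<Rightarrow> 'x \<Rightarrow> 'x"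
    and D :: "'i \<Rightarrow> ('i \<times> 'g) list \<Rightarrow> nat \<Rightarrow> 'x set"
  assumes m: "exit j x u \<Longrightarrow> \<not> min_exit j x u \<Longrightarrow>
      \<exists>v. min_exit j (m j u x) v \<and> cl j x u (m j u x) v"
    and D_exit: "x \<in> D j u e \<Longrightarrow> exit j x u \<and> \<not> min_exit j x u"
    and D_cover: "exit j x u \<Longrightarrow> \<not> min_exit j x u \<Longrightarrow> \<exists>e. x \<in> D j u e"
    and D_disjoint: "x \<in> D j u e \<Longrightarrow> x \<in> D j u e' \<Longrightarrow> e = e'"
    and m_inj: "inj_on (m j u) (D j u e)"
    and m_D: "D j u e \<inter> m j u ` D j u e = {}"
begin

text \<open>
  For a class of \<open>cl j\<close>, \<open>Local j u\<close> relates the points which meet it with the minimal word \<open>u\<close>,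
  while \<open>Link j u e\<close> ties a point meeting it with another word to one of these.
\<close>

fun piece_rel :: "('i, ('i \<times> 'g) list) piece \<Rightarrow> ('x \<times> 'x) set" where
  "piece_rel Kernel = ker"
| "piece_rel (Local j u) = {(x, y). min_exit j x u \<and> min_exit j y u \<and> cl j x u y u}"
| "piece_rel (Link j u e) =
    (\<Union>x\<in>D j u e. {x, m j u x} \<times> {x, m j u x})"

lemma D_m:
  assumes "x \<in> D j u e"
  obtains v where "min_exit j (m j u x) v" "cl j x u (m j u x) v" "(x, m j u x) \<in> R"
proof -
  obtain v where v: "min_exit j (m j u x) v" "cl j x u (m j u x) v"
    using m[of j x u] D_exit[OF assms] by blast
  then show thesis using that[OF v] by (simp add: cl_def)
qed

lemma D_cases:
  assumes "x \<in> D j u e" "y \<in> D j u e" "{x, m j u x} \<inter> {y, m j u y} \<noteq> {}"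
  shows "x = y"
proof -
  have "m j u x \<noteq> y" "x \<noteq> m j u y" using assms(1,2) m_D[of j u e] by blast+
  then have "x = y \<or> m j u x = m j u y" using assms(3) by blast
  then show ?thesis using inj_onD[OF m_inj _ assms(1,2)] by blast
qed

section \<open>The pieces are equivalence relations\<close>

lemma equiv_ker: "equiv X0 ker"
proof (rule equivI)
  show "ker \<subseteq> X0 \<times> X0" using R_dom unfolding ker_def by blast
  show "refl_on X0 ker" by (rule refl_onI) (simp add: ker_def R_refl \<sigma>_refl)
  show "sym ker"
  proof (rule symI)
    fix x y assume "(x, y) \<in> ker"
    then have "(x, y) \<in> R" "\<sigma> x y = []" by (auto simp: ker_def)
    then show "(y, x) \<in> ker" using \<sigma>_inv[of x y] R_sym[of x y] W.inv_one by (simp add: ker_def)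
  qed
  show "trans ker"
  proof (rule transI)
    fix x y z assume "(x, y) \<in> ker" "(y, z) \<in> ker"
    then have "(x, y) \<in> R" "(y, z) \<in> R" "\<sigma> x y = []" "\<sigma> y z = []" by (auto simp: ker_def)
    then show "(x, z) \<in> ker" using \<sigma>_mult[of x y z] R_trans[of x y z] by (simp add: ker_def)
  qed
qed

lemma piece_rel_subset: "piece_rel i \<subseteq> R"
proof (cases i)
  case (Link j u e)
  have "{x, m j u x} \<times> {x, m j u x} \<subseteq> R" if "x \<in> D j u e" for x
  proof -
    have "(x, m j u x) \<in> R" using D_m[OF that] by blast
    then show ?thesis using R_sym[of x "m j u x"] R_refl[of x] R_refl[of "m j u x"] R_dom[of x "m j u x"]
      by auto
  qed
  then show ?thesis by (auto simp: Link)
qed (auto simp: ker_def cl_def)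

lemma piece_rel_sym: "sym (piece_rel i)"
proof (cases i)
  case Kernel
  then show ?thesis using equiv_ker by (simp add: equiv_def)
next
  case (Local j u)
  show ?thesis
  proof (rule symI)
    fix x y assume "(x, y) \<in> piece_rel i"
    then have xy: "min_exit j x u" "min_exit j y u" "cl j x u y u" by (auto simp: Local)
    then show "(y, x) \<in> piece_rel i"
      using cl_sym[OF xy(3)] exitD[OF min_exitD[OF xy(1)]] by (simp add: Local)
  qed
qed (auto simp: sym_def)

lemma piece_rel_trans: "trans (piece_rel i)"
proof (cases i)
  case Kernel
  then show ?thesis using equiv_ker by (simp add: equiv_def)
next
  case (Local j u)
  show ?thesis
  proof (rule transI)
    fix x y z assume "(x, y) \<in> piece_rel i" "(y, z) \<in> piece_rel i"
    then have xy: "min_exit j x u" "min_exit j z u" "cl j x u y u" "cl j y u z u" by (auto simp: Local)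
    then show "(x, z) \<in> piece_rel i"
      using cl_trans[OF xy(3,4)] exitD[OF min_exitD[OF xy(1)]] by (simp add: Local)
  qed
next
  case (Link j u e)
  show ?thesis
  proof (rule transI)
    fix x y z assume "(x, y) \<in> piece_rel i" "(y, z) \<in> piece_rel i"
    then obtain a b where "a \<in> D j u e" "b \<in> D j u e" "x \<in> {a, m j u a}" "y \<in> {a, m j u a}"
      "y \<in> {b, m j u b}" "z \<in> {b, m j u b}"
      by (auto simp: Link)
    moreover from this have "a = b" using D_cases[of a j u e b] by blast
    ultimately show "(x, z) \<in> piece_rel i" by (auto simp: Link)
  qed
qed

lemma equiv_piece_rel: "equiv (Domain (piece_rel i)) (piece_rel i)"
proof (rule equivI)
  show "piece_rel i \<subseteq> Domain (piece_rel i) \<times> Domain (piece_rel i)"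
    using piece_rel_sym[of i] by (auto dest: symD)
  show "refl_on (Domain (piece_rel i)) (piece_rel i)"
  proof (rule refl_onI)
    fix x assume "x \<in> Domain (piece_rel i)"
    then obtain y where y: "(x, y) \<in> piece_rel i" by blast
    show "(x, x) \<in> piece_rel i"
      using transD[OF piece_rel_trans y symD[OF piece_rel_sym y]] .
  qed
qed (rule piece_rel_sym piece_rel_trans)+

section \<open>Gates of the pieces and free independence\<close>

definition anchor :: "'i \<Rightarrow> ('i \<times> 'g) list \<Rightarrow> nat \<Rightarrow> 'x \<Rightarrow> 'x" where
  "anchor j u e x = (THE a. a \<in> D j u e \<and> x \<in> {a, m j u a})"

lemma anchor:
  assumes "a \<in> D j u e" "x \<in> {a, m j u a}"
  shows "anchor j u e x = a"
  unfolding anchor_def using assms D_cases[of _ j u e a] by (intro the_equality) blast+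

text \<open>A class of \<open>cl j\<close> is a star: the points meeting it minimally form the
  centre, which is one \<open>Local\<close> class, and each other point hangs on it by a
  \<open>Link\<close>. If the star is entered at a hanging point \<open>r\<close>, the link of
  \<open>r\<close> is entered at \<open>r\<close> and the centre at \<open>m j v r\<close>; all
  other links are entered from the centre. In a kernel class only the root can lie in other pieces,
  so it is the entrance unless \<open>x0\<close> belongs to the class.\<close>

fun gate :: "'x \<Rightarrow> ('i, ('i \<times> 'g) list) piece \<Rightarrow> 'x \<Rightarrow> 'x" where
  "gate x0 Kernel x = (if (x, x0) \<in> ker then x0 else root x [])"
| "gate x0 (Local j u) x =
    (let r = gate_root x0 j x u; v = gate_exit x0 j x u in if min_exit j r v then r else m j v r)"
| "gate x0 (Link j u e) x =
    (let a = anchor j u e x in if gate_root x0 j a u = a then a else m j u a)"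

lemma gate_class:
  assumes "(x, y) \<in> piece_rel i" "(x, x0) \<in> R"
  shows "gate x0 i x = gate x0 i y"
proof (cases i)
  case Kernel
  then have "(x, y) \<in> ker" using assms by simp
  moreover from this have "(x, x0) \<in> ker \<longleftrightarrow> (y, x0) \<in> ker"
  proof -
    have "sym ker" "trans ker" using equiv_ker by (auto simp: equiv_def)
    then show ?thesis using \<open>(x, y) \<in> ker\<close> by (meson symD transD)
  qed
  ultimately show ?thesis using root_Nil_ker by (simp add: Kernel)
next
  case (Local j u)
  then have *: "min_exit j x u" "min_exit j y u" "cl j x u y u" using assms by auto
  note u = exitD[OF min_exitD[OF *(1)]]
  show ?thesis using gate_cong[OF *(3) assms(2)] u by (simp add: Local)
next
  case (Link j u e)
  then obtain a where "a \<in> D j u e" "x \<in> {a, m j u a}" "y \<in> {a, m j u a}" using assms by auto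
  then show ?thesis using anchor by (simp add: Link)
qed

lemma piece_exit:
  assumes "x \<in> Domain (piece_rel i)" "i \<noteq> Kernel"
  obtains j u where "exit j x u" "i = Local j u" "min_exit j x u"
  | j u e where "exit j x u" "i = Link j u e" "x \<in> D j u e"
  | j u e a v where "exit j x v" "i = Link j u e" "a \<in> D j u e" "x = m j u a" "min_exit j x v"
      "cl j a u x v"
proof (cases i)
  case Kernel
  then show ?thesis using assms by simp
next
  case (Local j u)
  then show ?thesis using assms that(1) by (auto dest: min_exitD)
next
  case (Link j u e)
  then obtain a where a: "a \<in> D j u e" "x \<in> {a, m j u a}" using assms by auto
  show ?thesis
  proof (cases "x = a")
    case True
    then show ?thesis using that(2)[of j u e] a Link D_exit[of x j u e] by blast
  next
    case False
    then have "x = m j u a" using a by simp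
    obtain v where v: "min_exit j (m j u a) v" "cl j a u (m j u a) v"
      using D_m[OF a(1)] by blast
    show ?thesis
      by (rule that(3)[of j v u e a])
        (use v a(1) \<open>x = m j u a\<close> Link min_exitD in blast)+
  qed
qed

text \<open>The piece \<open>i\<close> is part of the star that \<open>x\<close> meets with the word
  \<open>v\<close>. For a link this is true at both of its ends, with different words.\<close>

definition piece_at :: "('i, ('i \<times> 'g) list) piece \<Rightarrow> 'i \<Rightarrow> 'x \<Rightarrow> ('i \<times> 'g) list \<Rightarrow> bool" where
  "piece_at i j x v \<longleftrightarrow> exit j x v \<and> (i = Local j v \<and> min_exit j x v
    \<or> (\<exists>e. i = Link j v e \<and> x \<in> D j v e)
    \<or> (\<exists>u e a. i = Link j u e \<and> a \<in> D j u e \<and> x = m j u a \<and> min_exit j x v \<and> cl j a u x v))"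

lemma piece_at_exit: "piece_at i j x v \<Longrightarrow> exit j x v"
  by (simp add: piece_at_def)

lemma ex_piece_at:
  assumes "x \<in> Domain (piece_rel i)" "i \<noteq> Kernel"
  shows "\<exists>j v. piece_at i j x v"
  using assms by (rule piece_exit) (auto simp: piece_at_def)

text \<open>If a star is entered at \<open>x\<close>, each of its pieces through \<open>x\<close> is
  entered at \<open>x\<close>.\<close>

lemma gate_of_gate_root:
  assumes "piece_at i j x v" "gate_root x0 j x v = x" "(x, x0) \<in> R"
  shows "gate x0 i x = x"
proof -
  have ex: "exit j x v" using assms by (simp add: piece_at_def)
  note v = exitD[OF ex]
  consider "i = Local j v" "min_exit j x v" | e where "i = Link j v e" "x \<in> D j v e"
    | u e a where "i = Link j u e" "a \<in> D j u e" "x = m j u a" "min_exit j x v" "cl j a u x v"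
    using assms(1) by (auto simp: piece_at_def)
  then show ?thesis
  proof cases
    case 1
    have "gate_exit x0 j x v = v"
      using gate_exit_eq[OF ex assms(3), of v] assms(2) ex cl_refl v by simp
    then show ?thesis using 1 assms(2) by simp
  next
    case 2
    then show ?thesis using anchor[of x j v e x] assms(2) by simp
  next
    case 3
    have a: "exit j a u" "(a, x0) \<in> R"
      using D_exit[OF 3(2)] 3(5) assms(3) R_trans by (auto simp: cl_def)
    have "gate_root x0 j a u = x"
      using gate_cong(1)[OF 3(5) a(2)] exitD[OF a(1)] v assms(2) by simp
    moreover have "x \<noteq> a"
    proof
      assume "x = a"
      then have "a \<in> m j u ` D j u e" using 3(2,3) by (metis imageI)
      then show False using 3(2) m_D[of j u e] by blast
    qed
    ultimately show ?thesis using anchor[OF 3(2), of x] 3 by simp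
  qed
qed

text \<open>Both pieces belong to one star. A hanging point lies on only one of its links. At a
  point of the centre at most one link leads back to \<open>x0\<close>, the one of the entry point
  of the star, and in that case the centre is entered at \<open>x\<close>.\<close>

lemma gate_two_pieces:
  assumes "piece_at i j x v" "piece_at k j x v" "i \<noteq> k" "(x, x0) \<in> R"
  shows "gate x0 i x = x \<or> gate x0 k x = x"
proof -
  have ex: "exit j x v" using assms by (simp add: piece_at_def)
  note v = exitD[OF ex]
  have link: "gate x0 (Link j u e) x = x \<or> gate_root x0 j x v = a \<and> gate_exit x0 j x v = u"
    if "a \<in> D j u e" "x = m j u a" "cl j a u x v" for a u e
  proof -
    have a: "exit j a u" "(a, x0) \<in> R"
      using D_exit[OF that(1)] that(3) assms(4) R_trans by (auto simp: cl_def)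
    note u = exitD[OF a(1)]
    have eq: "gate_root x0 j a u = gate_root x0 j x v" "gate_exit x0 j a u = gate_exit x0 j x v"
      using gate_cong[OF that(3) a(2)] u v by simp_all
    show ?thesis
    proof (cases "gate_root x0 j a u = a")
      case True
      then have "gate_exit x0 j a u = u"
        using gate_exit_eq[OF a, of u] a cl_refl u by simp
      then show ?thesis using eq True by simp
    next
      case False
      then show ?thesis using anchor[OF that(1), of x] that(2) by simp
    qed
  qed
  show ?thesis
  proof (cases "min_exit j x v")
    case False
    then obtain e e' where "i = Link j v e" "x \<in> D j v e" "k = Link j v e'" "x \<in> D j v e'"
      using assms by (auto simp: piece_at_def)
    then show ?thesis using D_disjoint assms(3) by blast
  next
    case True
    then have not_D: "x \<notin> D j v e" for e using D_exit by blast
    have one: "gate x0 (Local j v) x = x \<or> gate x0 (Link j u e) x = x"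
      if "a \<in> D j u e" "x = m j u a" "cl j a u x v" for a u e
      using link[OF that] D_exit[OF that(1)] that(2) by (auto simp: Let_def)
    have two: "gate x0 (Link j u e) x = x \<or> gate x0 (Link j u' e') x = x"
      if "a \<in> D j u e" "x = m j u a" "cl j a u x v" "a' \<in> D j u' e'" "x = m j u' a'" "cl j a' u' x v"
        "Link j u e \<noteq> (Link j u' e' :: ('i, ('i \<times> 'g) list) piece)" for a u e a' u' e'
      using link[OF that(1-3)] link[OF that(4-6)] that(1,4,7) D_disjoint[of a j u e e'] by auto
    have shape: "p = Local j v \<or> (\<exists>a u e. p = Link j u e \<and> a \<in> D j u e \<and> x = m j u a \<and> cl j a u x v)"
      if "piece_at p j x v" for p
      using that not_D unfolding piece_at_def by blast
    show ?thesis
      using shape[OF assms(1)] shape[OF assms(2)]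
    proof (elim disjE exE conjE)
      assume "i = Local j v" "k = Local j v"
      then show ?thesis using assms(3) by simp
    next
      fix a u e assume "i = Local j v" "k = Link j u e" "a \<in> D j u e" "x = m j u a" "cl j a u x v"
      then show ?thesis using one by blast
    next
      fix a u e assume "k = Local j v" "i = Link j u e" "a \<in> D j u e" "x = m j u a" "cl j a u x v"
      then show ?thesis using one by blast
    next
      fix a u e a' u' e'
      assume *: "i = Link j u e" "a \<in> D j u e" "x = m j u a" "cl j a u x v"
        "k = Link j u' e'" "a' \<in> D j u' e'" "x = m j u' a'" "cl j a' u' x v"
      show ?thesis using two[OF *(2-4) *(6-8)] assms(3) *(1,5) by blast
    qed
  qed
qed

text \<open>Two pieces through \<open>x\<close> lie in different stars
  (\<open>gate_alternative\<close>), in one star (\<open>gate_two_pieces\<close>), or one of them is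
  the kernel. In the last case, the other piece is entered at \<open>x\<close> if \<open>x0\<close>
  is in the kernel class of \<open>x\<close>; if not, the kernel class is entered at its root, which
  is \<open>x\<close>.\<close>

theorem freely_independent_piece_rel: "freely_independent J piece_rel"
proof (rule freely_independent_gate[OF piece_rel_subset piece_rel_sym equiv])
  fix x0 assume x0: "x0 \<in> X0"
  have base: "gate x0 i x0 = x0" if dom: "x0 \<in> Domain (piece_rel i)" for i
  proof (cases "i = Kernel")
    case True
    then show ?thesis using x0 equiv_ker by (auto simp: equiv_def refl_on_def)
  next
    case False
    then obtain j v where j: "piece_at i j x0 v" using ex_piece_at[OF dom False] by blast
    have "gate_root x0 j x0 v = x0"
      using j x0 equiv_ker by (intro gate_base) (auto simp: piece_at_def equiv_def refl_on_def)
    then show ?thesis using gate_of_gate_root[OF j _ R_refl[OF x0]] by blast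
  qed
  have alt: "gate x0 i x = x \<or> gate x0 k x = x"
    if ik: "i \<noteq> k" and xx0: "(x, x0) \<in> R" and dom_i: "x \<in> Domain (piece_rel i)"
      and dom_k: "x \<in> Domain (piece_rel k)" for i k x
  proof -
    have ker: "gate x0 Kernel x = x \<or> gate x0 k x = x"
      if k: "k \<noteq> Kernel" and dom: "x \<in> Domain (piece_rel k)" for k
    proof -
      obtain j v where j: "piece_at k j x v" using ex_piece_at[OF dom k] by blast
      have ex: "exit j x v" using j by (simp add: piece_at_def)
      show ?thesis
      proof (cases "(x, x0) \<in> ker")
        case True
        then show ?thesis using gate_of_gate_root[OF j gate_base[OF ex True] xx0] by blast
      next
        case False
        then show ?thesis using root_ker[OF _ exit_Nil[OF ex]] exitD[OF ex] by simp
      qed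
    qed
    show ?thesis
    proof (cases "i = Kernel \<or> k = Kernel")
      case True
      then show ?thesis using ker[of k] ker[of i] ik dom_i dom_k by blast
    next
      case False
      then obtain j v j' v' where at: "piece_at i j x v" "piece_at k j' x v'"
        using ex_piece_at[OF dom_i] ex_piece_at[OF dom_k] by blast
      show ?thesis
      proof (cases "(j, v) = (j', v')")
        case True
        then show ?thesis using gate_two_pieces[OF at(1) _ ik xx0] at(2) by simp
      next
        case False
        then show ?thesis
          using gate_alternative[OF piece_at_exit[OF at(1)] piece_at_exit[OF at(2)] False xx0]
            gate_of_gate_root[OF at(1) _ xx0] gate_of_gate_root[OF at(2) _ xx0] by blast
      qed
    qed
  qed
  show "\<exists>\<gamma>. (\<forall>i\<in>J. \<forall>x y. (x, y) \<in> piece_rel i \<and> (x, x0) \<in> R \<longrightarrow> \<gamma> i x = \<gamma> i y) \<and>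
      (\<forall>i\<in>J. x0 \<in> Domain (piece_rel i) \<longrightarrow> \<gamma> i x0 = x0) \<and>
      (\<forall>i\<in>J. \<forall>k\<in>J. \<forall>x. i \<noteq> k \<and> (x, x0) \<in> R \<and> x \<in> Domain (piece_rel i) \<and> x \<in> Domain (piece_rel k) \<longrightarrow>
        \<gamma> i x = x \<or> \<gamma> k x = x)"
  proof (intro exI[of _ "gate x0"] conjI ballI allI impI)
    show "gate x0 i x = gate x0 i y" if "(x, y) \<in> piece_rel i \<and> (x, x0) \<in> R" for i x y
      using gate_class that by blast
    show "gate x0 i x0 = x0" if "x0 \<in> Domain (piece_rel i)" for i
      using base that by blast
    show "gate x0 i x = x \<or> gate x0 k x = x"
      if "i \<noteq> k \<and> (x, x0) \<in> R \<and> x \<in> Domain (piece_rel i) \<and> x \<in> Domain (piece_rel k)" for i k x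
      using alt[of i k x] that by blast
  qed
qed

text \<open>
  The roots of two points of the Bass-Serre tree which are equivalent under one factor are joined
  by pieces; walking along the word \<open>\<sigma> x y\<close> then joins \<open>x\<close> to \<open>y\<close>.
\<close>

definition gen :: "('x \<times> 'x) set" where
  "gen = (\<Union>i. piece_rel i)\<^sup>+"

lemma gen_piece: "(x, y) \<in> piece_rel i \<Longrightarrow> (x, y) \<in> gen"
  by (auto simp: gen_def)

lemma gen_trans: "(x, y) \<in> gen \<Longrightarrow> (y, z) \<in> gen \<Longrightarrow> (x, z) \<in> gen"
  by (auto simp: gen_def)

lemma gen_sym: "(x, y) \<in> gen \<Longrightarrow> (y, x) \<in> gen"
proof -
  have "sym (\<Union>i. piece_rel i)" using piece_rel_sym by (auto simp: sym_def)
  then show "(x, y) \<in> gen \<Longrightarrow> (y, x) \<in> gen" unfolding gen_def by (blast dest: symD[OF sym_trancl])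
qed

text \<open>Each end is in the centre of the star or linked to it, and the centre is a single
  \<open>Local\<close> class.\<close>

lemma gen_exit:
  assumes "exit j x u" "exit j y v" "cl j x u y v"
  shows "(x, y) \<in> gen"
proof -
  have move: "\<exists>y v. (x, y) \<in> gen \<and> min_exit j y v \<and> cl j x u y v" if ex: "exit j x u" for x u
  proof (cases "min_exit j x u")
    case True
    have r: "cl j x u x u" using cl_refl[of x j u] exitD[OF ex] by blast
    then have "(x, x) \<in> piece_rel (Local j u)" using True by simp
    then show ?thesis using True r gen_piece[of x x "Local j u"] by blast
  next
    case False
    then obtain e where e: "x \<in> D j u e" using D_cover[OF ex False] by blast
    then have "(x, m j u x) \<in> piece_rel (Link j u e)" by auto
    then show ?thesis using m[OF ex False] gen_piece[of x "m j u x" "Link j u e"] by blast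
  qed
  obtain x' u' where x': "(x, x') \<in> gen" "min_exit j x' u'" "cl j x u x' u'" using move assms(1) by blast
  obtain y' v' where y': "(y, y') \<in> gen" "min_exit j y' v'" "cl j y v y' v'" using move assms(2) by blast
  note d = exitD[OF assms(1)] exitD[OF assms(2)] exitD[OF min_exitD[OF x'(2)]] exitD[OF min_exitD[OF y'(2)]]
  have "cl j x' u' y v" using cl_trans[OF cl_sym[OF x'(3)] assms(3)] d by blast
  then have c: "cl j x' u' y' v'" using cl_trans[OF _ y'(3)] d by blast
  then have "(x', y') \<in> piece_rel (Local j u')"
    using min_exit_unique[OF x'(2) y'(2)] x' y' by auto
  then have "(x', y') \<in> gen" by (rule gen_piece)
  then show ?thesis using x'(1) gen_sym[OF y'(1)] gen_trans by blast
qed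

lemma gen_root:
  assumes "x \<in> X0" "j \<in> I" "g \<in> carrier (G j)" "u \<in> RW"
  shows "(root x (incl j g \<cdot>\<^sub>W u), root x u) \<in> gen"
proof -
  interpret Gj: group "G j" by (rule group_factor[OF assms(2)])
  have shift: "cl j x u (root x u) (strip j (u \<cdot>\<^sub>W \<sigma> x (root x u))) \<and>
      exit j (root x u) (strip j (u \<cdot>\<^sub>W \<sigma> x (root x u)))" if "u \<in> RW" for u
  proof -
    note r = root[OF assms(1) that]
    have w: "u \<cdot>\<^sub>W \<sigma> x (root x u) \<in> RW" using that r \<sigma>_closed by simp
    obtain h where "h \<in> carrier (G j)"
      "u \<cdot>\<^sub>W \<sigma> x (root x u) = incl j h \<cdot>\<^sub>W strip j (u \<cdot>\<^sub>W \<sigma> x (root x u))"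
      using incl_strip[OF assms(2) w] by blast
    then show ?thesis using r exit_strip[OF r(2) assms(2)] by (auto simp: cl_def)
  qed
  have gu: "incl j g \<cdot>\<^sub>W u \<in> RW" using assms incl_closed by simp
  have "cl j x (incl j g \<cdot>\<^sub>W u) x u"
    using assms R_refl[OF assms(1)] \<sigma>_refl[OF assms(1)] gu unfolding cl_def
    by (auto intro!: bexI[of _ g])
  note su = shift[OF assms(4)] and sgu = shift[OF gu]
  note r = exitD[OF conjunct2[OF su]] exitD[OF conjunct2[OF sgu]]
  have "cl j x (incl j g \<cdot>\<^sub>W u) (root x u) (strip j (u \<cdot>\<^sub>W \<sigma> x (root x u)))"
    using cl_trans[OF \<open>cl j x _ x u\<close> conjunct1[OF su]] assms gu r by blast
  then show ?thesis
    using gen_exit[OF conjunct2[OF sgu] conjunct2[OF su]]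
      cl_trans[OF cl_sym[OF conjunct1[OF sgu]]] assms gu r by blast
qed

theorem gen_eq: "gen = R"
proof
  show "gen \<subseteq> R"
  proof -
    have "(\<Union>i. piece_rel i) \<subseteq> R" using piece_rel_subset by blast
    then have "gen \<subseteq> R\<^sup>+" unfolding gen_def by (auto intro: trancl_mono)
    then show ?thesis using equiv by (simp add: equiv_def trancl_id)
  qed
  have walk: "(root x u, root x []) \<in> gen" if "x \<in> X0" "u \<in> RW" for x u
    using that(2)
  proof (induction u)
    case Nil
    have "root x [] \<in> X0" using root(1)[OF that(1) Nil] R_dom by blast
    then show ?case using equiv_ker gen_piece[of _ _ Kernel] by (auto simp: equiv_def refl_on_def)
  next
    case (Cons a u)
    obtain j g where a: "a = (j, g)" by (cases a)
    have "j \<in> I" "g \<in> carrier (G j)" "u \<in> RW" using Cons.prems by (auto simp: a Cons_reduced_iff)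
    then show ?case
      using gen_trans[OF gen_root[OF that(1)] Cons.IH] Cons_eq_incl_mult[of j g u] Cons.prems
      unfolding a by simp
  qed
  have hair: "(x, root x []) \<in> gen" if "x \<in> X0" for x
    using root_Nil[OF that] gen_piece[of _ _ Kernel] by simp
  show "R \<subseteq> gen"
  proof clarify
    fix x y assume xy: "(x, y) \<in> R"
    have "root y ([] \<cdot>\<^sub>W \<sigma> x y) = root x []" by (rule root_change[OF xy Nil_reduced])
    then have "(root x [], root y []) \<in> gen"
      using walk[of y "\<sigma> x y"] R_dom[OF xy] \<sigma>_closed[OF xy] by simp
    then show "(x, y) \<in> gen"
      using hair[of x] hair[of y] R_dom[OF xy] gen_trans gen_sym by blast
  qed
qed

end


section \<open>Probability measure preserving actions\<close>

lemma orbit_relation_iff_orbit: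
  "(x, y) \<in> orbit_relation \<Gamma> M \<phi> \<longleftrightarrow> x \<in> space M \<and> (\<exists>g\<in>carrier \<Gamma>. y = \<phi> g x)"
  by (auto simp: orbit_relation_def orbit_def)

locale pmp_action =
  fixes \<Gamma> :: "'g monoid" and M :: "'x::polish_space measure" and \<phi> :: "'g \<Rightarrow> 'x \<Rightarrow> 'x"
  assumes free_pmp: "free_pmp_action \<Gamma> M \<phi>" and countable_group: "countable (carrier \<Gamma>)"
begin

lemma sets_M [simp]: "sets M = sets borel" and space_M [simp]: "space M = UNIV"
  and prob_M: "prob_space M" and nonatomic_M: "nonatomic M"
  using free_pmp sets_eq_imp_space_eq[of M borel]
  by (auto simp: free_pmp_action_def standard_prob_space_def)

sublocale prob_space M by (rule prob_M)

sublocale group_action \<Gamma> UNIV \<phi>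
  using free_pmp by (simp add: free_pmp_action_def)

sublocale group \<Gamma>
  using group_hom by (rule group_hom.axioms)

lemma act_one [simp]: "\<phi> \<one>\<^bsub>\<Gamma>\<^esub> x = x"
  using id_eq_one by (metis UNIV_I restrict_apply')

lemma act_mult: "g \<in> carrier \<Gamma> \<Longrightarrow> h \<in> carrier \<Gamma> \<Longrightarrow> \<phi> (g \<otimes>\<^bsub>\<Gamma>\<^esub> h) x = \<phi> g (\<phi> h x)"
  using composition_rule by simp

lemma act_inv [simp]:
  "g \<in> carrier \<Gamma> \<Longrightarrow> \<phi> (inv\<^bsub>\<Gamma>\<^esub> g) (\<phi> g x) = x" "g \<in> carrier \<Gamma> \<Longrightarrow> \<phi> g (\<phi> (inv\<^bsub>\<Gamma>\<^esub> g) x) = x"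
  by (simp_all add: act_mult[symmetric])

lemma act_measurable [measurable]: "g \<in> carrier \<Gamma> \<Longrightarrow> \<phi> g \<in> measurable M M"
  using free_pmp by (simp add: free_pmp_action_def)

lemma act_vimage: "g \<in> carrier \<Gamma> \<Longrightarrow> A \<in> sets M \<Longrightarrow> \<phi> g -` A \<in> sets M"
  using measurable_sets[OF act_measurable] by fastforce

lemma emeasure_act_vimage:
  assumes "g \<in> carrier \<Gamma>" "A \<in> sets M"
  shows "emeasure M (\<phi> g -` A) = emeasure M A"
proof -
  have "distr M M (\<phi> g) = M" using assms free_pmp by (simp add: free_pmp_action_def)
  then show ?thesis using emeasure_distr[OF act_measurable[OF assms(1)] assms(2)] by simp
qed

lemma act_image: "g \<in> carrier \<Gamma> \<Longrightarrow> \<phi> g ` A = \<phi> (inv\<^bsub>\<Gamma>\<^esub> g) -` A"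
  by (auto simp: image_iff) (metis act_inv(2))

lemma act_image_sets: "g \<in> carrier \<Gamma> \<Longrightarrow> A \<in> sets M \<Longrightarrow> \<phi> g ` A \<in> sets M"
  using act_vimage act_image by simp

lemma emeasure_act_image: "g \<in> carrier \<Gamma> \<Longrightarrow> A \<in> sets M \<Longrightarrow> emeasure M (\<phi> g ` A) = emeasure M A"
  using emeasure_act_vimage act_image by simp

lemma act_inj: "g \<in> carrier \<Gamma> \<Longrightarrow> \<phi> g x = \<phi> g y \<Longrightarrow> x = y"
  by (metis act_inv(1))

abbreviation orb :: "('x \<times> 'x) set" where
  "orb \<equiv> orbit_relation \<Gamma> M \<phi>"

lemma orb_iff: "(x, y) \<in> orb \<longleftrightarrow> (\<exists>g\<in>carrier \<Gamma>. y = \<phi> g x)"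
  by (simp add: orbit_relation_iff_orbit)

lemma equiv_orb: "equiv UNIV orb"
proof (rule equivI)
  show "refl orb" by (rule refl_onI) (auto simp: orb_iff intro!: bexI[of _ "\<one>\<^bsub>\<Gamma>\<^esub>"])
  show "sym orb" by (rule symI) (auto simp: orb_iff intro!: bexI[of _ "inv\<^bsub>\<Gamma>\<^esub> _"])
  show "trans orb"
  proof (rule transI)
    fix x y z assume "(x, y) \<in> orb" "(y, z) \<in> orb"
    then obtain g h where "g \<in> carrier \<Gamma>" "h \<in> carrier \<Gamma>" "y = \<phi> g x" "z = \<phi> h y" by (auto simp: orb_iff)
    then show "(x, z) \<in> orb" by (auto simp: orb_iff act_mult intro!: bexI[of _ "h \<otimes>\<^bsub>\<Gamma>\<^esub> g"])
  qed
qed simp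

lemma orb_sym: "(x, y) \<in> orb \<Longrightarrow> (y, x) \<in> orb"
  using equiv_orb by (auto simp: equiv_def dest: symD)

lemma orb_trans: "(x, y) \<in> orb \<Longrightarrow> (y, z) \<in> orb \<Longrightarrow> (x, z) \<in> orb"
  using equiv_orb by (auto simp: equiv_def dest: transD)

lemma orb_refl: "(x, x) \<in> orb"
  using equiv_orb by (auto simp: equiv_def refl_on_def)

lemma orb_act: "g \<in> carrier \<Gamma> \<Longrightarrow> (x, \<phi> g x) \<in> orb"
  by (auto simp: orb_iff)

definition free_part :: "'x set" where
  "free_part = {x. \<forall>g\<in>carrier \<Gamma>. \<phi> g x = x \<longrightarrow> g = \<one>\<^bsub>\<Gamma>\<^esub>}"

lemma act_eq_sets:
  assumes "f \<in> measurable N M" "h \<in> measurable N M"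
  shows "{x \<in> space N. f x = h x} \<in> sets N"
proof -
  have "f \<in> borel_measurable N" "h \<in> borel_measurable N"
    using assms measurable_cong_sets[OF refl sets_M, of N] by auto
  then have "{x \<in> space N. dist (f x) (h x) = 0} \<in> sets N" by measurable
  then show ?thesis by simp
qed

lemma act_Collect_eq:
  assumes "f \<in> measurable M M" "h \<in> measurable M M"
  shows "{x. f x = h x} \<in> sets M"
  using act_eq_sets[OF assms] by simp

lemma free_part_sets: "free_part \<in> sets M"
proof -
  have "free_part = (\<Inter>g\<in>carrier \<Gamma>. if g = \<one>\<^bsub>\<Gamma>\<^esub> then UNIV else UNIV - {x. \<phi> g x = x})"
    by (auto simp: free_part_def)
  also have "\<dots> \<in> sets M"
    using act_Collect_eq[OF act_measurable measurable_ident]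
    by (intro sets.countable_INT' countable_group) (use sets.top[of M] in \<open>auto intro!: one_closed sets.Diff simp del: sets_M\<close>)
  finally show ?thesis .
qed

lemma free_part_conull: "UNIV - free_part \<in> null_sets M"
proof -
  have "AE x in M. x \<in> free_part" using free_pmp by (simp add: free_pmp_action_def free_part_def)
  then show ?thesis
    using AE_iff_null_sets[of "UNIV - free_part" M] free_part_sets sets.Diff[OF sets.top[of M] free_part_sets]
    by simp
qed

lemma free_part_act: "x \<in> free_part \<Longrightarrow> g \<in> carrier \<Gamma> \<Longrightarrow> h \<in> carrier \<Gamma> \<Longrightarrow> \<phi> g x = \<phi> h x \<Longrightarrow> g = h"
proof -
  assume a: "x \<in> free_part" "g \<in> carrier \<Gamma>" "h \<in> carrier \<Gamma>" "\<phi> g x = \<phi> h x"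
  then have "\<phi> (inv\<^bsub>\<Gamma>\<^esub> h \<otimes>\<^bsub>\<Gamma>\<^esub> g) x = x" by (simp add: act_mult)
  then have "inv\<^bsub>\<Gamma>\<^esub> h \<otimes>\<^bsub>\<Gamma>\<^esub> g = \<one>\<^bsub>\<Gamma>\<^esub>" using a by (simp add: free_part_def)
  then show "g = h" using a inv_equality[of "inv\<^bsub>\<Gamma>\<^esub> h" g] by (metis inv_closed inv_inv)
qed

lemma free_part_invariant: "x \<in> free_part \<Longrightarrow> h \<in> carrier \<Gamma> \<Longrightarrow> \<phi> h x \<in> free_part"
proof -
  assume a: "x \<in> free_part" "h \<in> carrier \<Gamma>"
  have "g = \<one>\<^bsub>\<Gamma>\<^esub>" if "g \<in> carrier \<Gamma>" "\<phi> g (\<phi> h x) = \<phi> h x" for g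
  proof -
    have "g \<otimes>\<^bsub>\<Gamma>\<^esub> h = h" using free_part_act[OF a(1), of "g \<otimes>\<^bsub>\<Gamma>\<^esub> h" h] a that by (simp add: act_mult)
    then show ?thesis using a that by (simp add: r_cancel_one)
  qed
  then show "\<phi> h x \<in> free_part" by (simp add: free_part_def)
qed

definition sat :: "'x set \<Rightarrow> 'x set" where
  "sat A = {x. \<exists>g\<in>carrier \<Gamma>. \<phi> g x \<in> A}"

lemma sat_sets: "A \<in> sets M \<Longrightarrow> sat A \<in> sets M"
proof -
  assume a: "A \<in> sets M"
  have "sat A = (\<Union>g\<in>carrier \<Gamma>. \<phi> g -` A)" by (auto simp: sat_def)
  also have "\<dots> \<in> sets M" using a act_vimage by (intro sets.countable_UN' countable_group) auto
  finally show ?thesis .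
qed

lemma sat_null: "A \<in> null_sets M \<Longrightarrow> sat A \<in> null_sets M"
proof -
  assume a: "A \<in> null_sets M"
  have "sat A = (\<Union>g\<in>carrier \<Gamma>. \<phi> g -` A)" by (auto simp: sat_def)
  also have "\<dots> \<in> null_sets M"
    using a act_vimage emeasure_act_vimage
    by (intro null_sets_UN' countable_group) (auto simp: null_sets_def simp del: sets_M)
  finally show ?thesis .
qed

lemma sat_invariant: "g \<in> carrier \<Gamma> \<Longrightarrow> \<phi> g x \<in> sat A \<longleftrightarrow> x \<in> sat A"
proof
  assume g: "g \<in> carrier \<Gamma>"
  show "x \<in> sat A" if "\<phi> g x \<in> sat A"
  proof -
    from that obtain h where "h \<in> carrier \<Gamma>" "\<phi> h (\<phi> g x) \<in> A" by (auto simp: sat_def)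
    then show ?thesis using g by (auto simp: sat_def act_mult intro!: bexI[of _ "h \<otimes>\<^bsub>\<Gamma>\<^esub> g"])
  qed
  show "\<phi> g x \<in> sat A" if "x \<in> sat A"
  proof -
    from that obtain h where "h \<in> carrier \<Gamma>" "\<phi> h x \<in> A" by (auto simp: sat_def)
    then show ?thesis using g by (auto simp: sat_def act_mult intro!: bexI[of _ "h \<otimes>\<^bsub>\<Gamma>\<^esub> inv\<^bsub>\<Gamma>\<^esub> g"])
  qed
qed

lemma subset_sat: "A \<subseteq> sat A"
  by (auto simp: sat_def intro!: bexI[of _ "\<one>\<^bsub>\<Gamma>\<^esub>"])

lemma pos_piece:
  assumes "V \<in> sets M" "emeasure M V > 0" "countable S" "V \<subseteq> (\<Union>s\<in>S. A s)" "\<And>s. s \<in> S \<Longrightarrow> A s \<in> sets M"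
  obtains s where "s \<in> S" "V \<inter> A s \<in> sets M" "emeasure M (V \<inter> A s) > 0"
proof -
  have "\<exists>s\<in>S. emeasure M (V \<inter> A s) > 0"
  proof (rule ccontr)
    assume "\<not> ?thesis"
    then have "(\<Union>s\<in>S. V \<inter> A s) \<in> null_sets M"
      using assms by (intro null_sets_UN') (auto simp: null_sets_def zero_less_iff_neq_zero simp del: sets_M)
    moreover have "(\<Union>s\<in>S. V \<inter> A s) = V" using assms by blast
    ultimately show False using assms(2) by (simp add: null_setsD1)
  qed
  then show thesis using that assms by (metis sets.Int)
qed

lemma pos_diff_null:
  assumes "V \<in> sets M" "emeasure M V > 0" "UNIV - X \<in> null_sets M" "X \<in> sets M"
  shows "V \<inter> X \<in> sets M" "emeasure M (V \<inter> X) > 0"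
proof -
  show "V \<inter> X \<in> sets M" using assms by auto
  have "emeasure M (V - (UNIV - X)) = emeasure M V" using assms by (intro emeasure_Diff_null_set)
  moreover have "V - (UNIV - X) = V \<inter> X" by auto
  ultimately show "emeasure M (V \<inter> X) > 0" using assms by simp
qed

text \<open>First moment: \<open>k\<close> translates of \<open>V\<close> have total measure
  \<open>k * measure M V\<close>, which exceeds \<open>n\<close> for large \<open>k\<close>, so a
  non-null set of points lies in more than \<open>n\<close> of them.\<close>

lemma many_returns:
  assumes "infinite (carrier \<Gamma>)" "V \<in> sets M" "emeasure M V > 0"
    and X: "X \<in> sets M" "UNIV - X \<in> null_sets M"
  obtains x F where "x \<in> X" "x \<in> free_part" "F \<subseteq> carrier \<Gamma>" "finite F" "card F = n" "\<And>g. g \<in> F \<Longrightarrow> \<phi> g x \<in> V"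
proof -
  have V: "measure M V > 0" using assms(3) by (simp add: emeasure_eq_measure)
  obtain k :: nat where k: "real n < real k * measure M V" using reals_Archimedean3[OF V] by blast
  obtain F where F: "F \<subseteq> carrier \<Gamma>" "finite F" "card F = k"
    using infinite_arbitrarily_large[OF assms(1)] by blast
  define f where "f x = (\<Sum>g\<in>F. indicator (\<phi> g -` V) x :: real)" for x
  have m: "\<phi> g -` V \<in> sets M" "measure M (\<phi> g -` V) = measure M V" if "g \<in> F" for g
    using act_vimage[OF subsetD[OF F(1) that] assms(2)]
      emeasure_act_vimage[OF subsetD[OF F(1) that] assms(2)] by (simp_all add: measure_def)
  have ind: "integrable M (indicator (\<phi> g -` V) :: 'x \<Rightarrow> real)" if "g \<in> F" for g
    using m(1)[OF that] by (rule integrable_real_indicator) (simp add: emeasure_eq_measure)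
  have int: "integrable M f"
    unfolding f_def by (rule Bochner_Integration.integrable_sum[OF ind])
  have "integral\<^sup>L M f = (\<Sum>g\<in>F. integral\<^sup>L M (indicator (\<phi> g -` V)))"
    unfolding f_def by (rule Bochner_Integration.integral_sum[OF ind])
  also have "\<dots> = (\<Sum>g\<in>F. measure M V)"
    by (rule sum.cong[OF refl]) (simp add: m(2))
  also have "\<dots> = real k * measure M V" using F(3) by simp
  finally have I: "integral\<^sup>L M f > real n" using k by simp
  have "\<exists>x. x \<in> X \<and> x \<in> free_part \<and> f x > real n"
  proof (rule ccontr)
    assume neg: "\<not> ?thesis"
    have "AE x in M. x \<in> X" "AE x in M. x \<in> free_part"
      using AE_not_in[OF X(2)] AE_not_in[OF free_part_conull] by auto
    then have "AE x in M. f x \<le> real n"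
      by eventually_elim (use neg in \<open>auto simp: not_less\<close>)
    then have "integral\<^sup>L M f \<le> integral\<^sup>L M (\<lambda>_. real n)"
      using int by (intro integral_mono_AE) auto
    then show False using I prob_space by simp
  qed
  then obtain x where x: "x \<in> X" "x \<in> free_part" "f x > real n" by blast
  have "f x = real (card {g\<in>F. \<phi> g x \<in> V})"
  proof -
    have "f x = (\<Sum>g\<in>F. if \<phi> g x \<in> V then 1 else 0)"
      unfolding f_def by (rule sum.cong) (auto simp: indicator_def)
    also have "\<dots> = real (card {g\<in>F. \<phi> g x \<in> V})"
      using F(2) by (subst sum.inter_filter[symmetric]) auto
    finally show ?thesis .
  qed
  then have "n \<le> card {g\<in>F. \<phi> g x \<in> V}" using x by simp
  then obtain F' where "F' \<subseteq> {g\<in>F. \<phi> g x \<in> V}" "card F' = n" "finite F'"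
    using obtain_subset_with_card_n by blast
  then show thesis using that[of x F'] x F(1) by blast
qed

lemma orbit_subset_countable: "Q \<subseteq> orb \<Longrightarrow> countable (Q `` {x})"
proof -
  assume "Q \<subseteq> orb"
  then have "Q `` {x} \<subseteq> orb `` {x}" by blast
  also have "\<dots> = (\<lambda>g. \<phi> g x) ` carrier \<Gamma>" by (auto simp: orb_iff)
  finally have "Q `` {x} \<subseteq> (\<lambda>g. \<phi> g x) ` carrier \<Gamma>" .
  then show ?thesis using countable_group countable_subset by blast
qed

text \<open>A partial map inside the relation agrees with a single group element on each of
  countably many Borel parts of its domain, and there it preserves the measure.\<close>

lemma mp_eqrelI:
  assumes "equiv (Domain Q) Q" "Q \<subseteq> orb" and C: "\<And>g. g \<in> carrier \<Gamma> \<Longrightarrow> {x. (x, \<phi> g x) \<in> Q} \<in> sets M"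
  shows "mp_eqrel M Q"
proof -
  have Q_act: "\<exists>g\<in>carrier \<Gamma>. y = \<phi> g x" if "(x, y) \<in> Q" for x y
    using that assms(2) orb_iff by blast
  show ?thesis
    unfolding mp_eqrel_def
  proof (intro conjI allI ballI impI)
    have "Domain Q = (\<Union>g\<in>carrier \<Gamma>. {x. (x, \<phi> g x) \<in> Q})"
    proof (intro equalityI subsetI)
      fix x assume "x \<in> Domain Q"
      then obtain y where y: "(x, y) \<in> Q" by blast
      then show "x \<in> (\<Union>g\<in>carrier \<Gamma>. {x. (x, \<phi> g x) \<in> Q})" using Q_act[OF y] by auto
    qed auto
    then show "Domain Q \<in> sets M" using sets.countable_UN'[OF countable_group, of "\<lambda>g. {x. (x, \<phi> g x) \<in> Q}" M] C by auto
    have "Q = (\<Union>g\<in>carrier \<Gamma>. {z \<in> space (M \<Otimes>\<^sub>M M). snd z = \<phi> g (fst z)} \<inter>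
        (fst -` {x. (x, \<phi> g x) \<in> Q} \<inter> space (M \<Otimes>\<^sub>M M)))"
    proof (intro equalityI subsetI)
      fix z assume z: "z \<in> Q"
      obtain x y where xy: "z = (x, y)" by (cases z)
      then show "z \<in> (\<Union>g\<in>carrier \<Gamma>. {z \<in> space (M \<Otimes>\<^sub>M M). snd z = \<phi> g (fst z)} \<inter>
        (fst -` {x. (x, \<phi> g x) \<in> Q} \<inter> space (M \<Otimes>\<^sub>M M)))"
        using Q_act[of x y] z by (auto simp: space_pair_measure)
    qed auto
    also have "\<dots> \<in> sets (M \<Otimes>\<^sub>M M)"
    proof (rule sets.countable_UN'[OF countable_group], rule image_subsetI, rule sets.Int)
      fix g assume g: "g \<in> carrier \<Gamma>"
      note [measurable] = act_measurable[OF g]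
      show "{z \<in> space (M \<Otimes>\<^sub>M M). snd z = \<phi> g (fst z)} \<in> sets (M \<Otimes>\<^sub>M M)"
        by (rule act_eq_sets) measurable
      show "fst -` {x. (x, \<phi> g x) \<in> Q} \<inter> space (M \<Otimes>\<^sub>M M) \<in> sets (M \<Otimes>\<^sub>M M)"
        using C[OF g] by (rule measurable_sets[OF measurable_fst])
    qed
    finally show "Q \<in> sets (M \<Otimes>\<^sub>M M)" .
    show "countable (Q `` {x})" for x by (rule orbit_subset_countable[OF assms(2)])
    fix A f
    assume A: "A \<in> sets M" and f: "f \<in> measurable (restrict_space M A) M"
      and *: "inj_on f A \<and> f ` A \<in> sets M \<and> (\<forall>x\<in>A. (x, f x) \<in> Q)"
    show "emeasure M (f ` A) = emeasure M A"
    proof (cases "carrier \<Gamma> = {}")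
      case True
      then show ?thesis using one_closed by blast
    next
      case False
      define e where "e = from_nat_into (carrier \<Gamma>)"
      have e: "e n \<in> carrier \<Gamma>" for n using from_nat_into[OF False] by (simp add: e_def)
      have range_e: "range e = carrier \<Gamma>"
        using range_from_nat_into[OF False countable_group] by (simp add: e_def)
      define B where "B n = {x\<in>A. f x = \<phi> (e n) x}" for n
      define A' where "A' = disjointed B"
      have sA: "space (restrict_space M A) = A" using A by (simp add: space_restrict_space2)
      have B: "B n \<in> sets M" for n
      proof -
        have "{x \<in> space (restrict_space M A). f x = \<phi> (e n) x} \<in> sets (restrict_space M A)"
          by (rule act_eq_sets[OF f measurable_restrict_space1[OF act_measurable[OF e]]])
        then show ?thesis using sets_restrict_space_iff[of A M] A sA by (simp add: B_def)
      qed
      then have A': "A' n \<in> sets M" for n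
        using sets.range_disjointed_sets[of B M] by (auto simp: A'_def simp del: sets_M)
      have dis: "disjoint_family A'" by (simp add: A'_def disjoint_family_disjointed)
      have UA: "(\<Union>n. A' n) = A"
      proof -
        have "A \<subseteq> (\<Union>n. B n)"
        proof
          fix x assume x: "x \<in> A"
          then obtain g where "g \<in> carrier \<Gamma>" "f x = \<phi> g x" using * Q_act by blast
          moreover from this obtain n where "g = e n" using range_e by blast
          ultimately show "x \<in> (\<Union>n. B n)" using x by (auto simp: B_def)
        qed
        then show ?thesis by (auto simp: A'_def UN_disjointed_eq B_def)
      qed
      have AB: "A' n \<subseteq> B n" for n using disjointed_subset by (simp add: A'_def)
      have img: "f ` A' n = \<phi> (e n) ` A' n" for n
        using AB[of n] by (intro image_cong refl) (auto simp: B_def)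
      have fdis: "disjoint_family (\<lambda>n. f ` A' n)"
      proof -
        have "f ` A' m \<inter> f ` A' n = {}" if "m \<noteq> n" for m n
        proof -
          have "A' m \<subseteq> A" "A' n \<subseteq> A" using UA by auto
          then have "f ` A' m \<inter> f ` A' n = f ` (A' m \<inter> A' n)"
            using * by (simp add: inj_on_image_Int[of f A])
          then show ?thesis using dis that by (simp add: disjoint_family_on_def)
        qed
        then show ?thesis by (simp add: disjoint_family_on_def)
      qed
      have "emeasure M (f ` A) = emeasure M (\<Union>n. f ` A' n)" using UA by (simp flip: image_UN)
      also have "\<dots> = (\<Sum>n. emeasure M (f ` A' n))"
        using act_image_sets[OF e A'] img fdis by (intro suminf_emeasure[symmetric]) (auto simp del: sets_M)
      also have "\<dots> = (\<Sum>n. emeasure M (A' n))" using emeasure_act_image[OF e A'] img by simp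
      also have "\<dots> = emeasure M (\<Union>n. A' n)" using A' dis by (intro suminf_emeasure) (auto simp del: sets_M)
      finally show ?thesis using UA by simp
    qed
  qed (rule assms(1))
qed

end


section \<open>Rooting the orbits of an action\<close>

text \<open>\<open>p\<close> carries orbits into orbits and thereby induces the cocycle. It may
  identify points of one orbit; the label \<open>t\<close> tells these apart. In the application
  \<open>p\<close> moves a point into a section and then applies the orbit equivalence.\<close>

locale kurosh = A: pmp_action \<Gamma> M \<phi> + group_family I F + T: pmp_action "free_product I F" N \<beta>
  for \<Gamma> :: "'h monoid" and M :: "'x::polish_space measure" and \<phi>
    and I :: "'i set" and F :: "'i \<Rightarrow> 'g monoid" and N :: "'y::polish_space measure" and \<beta> +
  fixes p :: "'x \<Rightarrow> 'y" and t :: "'x \<Rightarrow> nat" and X0 :: "'x set"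
  assumes countable_I: "countable I" and countable_F: "i \<in> I \<Longrightarrow> countable (carrier (F i))"
    and X0_sets: "X0 \<in> sets M" and X0_conull: "UNIV - X0 \<in> null_sets M"
    and X0_inv: "x \<in> X0 \<Longrightarrow> g \<in> carrier \<Gamma> \<Longrightarrow> \<phi> g x \<in> X0"
    and p_meas: "p \<in> measurable M N" and t_meas: "t \<in> measurable M (count_space UNIV)"
    and p_orb: "x \<in> X0 \<Longrightarrow> g \<in> carrier \<Gamma> \<Longrightarrow> (p x, p (\<phi> g x)) \<in> T.orb"
    and p_free: "x \<in> X0 \<Longrightarrow> p x \<in> T.free_part"
    and p_t_inj: "x \<in> X0 \<Longrightarrow> g \<in> carrier \<Gamma> \<Longrightarrow> p (\<phi> g x) = p x \<Longrightarrow> t (\<phi> g x) = t x \<Longrightarrow> \<phi> g x = x"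
begin

definition R :: "('x \<times> 'x) set" where "R = restr A.orb X0"

lemma R_iff: "(x, y) \<in> R \<longleftrightarrow> x \<in> X0 \<and> (\<exists>g\<in>carrier \<Gamma>. y = \<phi> g x)"
  using X0_inv by (auto simp: R_def restr_def A.orb_iff)

lemma R_act: "x \<in> X0 \<Longrightarrow> g \<in> carrier \<Gamma> \<Longrightarrow> (x, \<phi> g x) \<in> R"
  by (auto simp: R_iff)

text \<open>The word takes \<open>p y\<close> to \<open>p x\<close> and not the other way round, so
  that the steps from \<open>x\<close> to \<open>y\<close> and from \<open>y\<close> to
  \<open>z\<close> multiply in this order.\<close>

definition \<sigma> :: "'x \<Rightarrow> 'x \<Rightarrow> ('i \<times> 'g) list" where
  "\<sigma> x y = (THE w. w \<in> RW \<and> p x = \<beta> w (p y))"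

lemma \<beta>_mult: "u \<in> RW \<Longrightarrow> v \<in> RW \<Longrightarrow> \<beta> (u \<otimes>\<^bsub>W\<^esub> v) y = \<beta> u (\<beta> v y)"
  using T.act_mult by simp

lemma \<beta>_Nil [simp]: "\<beta> [] y = y"
  using T.act_one by simp

lemma \<sigma>_eqI: "(x, y) \<in> R \<Longrightarrow> w \<in> RW \<Longrightarrow> p x = \<beta> w (p y) \<Longrightarrow> \<sigma> x y = w"
  unfolding \<sigma>_def
  using T.free_part_act[OF p_free, of y] X0_inv by (intro the_equality) (auto simp: R_iff)

lemma \<sigma>:
  assumes "(x, y) \<in> R"
  shows "\<sigma> x y \<in> RW" "p x = \<beta> (\<sigma> x y) (p y)"
proof -
  have "(p y, p x) \<in> T.orb" using assms p_orb T.orb_sym by (auto simp: R_iff)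
  then obtain w where w: "w \<in> RW" "p x = \<beta> w (p y)" by (auto simp: T.orb_iff)
  then have "\<sigma> x y = w" using \<sigma>_eqI assms by blast
  then show "\<sigma> x y \<in> RW" "p x = \<beta> (\<sigma> x y) (p y)" using w by auto
qed

lemma \<sigma>_eq_iff:
  assumes "x \<in> X0" "g \<in> carrier \<Gamma>"
  shows "\<sigma> x (\<phi> g x) = w \<longleftrightarrow> w \<in> RW \<and> p x = \<beta> w (p (\<phi> g x))"
  using \<sigma>[OF R_act[OF assms]] \<sigma>_eqI[OF R_act[OF assms]] by blast

lemma equiv_R: "equiv X0 R"
proof (rule equivI)
  show "R \<subseteq> X0 \<times> X0" by (auto simp: R_def restr_def)
  show "refl_on X0 R" by (rule refl_onI) (simp add: R_def restr_def A.orb_refl)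
  show "sym R" by (rule symI) (auto simp: R_def restr_def intro: A.orb_sym)
  show "trans R" by (rule transI) (auto simp: R_def restr_def intro: A.orb_trans)
qed

sublocale cocycle I F X0 R \<sigma>
proof unfold_locales
  show "equiv X0 R" by (rule equiv_R)
  show "\<sigma> x y \<in> RW" if "(x, y) \<in> R" for x y using \<sigma>(1)[OF that] .
  show "\<sigma> x z = \<sigma> x y \<otimes>\<^bsub>W\<^esub> \<sigma> y z" if "(x, y) \<in> R" "(y, z) \<in> R" for x y z
  proof (rule \<sigma>_eqI)
    show "(x, z) \<in> R" using that equiv_R by (auto simp: equiv_def dest: transD)
    show "p x = \<beta> (\<sigma> x y \<otimes>\<^bsub>W\<^esub> \<sigma> y z) (p z)"
      using \<sigma>[OF that(1)] \<sigma>[OF that(2)] by (simp add: \<beta>_mult)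
  qed (use \<sigma>[OF that(1)] \<sigma>[OF that(2)] in simp)
qed

definition letters where "letters = (SIGMA i:I. carrier (F i))"

text \<open>
  Appending the value of \<open>t\<close> as a last letter breaks ties between points in the same class of the
  kernel of the cocycle.
\<close>

definition key :: "('i \<times> 'g) list \<Rightarrow> nat \<Rightarrow> nat list" where
  "key w n = map (to_nat_on letters) w @ [n]"

abbreviation key_less :: "nat list \<Rightarrow> nat list \<Rightarrow> bool" (infix "\<prec>\<^sub>k" 50) where
  "a \<prec>\<^sub>k b \<equiv> (a, b) \<in> lenlex less_than"

text \<open>The point \<open>y\<close> sees the vertex through the word
  \<open>u \<cdot>\<^sub>W \<sigma> x y\<close>, and the root is the point with the least key.
  Well-foundedness of \<open>lenlex\<close> gives existence, the label gives uniqueness.\<close>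

definition P :: "('i \<times> 'g) list \<Rightarrow> 'x \<Rightarrow> bool" where
  "P u x \<longleftrightarrow> x \<in> X0 \<and> u \<in> RW \<and> (\<forall>y. (x, y) \<in> R \<longrightarrow> \<not> key (u \<otimes>\<^bsub>W\<^esub> \<sigma> x y) (t y) \<prec>\<^sub>k key u (t x))"

lemma countable_letters: "countable letters"
  unfolding letters_def using countable_I countable_F by (intro countable_SIGMA)

lemma RW_lists: "RW \<subseteq> lists letters"
  by (auto simp: reduced_words_def letters_def)

lemma countable_RW: "countable RW"
  using countable_subset[OF RW_lists countable_lists[OF countable_letters]] .

lemma key_inj:
  assumes "key u m = key v n" "u \<in> RW" "v \<in> RW"
  shows "u = v" "m = n"
proof -
  have "map (to_nat_on letters) u = map (to_nat_on letters) v" using assms(1) by (simp add: key_def)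
  moreover have "inj_on (to_nat_on letters) (set u \<union> set v)"
  proof (rule inj_on_subset[OF inj_on_to_nat_on[OF countable_letters]])
    have "u \<in> lists letters" "v \<in> lists letters" using RW_lists assms(2,3) by blast+
    then show "set u \<union> set v \<subseteq> letters" by (auto simp: in_lists_conv_set)
  qed
  ultimately show "u = v" using inj_on_map_eq_map[of "to_nat_on letters" u v] by simp
  show "m = n" using assms(1) by (simp add: key_def)
qed

lemma key_total: "a \<noteq> b \<Longrightarrow> a \<prec>\<^sub>k b \<or> b \<prec>\<^sub>k a"
proof -
  assume "a \<noteq> b"
  moreover have "total (lenlex less_than)"
    by (rule total_lenlex) (auto simp: total_on_def less_than_iff)
  ultimately show ?thesis by (auto simp: total_on_def)
qed

lemma length_key: "length (key u n) = Suc (length u)"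
  by (simp add: key_def)

lemma key_length_less: "length u < length v \<Longrightarrow> key u m \<prec>\<^sub>k key v n"
  by (simp add: lenlex_conv length_key)

lemma length_letter_mult: "length (letter_mult F (j, g) v) \<le> length v \<or> letter_mult F (j, g) v = (j, g) # v"
  by (cases v) (auto split: if_splits)

text \<open>Here it matters that length is compared first. Suppose that \<open>y\<close> beats
  \<open>x\<close> on \<open>u\<close> and put the letter \<open>a\<close> in front. Either it is
  added to both words and the comparison persists, or it is absorbed on the side of
  \<open>y\<close>, whose word is then strictly shorter than \<open>a # u\<close>.\<close>

lemma P_Cons_imp: "P u x" if "P (a # u) x"
proof -
  obtain j g where a: "a = (j, g)" by (cases a)
  have u: "x \<in> X0" "(j, g) # u \<in> RW"
    and min: "\<forall>y. (x, y) \<in> R \<longrightarrow> \<not> key ((a # u) \<otimes>\<^bsub>W\<^esub> \<sigma> x y) (t y) \<prec>\<^sub>k key (a # u) (t x)"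
    using that unfolding P_def a by blast+
  have u': "u \<in> RW" using u(2) by (simp add: Cons_reduced_iff)
  have j: "j \<in> I" "g \<in> carrier (F j)" using u(2) by (auto simp: Cons_reduced_iff)
  have "\<not> key (u \<otimes>\<^bsub>W\<^esub> \<sigma> x y) (t y) \<prec>\<^sub>k key u (t x)" if "(x, y) \<in> R" for y
  proof
    assume less: "key (u \<otimes>\<^bsub>W\<^esub> \<sigma> x y) (t y) \<prec>\<^sub>k key u (t x)"
    have e: "(a # u) \<otimes>\<^bsub>W\<^esub> \<sigma> x y = letter_mult F (j, g) (u \<otimes>\<^bsub>W\<^esub> \<sigma> x y)"
    proof -
      have "(a # u) \<otimes>\<^bsub>W\<^esub> \<sigma> x y = incl j g \<otimes>\<^bsub>W\<^esub> u \<otimes>\<^bsub>W\<^esub> \<sigma> x y"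
        unfolding a using Cons_eq_incl_mult[OF u(2)] by (rule arg_cong)
      also have "\<dots> = incl j g \<otimes>\<^bsub>W\<^esub> (u \<otimes>\<^bsub>W\<^esub> \<sigma> x y)"
        using incl_closed[OF j] u' \<sigma>(1)[OF that] by (simp add: W.m_assoc)
      finally show ?thesis by (simp only: incl_mult)
    qed
    have len: "length (u \<otimes>\<^bsub>W\<^esub> \<sigma> x y) \<le> length u" using lenlex_length[OF less] by (simp add: length_key)
    have "key (letter_mult F (j, g) (u \<otimes>\<^bsub>W\<^esub> \<sigma> x y)) (t y) \<prec>\<^sub>k key (a # u) (t x)"
    proof (cases "letter_mult F (j, g) (u \<otimes>\<^bsub>W\<^esub> \<sigma> x y) = (j, g) # (u \<otimes>\<^bsub>W\<^esub> \<sigma> x y)")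
      case True
      then show ?thesis using less by (simp add: key_def a Cons_lenlex_iff)
    next
      case False
      then have "length (letter_mult F (j, g) (u \<otimes>\<^bsub>W\<^esub> \<sigma> x y)) < length (a # u)"
        using length_letter_mult[of j g "u \<otimes>\<^bsub>W\<^esub> \<sigma> x y"] len by simp
      then show ?thesis by (rule key_length_less)
    qed
    moreover have "\<not> key ((a # u) \<otimes>\<^bsub>W\<^esub> \<sigma> x y) (t y) \<prec>\<^sub>k key (a # u) (t x)"
      using min that by blast
    ultimately show False unfolding e by blast
  qed
  then show ?thesis using u(1) u' unfolding P_def by blast
qed

lemma ex_P: 
  assumes "x \<in> X0" "u \<in> RW"
  shows "\<exists>y. (x, y) \<in> R \<and> P (u \<otimes>\<^bsub>W\<^esub> \<sigma> x y) y"
proof -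
  have wf: "wf (lenlex less_than)" by blast
  define K where "K = {key (u \<otimes>\<^bsub>W\<^esub> \<sigma> x y) (t y) | y. (x, y) \<in> R}"
  have K: "key (u \<otimes>\<^bsub>W\<^esub> \<sigma> x x) (t x) \<in> K" using R_refl[OF assms(1)] by (auto simp: K_def)
  obtain k where k: "k \<in> K" "\<And>l. l \<prec>\<^sub>k k \<Longrightarrow> l \<notin> K" using wfE_min[OF wf K] by metis
  then obtain y where y: "k = key (u \<otimes>\<^bsub>W\<^esub> \<sigma> x y) (t y)" "(x, y) \<in> R" by (auto simp: K_def)
  have "P (u \<otimes>\<^bsub>W\<^esub> \<sigma> x y) y"
    unfolding P_def
  proof (intro conjI allI impI)
    fix z assume z: "(y, z) \<in> R"
    have "key (u \<otimes>\<^bsub>W\<^esub> \<sigma> x z) (t z) \<in> K" using R_trans[OF y(2) z] by (auto simp: K_def)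
    then show "\<not> key (u \<otimes>\<^bsub>W\<^esub> \<sigma> x y \<otimes>\<^bsub>W\<^esub> \<sigma> y z) (t z) \<prec>\<^sub>k key (u \<otimes>\<^bsub>W\<^esub> \<sigma> x y) (t y)"
      unfolding mult_\<sigma>_\<sigma>[OF y(2) z assms(2)] y(1)[symmetric] using k(2) by blast
  qed (use assms \<sigma>(1)[OF y(2)] R_dom[OF y(2)] in auto)
  then show ?thesis using y(2) by blast
qed

sublocale rooted I F X0 R \<sigma> P "to_nat_on RW"
proof unfold_locales
  show "x \<in> X0 \<and> u \<in> RW" if "P u x" for u x using that by (simp add: P_def)
  show "x = y" if "P u x" and xy: "(x, y) \<in> R" and "P (u \<otimes>\<^bsub>W\<^esub> \<sigma> x y) y" for u x y
  proof -
    note yx = R_sym[OF xy]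
    have u: "u \<in> RW" "x \<in> X0" using that by (auto simp: P_def)
    have "\<not> key (u \<otimes>\<^bsub>W\<^esub> \<sigma> x y) (t y) \<prec>\<^sub>k key u (t x)"
      "\<not> key (u \<otimes>\<^bsub>W\<^esub> \<sigma> x y \<otimes>\<^bsub>W\<^esub> \<sigma> y x) (t x) \<prec>\<^sub>k key (u \<otimes>\<^bsub>W\<^esub> \<sigma> x y) (t y)"
      using that yx by (auto simp: P_def)
    moreover have "u \<otimes>\<^bsub>W\<^esub> \<sigma> x y \<otimes>\<^bsub>W\<^esub> \<sigma> y x = u"
      using mult_\<sigma>_\<sigma>[OF xy yx u(1)] \<sigma>_refl[OF u(2)] u(1) by simp
    ultimately have "key (u \<otimes>\<^bsub>W\<^esub> \<sigma> x y) (t y) = key u (t x)" using key_total by fastforce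
    note k = key_inj[OF this _ u(1)]
    have s: "\<sigma> x y \<in> RW" using \<sigma>(1)[OF xy] .
    then have "u \<otimes>\<^bsub>W\<^esub> \<sigma> x y = u" "t y = t x" using k u by simp_all
    then have "\<sigma> x y = []" using W.l_cancel_one[of u "\<sigma> x y"] u s by simp
    then have "p x = p y" using \<sigma>(2)[OF xy] by simp
    moreover obtain g where "g \<in> carrier \<Gamma>" "y = \<phi> g x" using xy by (auto simp: R_iff)
    ultimately show "x = y" using p_t_inj[OF u(2), of g] \<open>t y = t x\<close> by simp
  qed
  show "\<exists>y. (x, y) \<in> R \<and> P (u \<otimes>\<^bsub>W\<^esub> \<sigma> x y) y" if "x \<in> X0" "u \<in> RW" for x u
    using ex_P[OF that] .
  \<comment> \<open>The point \<open>x\<close> sees the vertex as the empty word, so the root,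
    having the least key, must see it as the empty word too.\<close>
  show "\<exists>y. (x, y) \<in> R \<and> \<sigma> x y = [] \<and> P [] y" if x: "x \<in> X0" for x
  proof -
    obtain y where y: "(x, y) \<in> R" "P (\<sigma> x y) y" using ex_P[OF x Nil_reduced] by auto
    note yx = R_sym[OF y(1)]
    have "\<not> key (\<sigma> x y \<otimes>\<^bsub>W\<^esub> \<sigma> y x) (t x) \<prec>\<^sub>k key (\<sigma> x y) (t y)" using y(2) yx by (simp add: P_def)
    moreover have "\<sigma> x y \<otimes>\<^bsub>W\<^esub> \<sigma> y x = []" using \<sigma>_mult[OF y(1) yx] \<sigma>_refl[OF x] by simp
    ultimately have "\<sigma> x y = []" using key_length_less[of "[]" "\<sigma> x y"] by auto
    then show ?thesis using y by auto
  qed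
  show "P u x" if "P (a # u) x" for a u x using P_Cons_imp[OF that] .
  show "inj_on (to_nat_on RW) RW" using inj_on_to_nat_on[OF countable_RW] .
qed

section \<open>Borel choice of the links\<close>

definition e :: "nat \<Rightarrow> 'h" where "e = from_nat_into (carrier \<Gamma>)"

lemma e_closed: "e n \<in> carrier \<Gamma>"
  using A.one_closed by (auto simp: e_def intro: from_nat_into)

lemma e_surj: "g \<in> carrier \<Gamma> \<Longrightarrow> \<exists>n. g = e n"
  using from_nat_into_surj[OF A.countable_group, of g] unfolding e_def by blast

definition base :: "nat \<Rightarrow> 'x set" where
  "base = from_nat_into (SOME B :: 'x set set. countable B \<and> topological_basis B)"

lemma base:
  shows "base n \<in> sets M" and "x \<noteq> y \<Longrightarrow> \<exists>n. x \<in> base n \<and> y \<notin> base n"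
proof -
  define B where "B = (SOME B :: 'x set set. countable B \<and> topological_basis B)"
  have "countable B \<and> topological_basis B"
    unfolding B_def by (rule someI_ex, rule ex_countable_basis)
  then have B: "countable B" "topological_basis B" by auto
  have ne: "B \<noteq> {}" using topological_basisE[OF B(2) open_UNIV UNIV_I] by blast
  then have "base n \<in> B" using from_nat_into[OF ne] by (simp add: base_def B_def)
  then show "base n \<in> sets M" using topological_basis_open[OF B(2)] by simp
  show "\<exists>n. x \<in> base n \<and> y \<notin> base n" if xy: "x \<noteq> y"
  proof -
    obtain U where U: "open U" "x \<in> U" "y \<notin> U" using t1_space[OF xy] by blast
    obtain C where C: "C \<in> B" "x \<in> C" "C \<subseteq> U" using topological_basisE[OF B(2) U(1,2)] by blast
    then obtain n where "C = base n" using from_nat_into_surj[OF B(1) C(1)] unfolding base_def B_def by blast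
    then show ?thesis using U C by blast
  qed
qed

definition good :: "'i \<Rightarrow> ('i \<times> 'g) list \<Rightarrow> nat \<Rightarrow> 'x \<Rightarrow> bool" where
  "good j u n x \<longleftrightarrow> (\<exists>v\<in>RW. min_exit j (\<phi> (e n) x) v \<and> cl j x u (\<phi> (e n) x) v)"

text \<open>Taking the least index makes the choice Borel. Where the index is \<open>n\<close>,
  linking is the action of the single element \<open>e n\<close>, hence injective.\<close>

definition link_index :: "'i \<Rightarrow> ('i \<times> 'g) list \<Rightarrow> 'x \<Rightarrow> nat" where
  "link_index j u x = (LEAST n. good j u n x)"

definition link :: "'i \<Rightarrow> ('i \<times> 'g) list \<Rightarrow> 'x \<Rightarrow> 'x" where
  "link j u x = \<phi> (e (link_index j u x)) x"

text \<open>
  The second component of \<open>k\<close> separates the points of \<open>D j u k\<close> from their links by a basic open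
  set, so that linking generates classes of at most two points.
\<close>

definition D :: "'i \<Rightarrow> ('i \<times> 'g) list \<Rightarrow> nat \<Rightarrow> 'x set" where
  "D j u k = (case prod_decode k of (n, b) \<Rightarrow> {x. exit j x u \<and> \<not> min_exit j x u \<and> link_index j u x = n \<and>
      (LEAST b. x \<in> base b \<and> \<phi> (e n) x \<notin> base b) = b})"

lemma good_link:
  assumes "exit j x u"
  shows "good j u (link_index j u x) x"
proof -
  obtain y v where y: "min_exit j y v" "cl j x u y v" using ex_min_exit[OF assms] by blast
  then have "(x, y) \<in> R" by (simp add: cl_def)
  then obtain g where "g \<in> carrier \<Gamma>" "y = \<phi> g x" by (auto simp: R_iff)
  moreover obtain n where "g = e n" using e_surj[OF \<open>g \<in> carrier \<Gamma>\<close>] by blast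
  ultimately have "y = \<phi> (e n) x" by simp
  then have "good j u n x" using y exitD[OF min_exitD[OF y(1)]] by (auto simp: good_def)
  then show ?thesis unfolding link_index_def by (rule LeastI)
qed

text \<open>A point linked to itself would meet the class both with its own word and with the
  minimal one.\<close>

lemma link_neq:
  assumes "exit j x u" "\<not> min_exit j x u"
  shows "link j u x \<noteq> x"
proof
  assume "link j u x = x"
  then obtain v where v: "min_exit j x v" "cl j x u x v"
    using good_link[OF assms(1)] by (auto simp: good_def link_def)
  then have "u = v" using exit_unique[OF assms(1) min_exitD[OF v(1)]] by simp
  then show False using v assms by simp
qed

lemma D_link:
  assumes "x \<in> D j u (prod_encode (n, b))"
  shows "exit j x u" "\<not> min_exit j x u" "link j u x = \<phi> (e n) x" "x \<in> base b" "\<phi> (e n) x \<notin> base b"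
proof -
  have x: "exit j x u" "\<not> min_exit j x u" "link_index j u x = n"
    "(LEAST b. x \<in> base b \<and> \<phi> (e n) x \<notin> base b) = b"
    using assms by (auto simp: D_def)
  then show "exit j x u" "\<not> min_exit j x u" "link j u x = \<phi> (e n) x" by (auto simp: link_def)
  then have "\<exists>b. x \<in> base b \<and> \<phi> (e n) x \<notin> base b"
    using link_neq[of j x u] base(2)[of x "\<phi> (e n) x"] by auto
  from LeastI_ex[OF this] show "x \<in> base b" "\<phi> (e n) x \<notin> base b" using x(4) by auto
qed

sublocale linked I F X0 R \<sigma> P "to_nat_on RW" link D
proof unfold_locales
  fix j x u k
  obtain n b where "prod_decode k = (n, b)" by fastforce
  then have k: "k = prod_encode (n, b)" by (metis prod_decode_inverse)
  show "\<exists>v. min_exit j (link j u x) v \<and> cl j x u (link j u x) v" if "exit j x u" "\<not> min_exit j x u"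
    using good_link[OF that(1)] by (auto simp: good_def link_def)
  show "exit j x u \<and> \<not> min_exit j x u" if "x \<in> D j u k"
    using D_link(1,2)[of x j u n b] that k by simp
  show "\<exists>k. x \<in> D j u k" if "exit j x u" "\<not> min_exit j x u"
    using that by (intro exI[of _ "prod_encode (link_index j u x,
      LEAST b. x \<in> base b \<and> \<phi> (e (link_index j u x)) x \<notin> base b)"]) (simp add: D_def)
  show "inj_on (link j u) (D j u k)"
    using D_link(3)[of _ j u n b] A.act_inj[OF e_closed[of n]] by (auto simp: inj_on_def k)
  show "D j u k \<inter> link j u ` D j u k = {}"
    using D_link(3-5)[of _ j u n b] by (auto simp: k)
next
  fix j x u k k'
  obtain n b n' b' where k: "prod_decode k = (n, b)" "prod_decode k' = (n', b')" by fastforce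
  assume "x \<in> D j u k" "x \<in> D j u k'"
  then have "n = n'" "b = b'" by (auto simp: D_def k)
  then show "k = k'" using k by (metis prod_decode_inverse)
qed

end


section \<open>A measured Kurosh theorem\<close>

lemma freely_independent_reindex:
  fixes Rs :: "'j \<Rightarrow> ('x \<times> 'x) set" and f :: "'k \<Rightarrow> 'j"
  assumes "freely_independent J Rs" "inj_on f K" "f ` K \<subseteq> J"
  shows "freely_independent K (\<lambda>k. Rs (f k))"
  unfolding freely_independent_def
proof (intro notI, elim exE conjE)
  fix n :: nat and x :: "nat \<Rightarrow> 'x" and i :: "nat \<Rightarrow> 'k"
  assume n: "n \<ge> 2" "x n = x 1"
    and steps: "\<forall>k\<in>{1..<n}. i k \<in> K \<and> x k \<noteq> x (k + 1) \<and> (x k, x (k + 1)) \<in> Rs (f (i k))"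
    and diff: "\<forall>k\<in>{1..<n - 1}. i k \<noteq> i (k + 1)"
  have "\<forall>k\<in>{1..<n}. f (i k) \<in> J \<and> x k \<noteq> x (k + 1) \<and> (x k, x (k + 1)) \<in> Rs (f (i k))"
    using steps assms(3) by blast
  moreover have "\<forall>k\<in>{1..<n - 1}. f (i k) \<noteq> f (i (k + 1))"
  proof
    fix k assume k: "k \<in> {1..<n - 1}"
    then have "i k \<in> K" "i (k + 1) \<in> K" using steps by auto
    then show "f (i k) \<noteq> f (i (k + 1))" using diff k assms(2) by (auto dest: inj_onD)
  qed
  ultimately have "\<not> freely_independent J Rs"
    unfolding freely_independent_def not_not
    using n by (intro exI[of _ n] conjI exI[of _ x] exI[of _ "\<lambda>k. f (i k)"])
  then show False using assms(1) by blast
qed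

context kurosh
begin

section \<open>Borel measurability of the pieces\<close>

lemma t_sets: "{x. t x = n} \<in> sets M"
  using measurable_sets[OF t_meas, of "{n}"] by (simp add: vimage_def)

lemma \<sigma>_sets:
  assumes g: "g \<in> carrier \<Gamma>"
  shows "{x \<in> X0. \<sigma> x (\<phi> g x) = w} \<in> sets M"
proof (cases "w \<in> RW")
  case True
  have "(\<lambda>x. \<beta> w (p (\<phi> g x))) \<in> measurable M N"
    using measurable_compose[OF measurable_compose[OF A.act_measurable[OF g] p_meas] T.act_measurable[of w]] True
    by simp
  then have "{x \<in> space M. p x = \<beta> w (p (\<phi> g x))} \<in> sets M" by (rule T.act_eq_sets[OF p_meas])
  then have "X0 \<inter> {x. p x = \<beta> w (p (\<phi> g x))} \<in> sets M" using X0_sets by auto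
  moreover have "{x \<in> X0. \<sigma> x (\<phi> g x) = w} = X0 \<inter> {x. p x = \<beta> w (p (\<phi> g x))}"
    using \<sigma>_eq_iff[OF _ g] True by auto
  ultimately show ?thesis by simp
next
  case False
  then have e: "{x \<in> X0. \<sigma> x (\<phi> g x) = w} = {}" using \<sigma>_eq_iff[OF _ g] by auto
  show ?thesis unfolding e by simp
qed

text \<open>For a fixed group element these data take countably many values, each on a Borel set, so
  every property of them is Borel. The sets for \<open>P\<close> and \<open>cl\<close> are
  instances.\<close>

lemma \<sigma>_t_sets:
  assumes g: "g \<in> carrier \<Gamma>"
  shows "{x \<in> X0. Q (\<sigma> x (\<phi> g x)) (t (\<phi> g x)) (t x)} \<in> sets M"
proof -
  have "{x \<in> X0. Q (\<sigma> x (\<phi> g x)) (t (\<phi> g x)) (t x)} =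
      (\<Union>w\<in>RW. \<Union>a. \<Union>b. if Q w a b then {x \<in> X0. \<sigma> x (\<phi> g x) = w} \<inter> \<phi> g -` {x. t x = a} \<inter> {x. t x = b} else {})"
    (is "?L = ?U")
  proof (intro equalityI subsetI)
    fix x assume "x \<in> ?L"
    then have x: "x \<in> X0" "Q (\<sigma> x (\<phi> g x)) (t (\<phi> g x)) (t x)" by auto
    have "\<sigma> x (\<phi> g x) \<in> RW" using \<sigma>(1)[OF R_act[OF x(1) g]] .
    then show "x \<in> ?U" using x by auto
  qed (auto split: if_splits)
  also have "\<dots> \<in> sets M"
    using \<sigma>_sets[OF g] A.act_vimage[OF g t_sets] t_sets
    by (intro sets.countable_UN' countable_RW) (auto simp del: A.sets_M)
  finally show ?thesis .
qed

lemma P_sets: "{x. P u x} \<in> sets M"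
proof (cases "u \<in> RW")
  case True
  have "{x. P u x} = (\<Inter>g\<in>carrier \<Gamma>. {x \<in> X0. \<not> key (u \<otimes>\<^bsub>W\<^esub> \<sigma> x (\<phi> g x)) (t (\<phi> g x)) \<prec>\<^sub>k key u (t x)})"
    (is "?L = ?U")
  proof (intro equalityI subsetI)
    fix x assume "x \<in> ?L"
    then show "x \<in> ?U" using R_act by (auto simp: P_def)
  next
    fix x assume "x \<in> ?U"
    then have "\<forall>g\<in>carrier \<Gamma>. \<not> key (u \<otimes>\<^bsub>W\<^esub> \<sigma> x (\<phi> g x)) (t (\<phi> g x)) \<prec>\<^sub>k key u (t x)" "x \<in> X0"
      using A.one_closed by auto
    then show "x \<in> ?L" using True by (auto simp: P_def R_iff)
  qed
  also have "\<dots> \<in> sets M"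
    using \<sigma>_t_sets[of _ "\<lambda>w a b. \<not> key (u \<otimes>\<^bsub>W\<^esub> w) a \<prec>\<^sub>k key u b"] A.one_closed
    by (intro sets.countable_INT' A.countable_group) (auto simp del: A.sets_M)
  finally show ?thesis .
qed (simp add: P_def)

lemma exit_sets: "{x. exit j x u} \<in> sets M"
  using P_sets[of u] by (cases "j \<in> I \<and> avoids j u") (auto simp: exit_def)

lemma cl_sets: "g \<in> carrier \<Gamma> \<Longrightarrow> {x. cl j x u (\<phi> g x) v} \<in> sets M"
proof -
  assume g: "g \<in> carrier \<Gamma>"
  have "{x. cl j x u (\<phi> g x) v} = {x \<in> X0. \<exists>h\<in>carrier (F j). u \<otimes>\<^bsub>W\<^esub> \<sigma> x (\<phi> g x) = incl j h \<otimes>\<^bsub>W\<^esub> v}"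
    using R_act[OF _ g] R_dom(1) by (auto simp: cl_def)
  then show ?thesis
    using \<sigma>_t_sets[OF g, of "\<lambda>w a b. \<exists>h\<in>carrier (F j). u \<otimes>\<^bsub>W\<^esub> w = incl j h \<otimes>\<^bsub>W\<^esub> v"] by simp
qed

lemma min_exit_sets: "{x. min_exit j x u} \<in> sets M"
proof -
  define B where "B g v = (if to_nat_on RW v < to_nat_on RW u
    then \<phi> g -` {y. exit j y v} \<inter> {x. cl j x u (\<phi> g x) v} else {})" for g v
  have "{x. min_exit j x u} = {x. exit j x u} - (\<Union>g\<in>carrier \<Gamma>. \<Union>v\<in>RW. B g v)"
    (is "?L = ?U")
  proof (intro equalityI subsetI)
    fix x assume "x \<in> ?L"
    then show "x \<in> ?U" by (auto simp: min_exit_def B_def not_less[symmetric] split: if_splits)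
  next
    fix x assume x: "x \<in> ?U"
    have "to_nat_on RW u \<le> to_nat_on RW v" if yv: "exit j y v" "cl j x u y v" for y v
    proof (rule ccontr)
      assume less: "\<not> to_nat_on RW u \<le> to_nat_on RW v"
      have "(x, y) \<in> R" using yv by (simp add: cl_def)
      then obtain g where "g \<in> carrier \<Gamma>" "y = \<phi> g x" by (auto simp: R_iff)
      then have "x \<in> B g v" "v \<in> RW" using less yv exitD[OF yv(1)] by (auto simp: B_def)
      then show False using x \<open>g \<in> carrier \<Gamma>\<close> by blast
    qed
    then show "x \<in> ?L" using x by (auto simp: min_exit_def)
  qed
  also have "\<dots> \<in> sets M"
  proof (intro sets.Diff exit_sets sets.countable_UN' A.countable_group countable_RW image_subsetI)
    fix g v assume "g \<in> carrier \<Gamma>"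
    then show "B g v \<in> sets M"
      using A.act_vimage[OF _ exit_sets] cl_sets by (auto simp: B_def simp del: A.sets_M)
  qed
  finally show ?thesis .
qed

lemma good_sets: "{x. good j u n x} \<in> sets M"
proof -
  have "{x. good j u n x} = (\<Union>v\<in>RW. \<phi> (e n) -` {y. min_exit j y v} \<inter> {x. cl j x u (\<phi> (e n) x) v})"
    by (auto simp: good_def)
  also have "\<dots> \<in> sets M"
    using A.act_vimage[OF e_closed min_exit_sets] cl_sets[OF e_closed]
    by (intro sets.countable_UN' countable_RW) (auto simp del: A.sets_M)
  finally show ?thesis .
qed

lemma LEAST_sets:
  fixes S :: "nat \<Rightarrow> 'x set"
  assumes "\<And>n. S n \<in> sets M"
  shows "{x. (\<exists>n. x \<in> S n) \<and> (LEAST n. x \<in> S n) = n} \<in> sets M"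
proof -
  have "{x. (\<exists>n. x \<in> S n) \<and> (LEAST n. x \<in> S n) = n} = S n - (\<Union>m<n. S m)"
  proof (intro equalityI subsetI)
    fix x assume "x \<in> {x. (\<exists>n. x \<in> S n) \<and> (LEAST n. x \<in> S n) = n}"
    then have "\<exists>n. x \<in> S n" and n: "(LEAST n. x \<in> S n) = n" by auto
    from LeastI_ex[OF this(1)] not_less_Least[of _ "\<lambda>n. x \<in> S n"]
    show "x \<in> S n - (\<Union>m<n. S m)" unfolding n by auto
  next
    fix x assume x: "x \<in> S n - (\<Union>m<n. S m)"
    then have "(LEAST n. x \<in> S n) = n" by (intro Least_equality) (auto simp: not_less[symmetric])
    then show "x \<in> {x. (\<exists>n. x \<in> S n) \<and> (LEAST n. x \<in> S n) = n}" using x by auto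
  qed
  also have "\<dots> \<in> sets M" using assms by auto
  finally show ?thesis .
qed

lemma D_sets: "D j u k \<in> sets M"
proof -
  obtain n b where k: "prod_decode k = (n, b)" by fastforce
  define S where "S b = base b \<inter> \<phi> (e n) -` (UNIV - base b)" for b
  have S: "S b \<in> sets M" for b
    using base(1)[of b] A.act_vimage[OF e_closed[of n], of "UNIV - base b"] sets.top[of M]
    by (auto simp: S_def simp del: A.sets_M)
  have "D j u k = ({x. exit j x u} - {x. min_exit j x u}) \<inter>
      {x. (\<exists>n. x \<in> {x. good j u n x}) \<and> (LEAST n. x \<in> {x. good j u n x}) = n} \<inter>
      {x. (\<exists>b. x \<in> S b) \<and> (LEAST b. x \<in> S b) = b}" (is "?L = ?U")
  proof (intro equalityI subsetI)
    fix x assume x: "x \<in> ?L"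
    moreover from x have "x \<in> D j u (prod_encode (n, b))" using k by (simp add: D_def)
    note x' = D_link[OF this]
    ultimately show "x \<in> ?U"
      using good_link[OF x'(1)] by (auto simp: D_def k link_index_def S_def)
  qed (auto simp: D_def k link_index_def S_def)
  also have "\<dots> \<in> sets M"
    using exit_sets[of j u] min_exit_sets[of j u] LEAST_sets[OF good_sets] LEAST_sets[OF S]
    by (intro sets.Int sets.Diff)
  finally show ?thesis .
qed

lemma piece_rel_sets:
  assumes g: "g \<in> carrier \<Gamma>"
  shows "{x. (x, \<phi> g x) \<in> piece_rel i} \<in> sets M"
proof (cases i)
  case Kernel
  have "{x. (x, \<phi> g x) \<in> piece_rel i} = {x \<in> X0. \<sigma> x (\<phi> g x) = []}"
    using R_act[OF _ g] R_dom(1) by (auto simp: Kernel ker_def)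
  then show ?thesis using \<sigma>_sets[OF g] by simp
next
  case (Local j u)
  have "{x. (x, \<phi> g x) \<in> piece_rel i} =
      {x. min_exit j x u} \<inter> \<phi> g -` {x. min_exit j x u} \<inter> {x. cl j x u (\<phi> g x) u}"
    by (auto simp: Local)
  then show ?thesis using min_exit_sets A.act_vimage[OF g min_exit_sets] cl_sets[OF g] by auto
next
  case (Link j u k)
  obtain n b where nb: "prod_decode k = (n, b)" by fastforce
  then have k: "k = prod_encode (n, b)" by (metis prod_decode_inverse)
  \<comment> \<open>On \<open>D j u k\<close> the link is the element \<open>e n\<close>, so the
    linked point of the pair through \<open>x\<close> is either \<open>x\<close> or
    \<open>\<phi> f x\<close>.\<close>
  define f where "f = inv\<^bsub>\<Gamma>\<^esub> (e n)"
  have f: "f \<in> carrier \<Gamma>" using e_closed[of n] by (simp add: f_def)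
  have "{x. (x, \<phi> g x) \<in> piece_rel i} =
     D j u k \<inter> ({x. \<phi> g x = x} \<union> {x. \<phi> g x = \<phi> (e n) x}) \<union>
     \<phi> f -` D j u k \<inter> ({x. \<phi> g x = x} \<union> {x. \<phi> g x = \<phi> f x})" (is "?L = ?U")
  proof (intro equalityI subsetI)
    fix x assume "x \<in> ?L"
    then obtain a where a: "a \<in> D j u k" "x \<in> {a, link j u a}" "\<phi> g x \<in> {a, link j u a}" by (auto simp: Link)
    have l: "link j u a = \<phi> (e n) a" using D_link(3)[of a j u n b] a k by simp
    then have "\<phi> f (link j u a) = a" using e_closed[of n] by (simp add: f_def)
    then show "x \<in> ?U" using a l by auto
  next
    fix x assume "x \<in> ?U"
    then consider "x \<in> D j u k" "\<phi> g x \<in> {x, \<phi> (e n) x}" | "\<phi> f x \<in> D j u k" "\<phi> g x \<in> {x, \<phi> f x}"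
      by blast
    then show "x \<in> ?L"
    proof cases
      case 1
      then show ?thesis using D_link(3)[of x j u n b] k by (auto simp: Link)
    next
      case 2
      have "link j u (\<phi> f x) = x"
        using D_link(3)[of "\<phi> f x" j u n b] 2 k e_closed[of n] by (simp add: f_def)
      then show ?thesis using 2 by (auto simp: Link intro!: bexI[of _ "\<phi> f x"])
    qed
  qed
  also have "\<dots> \<in> sets M"
    using D_sets[of j u k] A.act_vimage[OF f D_sets[of j u k]]
      A.act_Collect_eq[OF A.act_measurable[OF g] measurable_ident]
      A.act_Collect_eq[OF A.act_measurable[OF g] A.act_measurable[OF e_closed[of n]]]
      A.act_Collect_eq[OF A.act_measurable[OF g] A.act_measurable[OF f]]
    by (intro sets.Un sets.Int) (auto simp del: A.sets_M)
  finally show ?thesis .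
qed

lemma piece_rel_X0: "piece_rel i \<subseteq> X0 \<times> X0"
  using piece_rel_subset[of i] by (auto simp: R_def restr_def)

lemma piece_rel_orb: "piece_rel i \<subseteq> A.orb"
  using piece_rel_subset[of i] by (auto simp: R_def restr_def)

lemma mp_eqrel_piece_rel: "mp_eqrel M (piece_rel i)"
  by (rule A.mp_eqrelI[OF equiv_piece_rel piece_rel_orb piece_rel_sets])

section \<open>The decomposition and what free indecomposability makes of it\<close>

definition pieces :: "('i, ('i \<times> 'g) list) piece set" where
  "pieces = insert Kernel ((\<lambda>(j, u). Local j u) ` (I \<times> RW) \<union> (\<lambda>(j, u, k). Link j u k) ` (I \<times> RW \<times> UNIV))"

lemma countable_pieces: "countable pieces"
  unfolding pieces_def using countable_I countable_RW by auto

lemma pieces_cover: "(x, y) \<in> piece_rel i \<Longrightarrow> i \<in> pieces"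
proof (cases i)
  case (Local j u)
  assume "(x, y) \<in> piece_rel i"
  then have "exit j x u" using min_exitD by (auto simp: Local)
  then show ?thesis using exitD[of j x u] by (auto simp: Local pieces_def)
next
  case (Link j u k)
  assume "(x, y) \<in> piece_rel i"
  then obtain a where "a \<in> D j u k" by (auto simp: Link)
  then have "exit j a u" using D_exit by blast
  then show ?thesis using exitD[of j a u] by (force simp: Link pieces_def)
qed (simp add: pieces_def)

text \<open>\<open>freely_indecomposable\<close> speaks of families indexed by natural numbers,
  hence the enumeration of the countable set of pieces.\<close>

lemma decomposition:
  "free_product_decomposition M A.orb (to_nat_on pieces ` pieces) (\<lambda>n. piece_rel (from_nat_into pieces n))"
  unfolding free_product_decomposition_def
proof (intro conjI ballI bexI[OF _ X0_sets])
  let ?J = "to_nat_on pieces ` pieces" and ?f = "from_nat_into pieces"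
  have restr: "restr (piece_rel i) X0 = piece_rel i" for i using piece_rel_X0[of i] by (auto simp: restr_def)
  have id: "?f (to_nat_on pieces i) = i" if "i \<in> pieces" for i
    using from_nat_into_to_nat_on[OF countable_pieces that] .
  show "mp_eqrel M (piece_rel (?f j))" for j by (rule mp_eqrel_piece_rel)
  show "space M - X0 \<in> null_sets M" using X0_conull by simp
  show "restr (piece_rel (?f j)) X0 \<subseteq> A.orb" for j using piece_rel_orb[of "?f j"] by (simp add: restr)
  have "inj_on ?f ?J" by (rule inj_onI) (metis id imageE)
  then show "freely_independent ?J (\<lambda>j. restr (piece_rel (?f j)) X0)"
    unfolding restr by (rule freely_independent_reindex[OF freely_independent_piece_rel _ subset_UNIV])
  have "(\<Union>j\<in>?J. piece_rel (?f j)) = (\<Union>i\<in>pieces. piece_rel i)"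
    by (auto simp: id)
  also have "\<dots> = (\<Union>i. piece_rel i)" 
  proof (intro equalityI subrelI)
    fix x y assume "(x, y) \<in> (\<Union>i. piece_rel i)"
    then obtain i where i: "(x, y) \<in> piece_rel i" by blast
    then show "(x, y) \<in> (\<Union>i\<in>pieces. piece_rel i)" using pieces_cover[OF i] by blast
  qed blast
  finally have U: "(\<Union>j\<in>?J. piece_rel (?f j)) = (\<Union>i. piece_rel i)" .
  show "restr A.orb X0 = (\<Union>j\<in>?J. restr (piece_rel (?f j)) X0)\<^sup>+"
    unfolding restr U R_def[symmetric] gen_def[symmetric] gen_eq ..
qed

text \<open>Some free point returns to \<open>V\<close> under two different group elements. This
  rules out positive measure wherever the relation restricts to equality.\<close>

lemma no_trivial_piece:
  assumes "infinite (carrier \<Gamma>)" "V \<in> sets M" "emeasure M V > 0"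
  shows "\<exists>x\<in>V. \<exists>y\<in>V. (x, y) \<in> A.orb \<and> x \<noteq> y"
proof -
  obtain x K where x: "x \<in> A.free_part" "K \<subseteq> carrier \<Gamma>" "card K = 2" "\<And>g. g \<in> K \<Longrightarrow> \<phi> g x \<in> V"
    using A.many_returns[OF assms sets.top, of 2] by (metis A.space_M Diff_cancel null_sets.empty_sets)
  then obtain g h where gh: "g \<in> K" "h \<in> K" "g \<noteq> h" by (auto simp: card_2_iff)
  then have "\<phi> g x \<noteq> \<phi> h x" "(\<phi> g x, \<phi> h x) \<in> A.orb"
    using A.free_part_act[OF x(1), of g h] x(2) A.orb_trans[OF A.orb_sym[OF A.orb_act[of g x]] A.orb_act[of h x]]
    by auto
  then show ?thesis using x(4) gh by blast
qed

theorem kurosh_freely_indecomposable: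
  assumes FI: "freely_indecomposable M A.orb" and inf: "infinite (carrier \<Gamma>)"
    and V: "V \<in> sets M" "emeasure M V > 0"
  obtains V' j l where "V' \<in> sets M" "V' \<subseteq> V" "emeasure M V' > 0" "j \<in> I" "l \<in> RW"
    "\<And>x g. x \<in> V' \<Longrightarrow> g \<in> carrier \<Gamma> \<Longrightarrow> \<phi> g x \<in> V' \<Longrightarrow>
      \<exists>h\<in>carrier (F j). \<beta> l (p x) = \<beta> (incl j h) (\<beta> l (p (\<phi> g x)))"
proof -
  let ?J = "to_nat_on pieces ` pieces" and ?Rs = "\<lambda>n. piece_rel (from_nat_into pieces n)"
  have "inessential M A.orb ?J ?Rs"
    using FI decomposition unfolding freely_indecomposable_def by blast
  then obtain U Us where U: "complete_section M A.orb U" "U = (\<Union>j\<in>?J. Us j)"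
    and Us: "\<And>j. j \<in> ?J \<Longrightarrow> Us j \<in> sets M \<and> restr A.orb (Us j) = restr (?Rs j) (Us j)"
    unfolding inessential_def by blast
  have AE: "AE x in M. A.orb `` {x} \<inter> U \<noteq> {}"
    using U(1) A.orb_refl by (auto simp: complete_section_def)
  have "U \<in> sets M" using U(1) by (simp add: complete_section_def)
  then have sat: "A.sat U \<in> sets M" by (rule A.sat_sets)
  have "AE x in M. x \<in> A.sat U" using AE by (rule eventually_mono) (auto simp: A.sat_def A.orb_iff)
  then have "UNIV - A.sat U \<in> null_sets M"
    using AE_iff_null_sets[of "UNIV - A.sat U" M] sat sets.Diff[OF sets.top[of M] sat] by simp
  note V1 = A.pos_diff_null[OF A.pos_diff_null[OF V X0_conull X0_sets] this sat]
  define S where "S = ?J \<times> carrier \<Gamma>"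
  have cS: "countable S" using A.countable_group countable_pieces by (auto simp: S_def)
  \<comment> \<open>Almost every orbit meets \<open>U\<close>, so some \<open>g\<close> moves a part
    of \<open>V\<close> of positive measure into one \<open>Us n\<close>, where the whole orbit
    relation coincides with the piece \<open>n\<close>.\<close>
  have cover: "V \<inter> X0 \<inter> A.sat U \<subseteq> (\<Union>s\<in>S. \<phi> (snd s) -` Us (fst s))"
    using U(2) by (force simp: A.sat_def S_def)
  have "\<phi> (snd s) -` Us (fst s) \<in> sets M" if "s \<in> S" for s
    using that Us A.act_vimage by (auto simp: S_def simp del: A.sets_M)
  then obtain s where s: "s \<in> S" and V2: "V \<inter> X0 \<inter> A.sat U \<inter> \<phi> (snd s) -` Us (fst s) \<in> sets M"
    "emeasure M (V \<inter> X0 \<inter> A.sat U \<inter> \<phi> (snd s) -` Us (fst s)) > 0"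
    using A.pos_piece[OF V1 cS cover] by blast
  define n g i V2 where "n = fst s" and "g = snd s" and "i = from_nat_into pieces n"
    and "V2 = V \<inter> X0 \<inter> A.sat U \<inter> \<phi> g -` Us n"
  have n: "n \<in> ?J" and g: "g \<in> carrier \<Gamma>" using s by (auto simp: S_def n_def g_def)
  have V2: "V2 \<in> sets M" "emeasure M V2 > 0" "V2 \<subseteq> V" "V2 \<subseteq> X0" using V2 by (auto simp: V2_def n_def g_def)
  have local: "(\<phi> g x, \<phi> g y) \<in> piece_rel i" if "x \<in> V2" "y \<in> V2" "(x, y) \<in> A.orb" for x y
  proof -
    have "(\<phi> g x, \<phi> g y) \<in> A.orb"
      using A.orb_trans[OF A.orb_sym[OF A.orb_act[OF g]] A.orb_trans[OF that(3) A.orb_act[OF g]]] .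
    then have "(\<phi> g x, \<phi> g y) \<in> restr A.orb (Us n)" using that by (auto simp: restr_def V2_def)
    then show ?thesis using Us[OF n] by (auto simp: restr_def i_def)
  qed
  have nontrivial: False if "V3 \<in> sets M" "emeasure M V3 > 0" "\<And>x y. x \<in> V3 \<Longrightarrow> y \<in> V3 \<Longrightarrow> (x, y) \<in> A.orb \<Longrightarrow> x = y" for V3
    using no_trivial_piece[OF inf that(1,2)] that(3) by blast
  show thesis
  proof (cases i)
    case Kernel
    \<comment> \<open>\<open>p\<close> is constant on a kernel class, so fixing \<open>t\<close>
      leaves at most one point of it.\<close>
    have "V2 \<subseteq> (\<Union>k\<in>UNIV. \<phi> g -` {x. t x = k})" by auto
    then obtain k where k: "V2 \<inter> \<phi> g -` {x. t x = k} \<in> sets M" "emeasure M (V2 \<inter> \<phi> g -` {x. t x = k}) > 0"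
      using A.pos_piece[OF V2(1,2) countableI_type, of "\<lambda>k. \<phi> g -` {x. t x = k}"] A.act_vimage[OF g t_sets]
      by blast
    have False
    proof (rule nontrivial[OF k])
      fix x y assume xy: "x \<in> V2 \<inter> \<phi> g -` {x. t x = k}" "y \<in> V2 \<inter> \<phi> g -` {x. t x = k}" "(x, y) \<in> A.orb"
      then have "(\<phi> g x, \<phi> g y) \<in> ker" using local[of x y] by (simp add: Kernel)
      then have r: "(\<phi> g x, \<phi> g y) \<in> R" and "\<sigma> (\<phi> g x) (\<phi> g y) = []" by (auto simp: ker_def)
      then have "p (\<phi> g x) = p (\<phi> g y)" using \<sigma>(2)[OF r] by simp
      moreover obtain h where h: "h \<in> carrier \<Gamma>" "\<phi> g y = \<phi> h (\<phi> g x)" "\<phi> g x \<in> X0" using r by (auto simp: R_iff)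
      ultimately have "\<phi> g y = \<phi> g x" using p_t_inj[OF h(3,1)] xy by simp
      then show "x = y" using A.act_inj[OF g] by metis
    qed
    then show thesis ..
  next
    case (Link j u k)
    \<comment> \<open>A link class has one point inside \<open>D j u k\<close> and one outside, so a
      set on one side meets it at most once.\<close>
    define B where "B b = (if b then \<phi> g -` D j u k else UNIV - \<phi> g -` D j u k)" for b
    have Bs: "B b \<in> sets M" for b
      using A.act_vimage[OF g D_sets[of j u k]] sets.top[of M] by (auto simp: B_def simp del: A.sets_M)
    have "V2 \<subseteq> (\<Union>b\<in>UNIV. B b)" by (auto simp: B_def)
    then obtain b where b: "V2 \<inter> B b \<in> sets M" "emeasure M (V2 \<inter> B b) > 0"
      using A.pos_piece[OF V2(1,2) countableI_type, of B] Bs by blast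
    have False
    proof (rule nontrivial[OF b])
      fix x y assume xy: "x \<in> V2 \<inter> B b" "y \<in> V2 \<inter> B b" "(x, y) \<in> A.orb"
      then obtain a where a: "a \<in> D j u k" "\<phi> g x \<in> {a, link j u a}" "\<phi> g y \<in> {a, link j u a}"
        using local[of x y] by (auto simp: Link)
      have "link j u a \<notin> D j u k" using a(1) m_D[of j u k] by blast
      moreover have "\<phi> g x \<in> D j u k \<longleftrightarrow> \<phi> g y \<in> D j u k" using xy by (auto simp: B_def split: if_splits)
      ultimately have "\<phi> g x = \<phi> g y" using a by auto
      then show "x = y" using A.act_inj[OF g] by metis
    qed
    then show thesis ..
  next
    case (Local j u)
    obtain x y where "x \<in> V2" "y \<in> V2" "(x, y) \<in> A.orb" using no_trivial_piece[OF inf V2(1,2)] by blast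
    then have "exit j (\<phi> g x) u" using local[of x y] min_exitD by (auto simp: Local)
    then have j: "j \<in> I" "u \<in> RW" using exitD by blast+
    \<comment> \<open>The piece conjugates by \<open>u\<close> at the moved point
      \<open>\<phi> g x\<close>. Making this product a constant word \<open>l\<close> transfers the
      conjugation to \<open>x\<close>.\<close>
    define B where "B l = {x \<in> X0. u \<otimes>\<^bsub>W\<^esub> inv\<^bsub>W\<^esub> \<sigma> x (\<phi> g x) = l}" for l
    have Bs: "B l \<in> sets M" for l
      using \<sigma>_t_sets[OF g, of "\<lambda>w a b. u \<otimes>\<^bsub>W\<^esub> inv\<^bsub>W\<^esub> w = l"] by (simp add: B_def)
    have "V2 \<subseteq> (\<Union>l\<in>RW. B l)"
      using V2(4) j(2) \<sigma>(1)[OF R_act[OF _ g]] by (auto simp: B_def)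
    then obtain l where l: "l \<in> RW" "V2 \<inter> B l \<in> sets M" "emeasure M (V2 \<inter> B l) > 0"
      using A.pos_piece[OF V2(1,2) countable_RW, of B] Bs by blast
    have pl: "\<beta> l (p x) = \<beta> u (p (\<phi> g x))" if "x \<in> V2 \<inter> B l" for x
    proof -
      have x: "x \<in> X0" "l = u \<otimes>\<^bsub>W\<^esub> inv\<^bsub>W\<^esub> \<sigma> x (\<phi> g x)" using that by (auto simp: B_def)
      note s = \<sigma>[OF R_act[OF x(1) g]]
      have "\<beta> l (p x) = \<beta> u (\<beta> (inv\<^bsub>W\<^esub> \<sigma> x (\<phi> g x)) (p x))"
        using x(2) j(2) s(1) by (simp add: \<beta>_mult)
      also have "\<beta> (inv\<^bsub>W\<^esub> \<sigma> x (\<phi> g x)) (p x) = p (\<phi> g x)"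
        using T.act_inv(1)[of "\<sigma> x (\<phi> g x)" "p (\<phi> g x)"] s by simp
      finally show ?thesis .
    qed
    show thesis
    proof (rule that[OF l(2) _ l(3) j(1) l(1)])
      show "V2 \<inter> B l \<subseteq> V" using V2 by blast
      fix x h assume x: "x \<in> V2 \<inter> B l" "h \<in> carrier \<Gamma>" "\<phi> h x \<in> V2 \<inter> B l"
      then have "(\<phi> g x, \<phi> g (\<phi> h x)) \<in> piece_rel i" using local[of x "\<phi> h x"] A.orb_act by blast
      then have "cl j (\<phi> g x) u (\<phi> g (\<phi> h x)) u" by (simp add: Local)
      then obtain f where f: "f \<in> carrier (F j)" "(\<phi> g x, \<phi> g (\<phi> h x)) \<in> R"
        "u \<otimes>\<^bsub>W\<^esub> \<sigma> (\<phi> g x) (\<phi> g (\<phi> h x)) = incl j f \<otimes>\<^bsub>W\<^esub> u" by (auto simp: cl_def)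
      note s = \<sigma>[OF f(2)]
      have "\<beta> l (p x) = \<beta> (u \<otimes>\<^bsub>W\<^esub> \<sigma> (\<phi> g x) (\<phi> g (\<phi> h x))) (p (\<phi> g (\<phi> h x)))"
        using pl[OF x(1)] s j(2) by (simp add: \<beta>_mult)
      also have "\<dots> = \<beta> (incl j f) (\<beta> u (p (\<phi> g (\<phi> h x))))"
        unfolding f(3) using j f(1) incl_closed by (simp add: \<beta>_mult)
      also have "\<beta> u (p (\<phi> g (\<phi> h x))) = \<beta> l (p (\<phi> h x))" using pl[OF x(3)] by simp
      finally show "\<exists>f\<in>carrier (F j). \<beta> l (p x) = \<beta> (incl j f) (\<beta> l (p (\<phi> h x)))" using f(1) by blast
    qed
  qed
qed

end


section \<open>Copies of actions on the real line\<close>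

text \<open>A sequence of bits read as digits in base 4. In base 2 two sequences could have the same
  sum; here the tail stays below one unit of the preceding digit, so a floor reads every digit
  off.\<close>

definition digit_sum :: "(nat \<Rightarrow> bool) \<Rightarrow> real" where
  "digit_sum b = (\<Sum>m. of_bool (b m) * (1 / 4) ^ Suc m)"

lemma summable_digits: "summable (\<lambda>m. of_bool (b m) * (1 / 4 :: real) ^ Suc m)"
  by (rule summable_comparison_test'[where g = "\<lambda>m. (1 / 4) ^ m" and N = 0])
    (auto simp: of_bool_def intro!: summable_geometric)

lemma digit_sum_Suc: "4 * digit_sum b = of_bool (b 0) + digit_sum (\<lambda>m. b (Suc m))"
proof -
  have "digit_sum b = (\<Sum>m. of_bool (b (Suc m)) * (1 / 4) ^ Suc (Suc m)) + of_bool (b 0) * (1 / 4)"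
    unfolding digit_sum_def using suminf_split_initial_segment[OF summable_digits[of b], of 1] by simp
  also have "(\<Sum>m. of_bool (b (Suc m)) * (1 / 4 :: real) ^ Suc (Suc m)) = digit_sum (\<lambda>m. b (Suc m)) / 4"
    unfolding digit_sum_def using suminf_divide[OF summable_digits[of "\<lambda>m. b (Suc m)"], of 4]
    by (simp add: field_simps)
  finally show ?thesis by simp
qed

lemma digit_sum_bounds: "0 \<le> digit_sum b" "digit_sum b < 1"
proof -
  show "0 \<le> digit_sum b" unfolding digit_sum_def by (rule suminf_nonneg[OF summable_digits]) simp
  have g: "(\<lambda>m. (1 / 4 :: real) ^ m * (1 / 4)) sums ((1 / (1 - 1 / 4)) * (1 / 4))"
    by (rule sums_mult2[OF geometric_sums]) simp
  have "digit_sum b \<le> (\<Sum>m. (1 / 4) ^ m * (1 / 4))"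
    unfolding digit_sum_def using summable_digits[of b] sums_summable[OF g]
    by (rule suminf_le[rotated]) (auto simp: of_bool_def)
  also have "\<dots> < 1" using sums_unique[OF g] by simp
  finally show "digit_sum b < 1" .
qed

lemma digit_of_digit_sum: "\<lfloor>4 ^ Suc n * digit_sum b\<rfloor> mod 4 = of_bool (b n)"
proof (induction n arbitrary: b)
  case 0
  have "\<lfloor>4 * digit_sum b\<rfloor> = of_bool (b 0)"
    unfolding digit_sum_Suc using digit_sum_bounds[of "\<lambda>m. b (Suc m)"] by (intro floor_unique) auto
  then show ?case by simp
next
  case (Suc n)
  have "4 ^ Suc (Suc n) * digit_sum b = 4 ^ Suc n * (4 * digit_sum b)" by simp
  also have "\<dots> = of_int (4 ^ Suc n * of_bool (b 0)) + 4 ^ Suc n * digit_sum (\<lambda>m. b (Suc m))"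
    unfolding digit_sum_Suc by (simp add: algebra_simps)
  finally have "\<lfloor>4 ^ Suc (Suc n) * digit_sum b\<rfloor>
      = 4 * (4 ^ n * of_bool (b 0)) + \<lfloor>4 ^ Suc n * digit_sum (\<lambda>m. b (Suc m))\<rfloor>"
    by (simp only: int_add_floor[symmetric]) simp
  then show ?case using Suc.IH[of "\<lambda>m. b (Suc m)"] by (simp add: mod_mult_self4)
qed

text \<open>
  A point is coded by the list of its approximations in a dense sequence; the decoding takes the
  limit of the approximations. Having a Borel left inverse replaces the theorem that injective
  Borel maps have Borel images.
\<close>

lemma polish_embedding:
  obtains \<iota> :: "'x::polish_space \<Rightarrow> real" and \<rho> :: "real \<Rightarrow> 'x"
  where "\<iota> \<in> borel_measurable borel" "\<rho> \<in> borel_measurable borel" "\<And>x. \<rho> (\<iota> x) = x"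
proof -
  obtain S :: "'x set" where S: "countable S" "\<And>X. open X \<Longrightarrow> X \<noteq> {} \<Longrightarrow> \<exists>d\<in>S. d \<in> X"
    using countable_dense_setE by blast
  have ne: "S \<noteq> {}" using S(2)[OF open_UNIV] by blast
  define d where "d = from_nat_into S"
  define k where "k n x = (LEAST k. dist x (d k) < (1 / 2) ^ n)" for n :: nat and x
  have k: "dist x (d (k n x)) < (1 / 2) ^ n" for n x
  proof -
    have "(0 :: real) < (1 / 2) ^ n" by simp
    then have "ball x ((1 / 2) ^ n) \<noteq> {}" by (simp only: ball_eq_empty not_le)
    then obtain y where "y \<in> S" "y \<in> ball x ((1 / 2) ^ n)" using S(2)[OF open_ball] by blast
    then have "\<exists>k. dist x (d k) < (1 / 2) ^ n"
      using from_nat_into_surj[OF S(1)] unfolding d_def by (metis mem_ball)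
    then show ?thesis unfolding k_def by (rule LeastI_ex)
  qed
  \<comment> \<open>The bit at \<open>prod_encode (n, k)\<close> is set exactly if \<open>k\<close>
    is the index of the \<open>n\<close>-th approximation, so for each \<open>n\<close> a search
    over \<open>k\<close> recovers it.\<close>
  define b where "b x m \<longleftrightarrow> k (fst (prod_decode m)) x = snd (prod_decode m)" for x m
  define \<iota> where "\<iota> x = digit_sum (b x)" for x
  define digit where "digit m r \<longleftrightarrow> \<lfloor>4 ^ Suc m * r\<rfloor> mod 4 = 1" for m and r :: real
  define l where "l n r = d (LEAST k. digit (prod_encode (n, k)) r)" for n r
  \<comment> \<open>The constant default makes the sequence converge at every real, also off the
    image of \<open>\<iota>\<close>, so that its limit is Borel on the whole line.\<close>
  define l' where "l' n r = (if Cauchy (\<lambda>n. l n r) then l n r else d 0)" for n r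
  define \<rho> where "\<rho> r = lim (\<lambda>n. l' n r)" for r
  have l': "l n (\<iota> x) = d (k n x)" for n x
  proof -
    have "digit (prod_encode (n, j)) (\<iota> x) \<longleftrightarrow> k n x = j" for j
      using digit_of_digit_sum[of "prod_encode (n, j)" "b x"] by (simp add: digit_def \<iota>_def b_def)
    moreover have "(LEAST j. k n x = j) = k n x" by (rule Least_equality) auto
    ultimately show ?thesis by (simp add: l_def)
  qed
  have lim: "(\<lambda>n. d (k n x)) \<longlonglongrightarrow> x" for x
  proof (rule metric_tendsto_imp_tendsto[where a = 0 and b = "x" and g = "\<lambda>n. d (k n x)"])
    show "(\<lambda>n. (1 / 2 :: real) ^ n) \<longlonglongrightarrow> 0" by (rule LIMSEQ_realpow_zero) auto
    show "\<forall>\<^sub>F n in sequentially. dist (d (k n x)) x \<le> dist ((1 / 2 :: real) ^ n) 0"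
      using k[of x] by (auto simp: dist_commute less_imp_le)
  qed
  have \<rho>\<iota>: "\<rho> (\<iota> x) = x" for x
    unfolding \<rho>_def l'_def l' using lim[of x] LIMSEQ_imp_Cauchy[OF lim[of x]] by (simp add: limI)
  have conv: "(\<lambda>n. l' n r) \<longlonglongrightarrow> \<rho> r" for r
  proof -
    have "convergent (\<lambda>n. l' n r)"
      by (cases "Cauchy (\<lambda>n. l n r)") (auto simp: l'_def Cauchy_convergent_iff convergent_const)
    then show ?thesis by (simp add: \<rho>_def convergent_LIMSEQ_iff)
  qed
  have [measurable]: "(\<lambda>x. dist x (d j)) \<in> borel_measurable borel" for j
    by (intro borel_measurable_dist) auto
  have [measurable]: "k n \<in> measurable borel (count_space UNIV)" for n
    unfolding k_def by measurable
  have \<iota>: "\<iota> \<in> borel_measurable borel"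
    unfolding \<iota>_def digit_sum_def b_def by measurable
  have dm [measurable]: "(\<lambda>r. digit m r) \<in> measurable borel (count_space UNIV)" for m
    unfolding digit_def by measurable
  have lm [measurable]: "l n \<in> borel_measurable borel" for n
  proof -
    have "(\<lambda>r. LEAST k. digit (prod_encode (n, k)) r) \<in> measurable borel (count_space UNIV)" by measurable
    then show ?thesis unfolding l_def by (rule measurable_compose) simp
  qed
  have "{r \<in> space borel. Cauchy (\<lambda>n. l n r)} \<in> sets borel" by (rule sets_Collect_Cauchy[OF lm])
  then have l'm: "l' n \<in> borel_measurable borel" for n
    unfolding l'_def by (intro measurable_If lm) auto
  have "\<rho> \<in> borel_measurable borel" by (rule borel_measurable_LIMSEQ_metric[OF l'm conv])
  then show thesis using that[OF \<iota> _ \<rho>\<iota>] by blast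
qed

lemma pmp_actionI:
  fixes M :: "'x::polish_space measure"
  assumes "group \<Gamma>" "countable (carrier \<Gamma>)" "prob_space M" "sets M = sets borel" "nonatomic M"
    and one: "\<And>x. \<phi> \<one>\<^bsub>\<Gamma>\<^esub> x = x"
    and mult: "\<And>g h x. g \<in> carrier \<Gamma> \<Longrightarrow> h \<in> carrier \<Gamma> \<Longrightarrow> \<phi> (g \<otimes>\<^bsub>\<Gamma>\<^esub> h) x = \<phi> g (\<phi> h x)"
    and meas: "\<And>g. g \<in> carrier \<Gamma> \<Longrightarrow> \<phi> g \<in> measurable M M"
    and pres: "\<And>g A. g \<in> carrier \<Gamma> \<Longrightarrow> A \<in> sets M \<Longrightarrow> emeasure M (\<phi> g -` A) = emeasure M A"
    and free: "AE x in M. \<forall>g\<in>carrier \<Gamma>. \<phi> g x = x \<longrightarrow> g = \<one>\<^bsub>\<Gamma>\<^esub>"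
  shows "pmp_action \<Gamma> M \<phi>"
proof
  interpret group \<Gamma> by fact
  have sp: "space M = UNIV" using sets_eq_imp_space_eq[OF assms(4)] by simp
  have bij: "\<phi> g \<in> Bij UNIV" if g: "g \<in> carrier \<Gamma>" for g
  proof -
    have "bij (\<phi> g)"
      by (rule o_bij[of "\<phi> (inv\<^bsub>\<Gamma>\<^esub> g)"]) (auto simp: fun_eq_iff g mult[symmetric] one)
    then show ?thesis by (simp add: Bij_def)
  qed
  have "group_action \<Gamma> (space M) \<phi>"
    unfolding group_action_def group_hom_def group_hom_axioms_def sp
    by (intro conjI assms(1) group_BijGroup homI)
      (auto simp: BijGroup_def bij compose_def fun_eq_iff mult)
  moreover have "distr M M (\<phi> g) = M" if g: "g \<in> carrier \<Gamma>" for g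
    by (rule measure_eqI) (simp_all add: emeasure_distr[OF meas[OF g]] sp pres[OF g])
  ultimately show "free_pmp_action \<Gamma> M \<phi>"
    using assms by (simp add: free_pmp_action_def standard_prob_space_def)
qed fact

lemma (in pmp_action) pmp_action_hom:
  assumes "group G" "inc \<in> hom G \<Gamma>" "inj_on inc (carrier G)"
  shows "pmp_action G M (\<lambda>g. \<phi> (inc g))"
proof (rule pmp_actionI[OF assms(1) _ prob_M sets_M nonatomic_M])
  interpret G: group G by fact
  interpret h: group_hom G \<Gamma> inc using assms by unfold_locales auto
  show "countable (carrier G)"
  proof (rule countable_image_inj_on[OF countable_subset[OF _ countable_group] assms(3)])
    show "inc ` carrier G \<subseteq> carrier \<Gamma>" by auto
  qed
  show "\<phi> (inc \<one>\<^bsub>G\<^esub>) x = x" for x by simp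
  show "\<phi> (inc (g \<otimes>\<^bsub>G\<^esub> h)) x = \<phi> (inc g) (\<phi> (inc h) x)" if "g \<in> carrier G" "h \<in> carrier G" for g h x
    using that by (simp add: act_mult)
  show "\<phi> (inc g) \<in> measurable M M" if "g \<in> carrier G" for g
    using that by (intro act_measurable) simp
  show "emeasure M (\<phi> (inc g) -` A) = emeasure M A" if "g \<in> carrier G" "A \<in> sets M" for g A
    using that by (intro emeasure_act_vimage) simp_all
  have "AE x in M. x \<in> free_part" using AE_not_in[OF free_part_conull] by simp
  then show "AE x in M. \<forall>g\<in>carrier G. \<phi> (inc g) x = x \<longrightarrow> g = \<one>\<^bsub>G\<^esub>"
  proof eventually_elim
    fix x assume "x \<in> free_part"
    show "\<forall>g\<in>carrier G. \<phi> (inc g) x = x \<longrightarrow> g = \<one>\<^bsub>G\<^esub>"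
    proof (intro ballI impI)
      fix g assume g: "g \<in> carrier G" "\<phi> (inc g) x = x"
      then have "inc g = inc \<one>\<^bsub>G\<^esub>" using \<open>x \<in> free_part\<close> by (simp add: free_part_def)
      then show "g = \<one>\<^bsub>G\<^esub>" using inj_onD[OF assms(3) _ g(1) G.one_closed] by blast
    qed
  qed
qed

text \<open>Conditioning the measure restricts an action to an invariant set without changing its
  type or its maps.\<close>

lemma (in pmp_action) pmp_action_uniform:
  assumes Y: "Y \<in> sets M" "emeasure M Y > 0" and inv: "\<And>g x. g \<in> carrier \<Gamma> \<Longrightarrow> \<phi> g x \<in> Y \<longleftrightarrow> x \<in> Y"
  shows "pmp_action \<Gamma> (uniform_measure M Y) \<phi>"
proof (rule pmp_actionI[OF is_group countable_group])
  have Y0: "emeasure M Y \<noteq> 0" "emeasure M Y \<noteq> \<infinity>" using Y by (auto simp: emeasure_eq_measure)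
  have em: "emeasure (uniform_measure M Y) A = emeasure M (Y \<inter> A) / emeasure M Y" if "A \<in> sets M" for A
    using emeasure_uniform_measure[OF Y(1) that] by simp
  show "prob_space (uniform_measure M Y)" using Y0 by (rule prob_space_uniform_measure)
  show "sets (uniform_measure M Y) = sets borel" by simp
  show "nonatomic (uniform_measure M Y)"
    unfolding nonatomic_def
  proof (intro ballI impI)
    fix A assume "A \<in> sets (uniform_measure M Y)" "0 < emeasure (uniform_measure M Y) A"
    then have A: "A \<in> sets M" "0 < emeasure M (Y \<inter> A)"
      using em[of A] by (auto simp: zero_less_iff_neq_zero)
    then obtain B where B: "B \<in> sets M" "B \<subseteq> Y \<inter> A" "0 < emeasure M B" "emeasure M B < emeasure M (Y \<inter> A)"
      using nonatomic_M Y(1) unfolding nonatomic_def by (metis sets.Int)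
    have "Y \<inter> B = B" using B by blast
    then have "0 < emeasure (uniform_measure M Y) B"
      "emeasure (uniform_measure M Y) B < emeasure (uniform_measure M Y) A"
      using em[OF A(1)] em[OF B(1)] B Y(2)
      by (auto simp: emeasure_eq_measure divide_ennreal ennreal_less_iff divide_strict_right_mono)
    then show "\<exists>B\<in>sets (uniform_measure M Y). B \<subseteq> A \<and> 0 < emeasure (uniform_measure M Y) B \<and>
        emeasure (uniform_measure M Y) B < emeasure (uniform_measure M Y) A"
      using B by auto
  qed
  show "\<phi> g \<in> measurable (uniform_measure M Y) (uniform_measure M Y)" if "g \<in> carrier \<Gamma>" for g
    using act_measurable[OF that] by simp
  show "emeasure (uniform_measure M Y) (\<phi> g -` A) = emeasure (uniform_measure M Y) A"
    if "g \<in> carrier \<Gamma>" "A \<in> sets (uniform_measure M Y)" for g A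
  proof -
    have A: "A \<in> sets M" using that by simp
    have "Y \<inter> \<phi> g -` A = \<phi> g -` (Y \<inter> A)" using inv[OF that(1)] by auto
    then show ?thesis
      using em[OF A] em[OF act_vimage[OF that(1) A]] emeasure_act_vimage[OF that(1), of "Y \<inter> A"] A Y(1) by simp
  qed
  have "AE x in M. x \<in> free_part" using AE_not_in[OF free_part_conull] by simp
  then show "AE x in uniform_measure M Y. \<forall>g\<in>carrier \<Gamma>. \<phi> g x = x \<longrightarrow> g = \<one>\<^bsub>\<Gamma>\<^esub>"
    by (intro AE_uniform_measureI[OF Y(1)]) (auto simp: free_part_def elim: eventually_mono)
qed (simp_all add: act_mult)

section \<open>Transport of an action to the line\<close>

locale real_copy = pmp_action \<Gamma> M \<phi> for \<Gamma> and M :: "'x::polish_space measure" and \<phi> +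
  fixes \<iota> :: "'x \<Rightarrow> real" and \<rho> :: "real \<Rightarrow> 'x"
  assumes \<iota>_borel: "\<iota> \<in> borel_measurable borel" and \<rho>_borel: "\<rho> \<in> borel_measurable borel"
    and \<rho>_\<iota> [simp]: "\<rho> (\<iota> x) = x"
begin

definition M' :: "real measure" where "M' = distr M borel \<iota>"

text \<open>Off the image of \<open>\<iota>\<close>, a null set for \<open>M'\<close>, every group
  element acts as the identity; freeness is demanded only almost everywhere.\<close>

definition \<phi>' where "\<phi>' g r = (if \<iota> (\<rho> r) = r then \<iota> (\<phi> g (\<rho> r)) else r)"

lemma sets_M' [simp]: "sets M' = sets borel" by (simp add: M'_def)

lemma \<iota>_meas: "\<iota> \<in> measurable M M'"
  using \<iota>_borel measurable_cong_sets[OF sets_M sets_M'] by blast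

lemma \<rho>_meas: "\<rho> \<in> measurable M' M"
  using \<rho>_borel measurable_cong_sets[OF sets_M' sets_M] by blast

lemma emeasure_M': "A \<in> sets borel \<Longrightarrow> emeasure M' A = emeasure M (\<iota> -` A)"
  unfolding M'_def using \<iota>_meas by (subst emeasure_distr) (auto simp: measurable_def M'_def)

definition copy :: "'x set \<Rightarrow> real set" where
  "copy A = {r. \<iota> (\<rho> r) = r \<and> \<rho> r \<in> A}"

lemma copy_sets: "A \<in> sets M \<Longrightarrow> copy A \<in> sets borel"
proof -
  assume A: "A \<in> sets M"
  have "(\<lambda>r. \<iota> (\<rho> r)) \<in> borel_measurable borel" using measurable_compose[OF \<rho>_borel \<iota>_borel] .
  then have "{r \<in> space borel. \<iota> (\<rho> r) = r} \<in> sets borel" by measurable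
  moreover have "\<rho> -` A \<inter> space borel \<in> sets borel" using A by (intro measurable_sets[OF \<rho>_borel]) simp
  ultimately have "{r \<in> space borel. \<iota> (\<rho> r) = r} \<inter> (\<rho> -` A \<inter> space borel) \<in> sets borel" by (rule sets.Int)
  then show ?thesis by (simp add: copy_def Int_def vimage_def)
qed

lemma \<iota>_copy: "\<iota> x \<in> copy A \<longleftrightarrow> x \<in> A" "\<iota> -` copy A = A"
  by (auto simp: copy_def)

lemma copyD: "r \<in> copy A \<Longrightarrow> \<rho> r \<in> A \<and> r = \<iota> (\<rho> r)"
  by (simp add: copy_def)

lemma \<phi>'_\<iota>: "\<phi>' g (\<iota> x) = \<iota> (\<phi> g x)"
  by (simp add: \<phi>'_def)

lemma pmp_copy: "pmp_action \<Gamma> M' \<phi>'"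
proof (rule pmp_actionI[OF is_group countable_group])
  show "prob_space M'" unfolding M'_def using \<iota>_meas by (intro prob_space_distr) (simp add: M'_def)
  show "sets M' = sets borel" by simp
  show "nonatomic M'"
    unfolding nonatomic_def
  proof (intro ballI impI)
    fix A assume "A \<in> sets M'" "0 < emeasure M' A"
    then have "\<iota> -` A \<in> sets M" "0 < emeasure M (\<iota> -` A)"
      using measurable_sets[OF \<iota>_meas, of A] emeasure_M' by auto
    then obtain B where B: "B \<in> sets M" "B \<subseteq> \<iota> -` A" "0 < emeasure M B" "emeasure M B < emeasure M (\<iota> -` A)"
      using nonatomic_M unfolding nonatomic_def by blast
    then show "\<exists>B\<in>sets M'. B \<subseteq> A \<and> 0 < emeasure M' B \<and> emeasure M' B < emeasure M' A"
      using \<open>A \<in> sets M'\<close> copy_sets[OF B(1)]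
      by (intro bexI[of _ "copy B"]) (auto simp: emeasure_M' \<iota>_copy dest!: copyD)
  qed
  show "\<phi>' \<one>\<^bsub>\<Gamma>\<^esub> r = r" for r by (simp add: \<phi>'_def)
  show "\<phi>' (g \<otimes>\<^bsub>\<Gamma>\<^esub> h) r = \<phi>' g (\<phi>' h r)" if "g \<in> carrier \<Gamma>" "h \<in> carrier \<Gamma>" for g h r
    using that by (simp add: \<phi>'_def act_mult)
  show "\<phi>' g \<in> measurable M' M'" if g: "g \<in> carrier \<Gamma>" for g
  proof -
    have "(\<lambda>r. \<iota> (\<rho> r)) \<in> borel_measurable borel" using measurable_compose[OF \<rho>_borel \<iota>_borel] .
    then have "{r \<in> space borel. \<iota> (\<rho> r) = r} \<in> sets borel" by measurable
    then have "{r \<in> space M'. \<iota> (\<rho> r) = r} \<in> sets M'" by (simp add: M'_def)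
    then show ?thesis
      unfolding \<phi>'_def
      using measurable_compose[OF measurable_compose[OF \<rho>_meas act_measurable[OF g]] \<iota>_meas]
      by (intro measurable_If) auto
  qed
  show "emeasure M' (\<phi>' g -` A) = emeasure M' A" if g: "g \<in> carrier \<Gamma>" and A: "A \<in> sets M'" for g A
  proof -
    have "\<phi>' g -` A \<inter> space M' \<in> sets M'" using \<open>g \<in> carrier \<Gamma> \<Longrightarrow> \<phi>' g \<in> measurable M' M'\<close>[OF g] A
      by (rule measurable_sets)
    then have "emeasure M' (\<phi>' g -` A) = emeasure M (\<iota> -` (\<phi>' g -` A))"
      by (subst emeasure_M') (simp_all add: M'_def)
    also have "\<iota> -` (\<phi>' g -` A) = \<phi> g -` (\<iota> -` A)" by (auto simp: \<phi>'_\<iota>)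
    also have "emeasure M \<dots> = emeasure M' A"
      using A measurable_sets[OF \<iota>_meas A] by (simp add: emeasure_act_vimage[OF g] emeasure_M')
    finally show ?thesis .
  qed
  have "AE x in M. x \<in> free_part" using AE_not_in[OF free_part_conull] by simp
  then show "AE r in M'. \<forall>g\<in>carrier \<Gamma>. \<phi>' g r = r \<longrightarrow> g = \<one>\<^bsub>\<Gamma>\<^esub>"
  proof -
    have null: "UNIV - copy free_part \<in> null_sets M'"
      using free_part_conull copy_sets[OF free_part_sets] emeasure_M'[of "UNIV - copy free_part"]
      by (auto simp: null_sets_def vimage_Diff \<iota>_copy)
    show ?thesis
      using AE_not_in[OF null]
    proof eventually_elim
      fix r assume "r \<notin> UNIV - copy free_part"
      then have r: "\<rho> r \<in> free_part" "r = \<iota> (\<rho> r)" using copyD by blast+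
      show "\<forall>g\<in>carrier \<Gamma>. \<phi>' g r = r \<longrightarrow> g = \<one>\<^bsub>\<Gamma>\<^esub>"
      proof (intro ballI impI)
        fix g assume g: "g \<in> carrier \<Gamma>" "\<phi>' g r = r"
        then have "\<iota> (\<phi> g (\<rho> r)) = \<iota> (\<rho> r)" using \<phi>'_\<iota>[of g "\<rho> r"] r(2) by simp
        then have "\<phi> g (\<rho> r) = \<rho> r" by (metis \<rho>_\<iota>)
        then show "g = \<one>\<^bsub>\<Gamma>\<^esub>" using r(1) g(1) by (simp add: free_part_def)
      qed
    qed
  qed
qed

end

lemma (in pmp_action) ex_real_copy: "\<exists>\<iota> \<rho>. real_copy \<Gamma> M \<phi> \<iota> \<rho>"
proof -
  obtain \<iota> :: "'x \<Rightarrow> real" and \<rho> where "\<iota> \<in> borel_measurable borel" "\<rho> \<in> borel_measurable borel" "\<And>x. \<rho> (\<iota> x) = x"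
    using polish_embedding by metis
  then have "real_copy \<Gamma> M \<phi> \<iota> \<rho>" by unfold_locales
  then show ?thesis by blast
qed

text \<open>\<open>MFI\<close> speaks of actions on the real line, so the acting side is copied
  there and the result pulled back along \<open>\<iota>\<close>. The target \<open>N\<close> stays
  as it is.\<close>

theorem (in kurosh) kurosh_MFI:
  assumes MFI: "MFI \<Gamma>" and inf: "infinite (carrier \<Gamma>)"
    and V: "V \<in> sets M" "emeasure M V > 0"
  obtains V' j l where "V' \<in> sets M" "V' \<subseteq> V" "emeasure M V' > 0" "j \<in> I" "l \<in> RW"
    "\<And>x g. x \<in> V' \<Longrightarrow> g \<in> carrier \<Gamma> \<Longrightarrow> \<phi> g x \<in> V' \<Longrightarrow>
      \<exists>h\<in>carrier (F j). \<beta> l (p x) = \<beta> (incl j h) (\<beta> l (p (\<phi> g x)))"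
proof -
  obtain \<iota> \<rho> where "real_copy \<Gamma> M \<phi> \<iota> \<rho>" using A.ex_real_copy by blast
  then interpret C: real_copy \<Gamma> M \<phi> \<iota> \<rho> .
  interpret C': pmp_action \<Gamma> C.M' C.\<phi>' by (rule C.pmp_copy)
  interpret K: kurosh \<Gamma> C.M' C.\<phi>' I F N \<beta> "\<lambda>r. p (\<rho> r)" "\<lambda>r. t (\<rho> r)" "C.copy X0"
  proof unfold_locales
    show "countable I" by (rule countable_I)
    show "countable (carrier (F i))" if "i \<in> I" for i using countable_F[OF that] .
    show "C.copy X0 \<in> sets C.M'" using C.copy_sets[OF X0_sets] by simp
    show "UNIV - C.copy X0 \<in> null_sets C.M'"
      using X0_conull C.copy_sets[OF X0_sets] C.emeasure_M'[of "UNIV - C.copy X0"]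
      by (auto simp: null_sets_def vimage_Diff C.\<iota>_copy)
    show "(\<lambda>r. p (\<rho> r)) \<in> measurable C.M' N" using measurable_compose[OF C.\<rho>_meas p_meas] .
    show "(\<lambda>r. t (\<rho> r)) \<in> measurable C.M' (count_space UNIV)" using measurable_compose[OF C.\<rho>_meas t_meas] .
    fix r assume "r \<in> C.copy X0"
    then have r: "\<rho> r \<in> X0" "\<iota> (\<rho> r) = r" using C.copyD by auto
    show "p (\<rho> r) \<in> T.free_part" using p_free[OF r(1)] .
    fix g assume g: "g \<in> carrier \<Gamma>"
    have gr: "C.\<phi>' g r = \<iota> (\<phi> g (\<rho> r))" using C.\<phi>'_\<iota>[of g "\<rho> r"] r(2) by simp
    show "C.\<phi>' g r \<in> C.copy X0" using X0_inv[OF r(1) g] by (simp add: gr C.\<iota>_copy)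
    show "(p (\<rho> r), p (\<rho> (C.\<phi>' g r))) \<in> T.orb" using p_orb[OF r(1) g] by (simp add: gr)
    show "C.\<phi>' g r = r" if "p (\<rho> (C.\<phi>' g r)) = p (\<rho> r)" "t (\<rho> (C.\<phi>' g r)) = t (\<rho> r)"
      using p_t_inj[OF r(1) g] that r(2) by (simp add: gr)
  qed
  have "freely_indecomposable C.M' C'.orb" using MFI C'.free_pmp by (simp add: MFI_def)
  moreover have "C.copy V \<in> sets C.M'" "emeasure C.M' (C.copy V) > 0"
    using C.copy_sets[OF V(1)] V(2) by (simp_all add: C.emeasure_M' C.\<iota>_copy)
  ultimately obtain V' j l where V': "V' \<in> sets C.M'" "V' \<subseteq> C.copy V" "emeasure C.M' V' > 0" "j \<in> I" "l \<in> RW"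
    and *: "\<And>x g. x \<in> V' \<Longrightarrow> g \<in> carrier \<Gamma> \<Longrightarrow> C.\<phi>' g x \<in> V' \<Longrightarrow>
      \<exists>h\<in>carrier (F j). \<beta> l (p (\<rho> x)) = \<beta> (incl j h) (\<beta> l (p (\<rho> (C.\<phi>' g x))))"
    using K.kurosh_freely_indecomposable[OF _ inf] by metis
  show thesis
  proof (rule that[of "\<iota> -` V'" j l])
    show "\<iota> -` V' \<in> sets M" using measurable_sets[OF C.\<iota>_meas V'(1)] by simp
    show "\<iota> -` V' \<subseteq> V" using V'(2) C.\<iota>_copy(1) by blast
    show "emeasure M (\<iota> -` V') > 0" using V'(1,3) C.emeasure_M'[of V'] by simp
    show "\<exists>h\<in>carrier (F j). \<beta> l (p x) = \<beta> (incl j h) (\<beta> l (p (\<phi> g x)))"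
      if "x \<in> \<iota> -` V'" "g \<in> carrier \<Gamma>" "\<phi> g x \<in> \<iota> -` V'" for x g
      using *[of "\<iota> x" g] that by (simp add: C.\<phi>'_\<iota>)
  qed (use V' in auto)
qed

section \<open>A local criterion for measure equivalence\<close>

text \<open>\<open>A\<close> and \<open>B\<close> may fail to be complete sections. They become
  complete when both measures are conditioned on the saturations, and the normalisation then absorbs
  the factor \<open>c\<close>.\<close>

lemma measure_equivalentI_real:
  fixes M :: "real measure" and N :: "real measure"
  assumes "pmp_action G M \<phi>" "pmp_action H N \<psi>"
    and A: "A \<in> sets M" "emeasure M A > 0" and B: "B \<in> sets N"
    and \<Theta>: "\<Theta> \<in> measurable M N" and \<Theta>': "\<Theta>' \<in> measurable N M" and img: "\<Theta> ` A = B"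
    and inv: "\<And>x. x \<in> A \<Longrightarrow> \<Theta>' (\<Theta> x) = x"
    and c: "c > 0" and scale: "\<And>C. C \<in> sets M \<Longrightarrow> C \<subseteq> A \<Longrightarrow> measure N (\<Theta> ` C) = c * measure M C"
    and orb: "\<And>x y. x \<in> A \<Longrightarrow> y \<in> A \<Longrightarrow>
      (x, y) \<in> orbit_relation G M \<phi> \<longleftrightarrow> (\<Theta> x, \<Theta> y) \<in> orbit_relation H N \<psi>"
  shows "measure_equivalent G H"
proof -
  interpret X: pmp_action G M \<phi> by fact
  interpret Y: pmp_action H N \<psi> by fact
  have mA: "measure M A > 0" using A by (simp add: X.emeasure_eq_measure)
  have mB: "measure N B = c * measure M A" using scale[OF A(1)] img by simp
  then have "measure N B > 0" using c mA by simp
  then have B': "emeasure N B > 0" by (simp add: Y.emeasure_eq_measure)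
  define A' B' where "A' = X.sat A" and "B' = Y.sat B"
  have A': "A' \<in> sets M" "A \<subseteq> A'" using X.sat_sets[OF A(1)] X.subset_sat by (auto simp: A'_def)
  have B'': "B' \<in> sets N" "B \<subseteq> B'" using Y.sat_sets[OF B] Y.subset_sat by (auto simp: B'_def)
  have pos: "emeasure M A' > 0" "emeasure N B' > 0"
    using emeasure_mono[OF A'(2,1)] emeasure_mono[OF B''(2,1)] A(2) B' by auto
  define M1 N1 where "M1 = uniform_measure M A'" and "N1 = uniform_measure N B'"
  have sets1: "sets M1 = sets M" "sets N1 = sets N" by (simp_all add: M1_def N1_def)
  have sp: "space M1 = UNIV" "space N1 = UNIV" by (simp_all add: M1_def N1_def)
  interpret X1: pmp_action G M1 \<phi>
    unfolding M1_def using A'(1) pos(1) X.sat_invariant by (intro X.pmp_action_uniform) (auto simp: A'_def)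
  interpret Y1: pmp_action H N1 \<psi>
    unfolding N1_def using B''(1) pos(2) Y.sat_invariant by (intro Y.pmp_action_uniform) (auto simp: B'_def)
  have orb1: "orbit_relation G M1 \<phi> = X.orb" "orbit_relation H N1 \<psi> = Y.orb"
    by (simp_all add: orbit_relation_def sp)
  have m1: "measure M1 C = measure M C / measure M A'" if "C \<in> sets M" "C \<subseteq> A" for C
    using measure_uniform_measure[of M A' C] pos(1) that A' by (simp add: M1_def Int_absorb1 X.emeasure_eq_measure)
  have n1: "measure N1 C = measure N C / measure N B'" if "C \<in> sets N" "C \<subseteq> B" for C
    using measure_uniform_measure[of N B' C] pos(2) that B'' by (simp add: N1_def Int_absorb1 Y.emeasure_eq_measure)
  have mA': "measure M A' > 0" "measure N B' > 0" using pos by (simp_all add: X.emeasure_eq_measure Y.emeasure_eq_measure)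
  have im: "\<Theta> ` C \<in> sets N" if "C \<in> sets M" "C \<subseteq> A" for C
  proof -
    have "\<Theta> ` C = B \<inter> \<Theta>' -` C" using that inv img by force
    then show ?thesis using measurable_sets[OF \<Theta>' that(1)] B by auto
  qed
  have bij: "bij_betw \<Theta> A B" using img inv by (metis bij_betw_imageI inj_on_inverseI)
  have "stably_orbit_equivalent M1 X.orb N1 Y.orb"
    unfolding stably_orbit_equivalent_def
  proof (intro exI conjI)
    show "complete_section M1 X.orb A"
      unfolding complete_section_def
    proof (intro conjI)
      show "A \<in> sets M1" using A sets1 by simp
      show "A \<subseteq> Domain X.orb" using X.orb_refl by blast
      show "AE x in M1. x \<in> Domain X.orb \<longrightarrow> X.orb `` {x} \<inter> A \<noteq> {}"
        unfolding M1_def by (intro AE_uniform_measureI[OF A'(1)] AE_I2) (use X.orb_act in \<open>unfold A'_def X.sat_def, blast\<close>)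
    qed
    show "complete_section N1 Y.orb B"
      unfolding complete_section_def
    proof (intro conjI)
      show "B \<in> sets N1" using B sets1 by simp
      show "B \<subseteq> Domain Y.orb" using Y.orb_refl by blast
      show "AE x in N1. x \<in> Domain Y.orb \<longrightarrow> Y.orb `` {x} \<inter> B \<noteq> {}"
        unfolding N1_def by (intro AE_uniform_measureI[OF B''(1)] AE_I2) (use Y.orb_act in \<open>unfold B'_def Y.sat_def, blast\<close>)
    qed
    show "bij_betw \<Theta> A B" by (rule bij)
    have t1: "\<Theta> \<in> measurable M1 N1" "\<Theta>' \<in> measurable N1 M1"
      using \<Theta> \<Theta>' measurable_cong_sets[OF sets1(1) sets1(2)] measurable_cong_sets[OF sets1(2) sets1(1)] by auto
    show "\<Theta> \<in> measurable (restrict_space M1 A) (restrict_space N1 B)"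
      using t1 img by (intro measurable_restrict_space3) auto
    have "\<Theta>' \<in> measurable (restrict_space N1 B) (restrict_space M1 A)"
      using t1 img inv by (intro measurable_restrict_space3) auto
    moreover have "the_inv_into A \<Theta> y = \<Theta>' y" if "y \<in> B" for y
      using that img inv bij by (auto simp: bij_betw_def the_inv_into_f_f)
    ultimately show "the_inv_into A \<Theta> \<in> measurable (restrict_space N1 B) (restrict_space M1 A)"
      by (subst measurable_cong[of _ _ \<Theta>']) (auto simp: space_restrict_space)
    show "\<forall>C\<in>sets M1. C \<subseteq> A \<longrightarrow> measure N1 (\<Theta> ` C) / measure N1 B = measure M1 C / measure M1 A"
    proof (intro ballI impI)
      fix C assume "C \<in> sets M1" and CA: "C \<subseteq> A"
      then have C: "C \<in> sets M" using sets1 by simp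
      have "\<Theta> ` C \<subseteq> B" using CA img by blast
      then show "measure N1 (\<Theta> ` C) / measure N1 B = measure M1 C / measure M1 A"
        using n1[OF im[OF C CA]] n1[OF B] m1[OF C CA] m1[OF A(1)] scale[OF C CA] mB mA mA' c by simp
    qed
    show "\<exists>A0\<in>sets M1. A0 \<subseteq> A \<and> A - A0 \<in> null_sets M1 \<and>
        (\<forall>x\<in>A0. \<forall>y\<in>A0. (x, y) \<in> X.orb \<longleftrightarrow> (\<Theta> x, \<Theta> y) \<in> Y.orb)"
      using orb A(1) sets1 by (intro bexI[of _ A]) auto
  qed
  then show ?thesis
    using X1.free_pmp Y1.free_pmp unfolding measure_equivalent_def orb1[symmetric] by blast
qed

lemma measure_equivalentI:
  fixes M :: "'x::polish_space measure" and N :: "'y::polish_space measure"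
  assumes "pmp_action G M \<phi>" "pmp_action H N \<psi>"
    and A: "A \<in> sets M" "emeasure M A > 0" and B: "B \<in> sets N"
    and \<Theta>: "\<Theta> \<in> measurable M N" and \<Theta>': "\<Theta>' \<in> measurable N M" and img: "\<Theta> ` A = B"
    and inv: "\<And>x. x \<in> A \<Longrightarrow> \<Theta>' (\<Theta> x) = x"
    and c: "c > 0" and scale: "\<And>C. C \<in> sets M \<Longrightarrow> C \<subseteq> A \<Longrightarrow> measure N (\<Theta> ` C) = c * measure M C"
    and orb: "\<And>x y. x \<in> A \<Longrightarrow> y \<in> A \<Longrightarrow>
      (x, y) \<in> orbit_relation G M \<phi> \<longleftrightarrow> (\<Theta> x, \<Theta> y) \<in> orbit_relation H N \<psi>"
  shows "measure_equivalent G H"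
proof -
  interpret X: pmp_action G M \<phi> by fact
  interpret Y: pmp_action H N \<psi> by fact
  obtain \<iota> \<rho> where "real_copy G M \<phi> \<iota> \<rho>" using X.ex_real_copy by blast
  then interpret X: real_copy G M \<phi> \<iota> \<rho> .
  obtain \<iota>' \<rho>' where "real_copy H N \<psi> \<iota>' \<rho>'" using Y.ex_real_copy by blast
  then interpret Y: real_copy H N \<psi> \<iota>' \<rho>' .
  interpret X': pmp_action G X.M' X.\<phi>' by (rule X.pmp_copy)
  interpret Y': pmp_action H Y.M' Y.\<phi>' by (rule Y.pmp_copy)
  have orbX: "(\<iota> x, \<iota> y) \<in> X'.orb \<longleftrightarrow> (x, y) \<in> X.orb" for x y
    unfolding X'.orb_iff X.orb_iff X.\<phi>'_\<iota> by (metis X.\<rho>_\<iota>)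
  have orbY: "(\<iota>' x, \<iota>' y) \<in> Y'.orb \<longleftrightarrow> (x, y) \<in> Y.orb" for x y
    unfolding Y'.orb_iff Y.orb_iff Y.\<phi>'_\<iota> by (metis Y.\<rho>_\<iota>)
  have im: "(\<lambda>r. \<iota>' (\<Theta> (\<rho> r))) ` C = Y.copy (\<Theta> ` (\<iota> -` C))" if "C \<subseteq> X.copy A" for C
  proof (intro equalityI subsetI)
    fix s assume "s \<in> (\<lambda>r. \<iota>' (\<Theta> (\<rho> r))) ` C"
    then obtain r where r: "r \<in> C" "s = \<iota>' (\<Theta> (\<rho> r))" by blast
    then have "\<rho> r \<in> \<iota> -` C" using X.copyD[of r A] that by auto
    then show "s \<in> Y.copy (\<Theta> ` (\<iota> -` C))" unfolding r(2) by (auto simp: Y.\<iota>_copy)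
  next
    fix s assume "s \<in> Y.copy (\<Theta> ` (\<iota> -` C))"
    then obtain x where "\<rho>' s = \<Theta> x" "\<iota> x \<in> C" "s = \<iota>' (\<rho>' s)" by (auto simp: Y.copy_def)
    then show "s \<in> (\<lambda>r. \<iota>' (\<Theta> (\<rho> r))) ` C" by (intro image_eqI[of _ _ "\<iota> x"]) auto
  qed
  show ?thesis
  proof (rule measure_equivalentI_real[OF X.pmp_copy Y.pmp_copy])
    show "X.copy A \<in> sets X.M'" "Y.copy B \<in> sets Y.M'" using X.copy_sets[OF A(1)] Y.copy_sets[OF B] by simp_all
    show "emeasure X.M' (X.copy A) > 0"
      using X.copy_sets[OF A(1)] A(2) by (simp add: X.emeasure_M' X.\<iota>_copy)
    show "(\<lambda>r. \<iota>' (\<Theta> (\<rho> r))) \<in> measurable X.M' Y.M'"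
      using measurable_compose[OF measurable_compose[OF X.\<rho>_meas \<Theta>] Y.\<iota>_meas] .
    show "(\<lambda>r. \<iota> (\<Theta>' (\<rho>' r))) \<in> measurable Y.M' X.M'"
      using measurable_compose[OF measurable_compose[OF Y.\<rho>_meas \<Theta>'] X.\<iota>_meas] .
    show "(\<lambda>r. \<iota>' (\<Theta> (\<rho> r))) ` X.copy A = Y.copy B"
      using im[of "X.copy A"] img by (simp add: X.\<iota>_copy)
    show "\<iota> (\<Theta>' (\<rho>' (\<iota>' (\<Theta> (\<rho> x))))) = x" if "x \<in> X.copy A" for x
      using X.copyD[OF that] inv by simp
    show "c > 0" by fact
    show "measure Y.M' ((\<lambda>r. \<iota>' (\<Theta> (\<rho> r))) ` C) = c * measure X.M' C"
      if C: "C \<in> sets X.M'" "C \<subseteq> X.copy A" for C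
    proof -
      have C': "\<iota> -` C \<in> sets M" "\<iota> -` C \<subseteq> A"
        using measurable_sets[OF X.\<iota>_meas C(1)] C(2) X.\<iota>_copy by auto
      have "\<Theta> ` (\<iota> -` C) = B \<inter> \<Theta>' -` (\<iota> -` C)" using C'(2) inv img by force
      then have "\<Theta> ` (\<iota> -` C) \<in> sets N" using measurable_sets[OF \<Theta>' C'(1)] B by auto
      then have "measure Y.M' (Y.copy (\<Theta> ` (\<iota> -` C))) = measure N (\<Theta> ` (\<iota> -` C))"
        using Y.copy_sets by (simp add: measure_def Y.emeasure_M' Y.\<iota>_copy)
      then show ?thesis using im[OF C(2)] scale[OF C'] C(1) by (simp add: measure_def X.emeasure_M')
    qed
    show "(x, y) \<in> X'.orb \<longleftrightarrow> (\<iota>' (\<Theta> (\<rho> x)), \<iota>' (\<Theta> (\<rho> y))) \<in> Y'.orb"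
      if "x \<in> X.copy A" "y \<in> X.copy A" for x y
      using X.copyD[OF that(1)] X.copyD[OF that(2)] orb[of "\<rho> x" "\<rho> y"] orbX[of "\<rho> x" "\<rho> y"] orbY by simp
  qed
qed


section \<open>Stable orbit equivalence\<close>

text \<open>The maps are total and the exceptional null sets are already removed, so orbit
  equivalence and freeness hold at every point of the sections.\<close>

locale soe = X: pmp_action \<Gamma> M \<phi> + Y: pmp_action \<Lambda> N \<beta>
  for \<Gamma> :: "'g monoid" and M :: "'x::polish_space measure" and \<phi>
    and \<Lambda> :: "'h monoid" and N :: "'y::polish_space measure" and \<beta> +
  fixes A :: "'x set" and B :: "'y set" and \<Theta> :: "'x \<Rightarrow> 'y" and \<Theta>' :: "'y \<Rightarrow> 'x" and c :: real
  assumes A_sets: "A \<in> sets M" and B_sets: "B \<in> sets N"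
    and A_sat: "UNIV - X.sat A \<in> null_sets M" and B_sat: "UNIV - Y.sat B \<in> null_sets N"
    and A_free: "A \<subseteq> X.free_part" and B_free: "B \<subseteq> Y.free_part"
    and \<Theta>_meas: "\<Theta> \<in> measurable M N" and \<Theta>'_meas: "\<Theta>' \<in> measurable N M"
    and \<Theta>_in: "x \<in> A \<Longrightarrow> \<Theta> x \<in> B" and \<Theta>'_in: "y \<in> B \<Longrightarrow> \<Theta>' y \<in> A"
    and \<Theta>'_\<Theta>: "x \<in> A \<Longrightarrow> \<Theta>' (\<Theta> x) = x" and \<Theta>_\<Theta>': "y \<in> B \<Longrightarrow> \<Theta> (\<Theta>' y) = y"
    and c_pos: "c > 0"
    and scale: "C \<in> sets M \<Longrightarrow> C \<subseteq> A \<Longrightarrow> measure N (\<Theta> ` C) = c * measure M C"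
    and \<Theta>_orb: "x \<in> A \<Longrightarrow> x' \<in> A \<Longrightarrow> (x, x') \<in> X.orb \<longleftrightarrow> (\<Theta> x, \<Theta> x') \<in> Y.orb"
begin

lemma soe_sym: "soe \<Lambda> N \<beta> \<Gamma> M \<phi> B A \<Theta>' \<Theta> (1 / c)"
proof unfold_locales
  show "measure M (\<Theta>' ` C) = 1 / c * measure N C" if C: "C \<in> sets N" "C \<subseteq> B" for C
  proof -
    have e: "\<Theta>' ` C = A \<inter> \<Theta> -` C" using C(2) \<Theta>'_in \<Theta>_\<Theta>' \<Theta>'_\<Theta> by force
    have "\<Theta>' ` C \<in> sets M" unfolding e using measurable_sets[OF \<Theta>_meas C(1)] A_sets by auto
    moreover have "\<Theta> ` \<Theta>' ` C = C" using C(2) \<Theta>_\<Theta>' by (force simp: image_image)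
    ultimately have "measure N C = c * measure M (\<Theta>' ` C)" using scale[of "\<Theta>' ` C"] e by simp
    then show ?thesis using c_pos by simp
  qed
  show "(y, y') \<in> Y.orb \<longleftrightarrow> (\<Theta>' y, \<Theta>' y') \<in> X.orb" if "y \<in> B" "y' \<in> B" for y y'
    using \<Theta>_orb[of "\<Theta>' y" "\<Theta>' y'"] \<Theta>'_in \<Theta>_\<Theta>' that by simp
qed (use A_sets B_sets A_sat B_sat A_free B_free \<Theta>_meas \<Theta>'_meas \<Theta>_in \<Theta>'_in \<Theta>'_\<Theta> \<Theta>_\<Theta>' c_pos in auto)

lemma A_pos: "emeasure M A > 0"
proof (rule ccontr)
  assume "\<not> emeasure M A > 0"
  then have "A \<in> null_sets M" using A_sets by (simp add: null_sets_def zero_less_iff_neq_zero)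
  from null_sets.Un[OF X.sat_null[OF this] A_sat] have "space M \<in> null_sets M" by simp
  then show False using X.emeasure_space_1 by (simp add: null_sets_def)
qed

end

lemma (in pmp_action) complete_section_orb:
  assumes "complete_section M orb A"
  shows "A \<in> sets M" "UNIV - sat A \<in> null_sets M" "measure M A > 0"
proof -
  show A: "A \<in> sets M" using assms by (simp add: complete_section_def)
  have "AE x in M. orb `` {x} \<inter> A \<noteq> {}"
    using assms orb_refl by (auto simp: complete_section_def)
  then have "AE x in M. x \<in> sat A" by (rule eventually_mono) (auto simp: sat_def orb_iff)
  then show null: "UNIV - sat A \<in> null_sets M"
    using AE_iff_null_sets[of "UNIV - sat A" M] sat_sets[OF A] sets.Diff[OF sets.top[of M] sat_sets[OF A]]
    by simp
  show "measure M A > 0"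
  proof (rule ccontr)
    assume "\<not> measure M A > 0"
    then have "measure M A = 0" using measure_nonneg[of M A] by linarith
    then have "A \<in> null_sets M" using A by (simp add: null_sets_def emeasure_eq_measure)
    from null_sets.Un[OF sat_null[OF this] null] have "space M \<in> null_sets M" by simp
    then show False using emeasure_space_1 by (simp add: null_sets_def)
  qed
qed

lemma (in pmp_action) sat_shrink:
  assumes "A \<in> sets M" "A1 \<in> sets M" "UNIV - sat A \<in> null_sets M" "A - A1 \<in> null_sets M"
  shows "UNIV - sat A1 \<in> null_sets M"
proof (rule null_sets_subset[OF null_sets.Un[OF assms(3) sat_null[OF assms(4)]]])
  show "UNIV - sat A1 \<in> sets M" using sat_sets[OF assms(2)] sets.top[of M] by (auto simp del: sets_M)
  show "UNIV - sat A1 \<subseteq> (UNIV - sat A) \<union> sat (A - A1)" by (auto simp: sat_def)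
qed

lemma ex_soe:
  assumes "pmp_action \<Gamma> M \<phi>" "pmp_action \<Lambda> N \<beta>"
    and "stably_orbit_equivalent M (orbit_relation \<Gamma> M \<phi>) N (orbit_relation \<Lambda> N \<beta>)"
  shows "\<exists>A B \<Theta> \<Theta>' c. soe \<Gamma> M \<phi> \<Lambda> N \<beta> A B \<Theta> \<Theta>' c"
proof -
  interpret X: pmp_action \<Gamma> M \<phi> by fact
  interpret Y: pmp_action \<Lambda> N \<beta> by fact
  obtain A B \<theta> where cs: "complete_section M X.orb A" "complete_section N Y.orb B"
    and bij: "bij_betw \<theta> A B"
    and m: "\<theta> \<in> measurable (restrict_space M A) (restrict_space N B)"
    and m': "the_inv_into A \<theta> \<in> measurable (restrict_space N B) (restrict_space M A)"
    and sc: "\<forall>C\<in>sets M. C \<subseteq> A \<longrightarrow> measure N (\<theta> ` C) / measure N B = measure M C / measure M A"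
    and ex: "\<exists>A0\<in>sets M. A0 \<subseteq> A \<and> A - A0 \<in> null_sets M \<and>
        (\<forall>x\<in>A0. \<forall>y\<in>A0. (x, y) \<in> X.orb \<longleftrightarrow> (\<theta> x, \<theta> y) \<in> Y.orb)"
    using assms(3) unfolding stably_orbit_equivalent_def by (elim exE conjE)
  from ex obtain A0 where A0: "A0 \<in> sets M" "A0 \<subseteq> A" "A - A0 \<in> null_sets M"
    and orb: "\<forall>x\<in>A0. \<forall>y\<in>A0. (x, y) \<in> X.orb \<longleftrightarrow> (\<theta> x, \<theta> y) \<in> Y.orb"
    by (elim bexE conjE)
  note A = X.complete_section_orb[OF cs(1)] and B = Y.complete_section_orb[OF cs(2)]
  define \<Theta> where "\<Theta> x = (if x \<in> A then \<theta> x else undefined)" for x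
  define \<Theta>' where "\<Theta>' y = (if y \<in> B then the_inv_into A \<theta> y else undefined)" for y
  have \<Theta>m: "\<Theta> \<in> measurable M N"
  proof -
    have "\<theta> \<in> measurable (restrict_space M A) N" using m B(1) by (simp add: measurable_restrict_space2_iff)
    then show ?thesis unfolding \<Theta>_def using A(1) by (subst measurable_restrict_space_iff[symmetric]) auto
  qed
  have \<Theta>'m: "\<Theta>' \<in> measurable N M"
  proof -
    have "the_inv_into A \<theta> \<in> measurable (restrict_space N B) M"
      using m' A(1) by (simp add: measurable_restrict_space2_iff)
    then show ?thesis unfolding \<Theta>'_def using B(1) by (subst measurable_restrict_space_iff[symmetric]) auto
  qed
  have AB: "\<Theta> x \<in> B" "\<Theta>' (\<Theta> x) = x" if "x \<in> A" for x
    using that bij by (auto simp: \<Theta>_def \<Theta>'_def bij_betw_def the_inv_into_f_f)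
  have BA: "\<Theta>' y \<in> A" "\<Theta> (\<Theta>' y) = y" if "y \<in> B" for y
    using that bij by (auto simp: \<Theta>_def \<Theta>'_def bij_betw_def f_the_inv_into_f the_inv_into_into)
  have im: "\<Theta> ` C = B \<inter> \<Theta>' -` C" if "C \<subseteq> A" for C
  proof (intro equalityI subsetI)
    fix y assume "y \<in> \<Theta> ` C"
    then show "y \<in> B \<inter> \<Theta>' -` C" using that AB by auto
  next
    fix y assume "y \<in> B \<inter> \<Theta>' -` C"
    then show "y \<in> \<Theta> ` C" using BA(2)[of y] by (intro image_eqI[of _ _ "\<Theta>' y"]) auto
  qed
  have im_sets: "\<Theta> ` C \<in> sets N" if "C \<in> sets M" "C \<subseteq> A" for C
    unfolding im[OF that(2)] using measurable_sets[OF \<Theta>'m that(1)] B(1) by auto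
  define c where "c = measure N B / measure M A"
  have c: "c > 0" using A(3) B(3) by (simp add: c_def)
  have scale: "measure N (\<Theta> ` C) = c * measure M C" if "C \<in> sets M" "C \<subseteq> A" for C
  proof -
    have "\<Theta> ` C = \<theta> ` C" using that(2) by (auto simp: \<Theta>_def intro!: image_cong)
    then show ?thesis using bspec[OF sc that(1)] that(2) A(3) B(3) by (simp add: c_def field_simps)
  qed
  have null: "C \<in> null_sets M \<longleftrightarrow> \<Theta> ` C \<in> null_sets N" if "C \<in> sets M" "C \<subseteq> A" for C
    using scale[OF that] that im_sets[OF that] c
    by (auto simp: null_sets_def X.emeasure_eq_measure Y.emeasure_eq_measure)
  \<comment> \<open>The points with a non-free image; they form a null set because
    \<open>\<Theta>\<close> scales the measure on \<open>A\<close>.\<close>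
  define Z where "Z = {x \<in> A. \<Theta> x \<notin> Y.free_part}"
  have Yc: "UNIV - Y.free_part \<in> sets N"
    using Y.free_part_sets sets.top[of N] by (auto simp del: Y.sets_M)
  have "Z = A \<inter> \<Theta> -` (UNIV - Y.free_part)" by (auto simp: Z_def)
  then have Z: "Z \<in> sets M" "Z \<subseteq> A" using measurable_sets[OF \<Theta>m Yc] A(1) by auto
  have "\<Theta> ` Z \<in> null_sets N"
    by (rule null_sets_subset[OF Y.free_part_conull im_sets[OF Z]]) (auto simp: Z_def)
  then have Z0: "Z \<in> null_sets M" using null[OF Z] by simp
  define A1 where "A1 = A0 \<inter> X.free_part - Z"
  have A1: "A1 \<in> sets M" "A1 \<subseteq> A" using A0 X.free_part_sets Z by (auto simp: A1_def)
  have AA1: "A - A1 \<in> null_sets M"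
  proof (rule null_sets_subset[OF null_sets.Un[OF null_sets.Un[OF A0(3) X.free_part_conull] Z0]])
    show "A - A1 \<in> sets M" using A(1) A1(1) by auto
  qed (auto simp: A1_def)
  define B1 where "B1 = \<Theta> ` A1"
  have B1: "B1 \<in> sets N" "B1 \<subseteq> B" using im_sets[OF A1] A1(2) AB by (auto simp: B1_def)
  have "B - B1 = \<Theta> ` (A - A1)"
    unfolding B1_def im[OF A1(2)] using im[of "A - A1"] BA(1) by auto
  then have BB1: "B - B1 \<in> null_sets N" using null[of "A - A1"] AA1 A(1) A1(1) by auto
  have "soe \<Gamma> M \<phi> \<Lambda> N \<beta> A1 B1 \<Theta> \<Theta>' c"
  proof unfold_locales
    show "UNIV - X.sat A1 \<in> null_sets M" by (rule X.sat_shrink[OF A(1) A1(1) A(2) AA1])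
    show "UNIV - Y.sat B1 \<in> null_sets N" by (rule Y.sat_shrink[OF B(1) B1(1) B(2) BB1])
    show "B1 \<subseteq> Y.free_part" using A1(2) by (auto simp: B1_def A1_def Z_def)
    show "(x, y) \<in> X.orb \<longleftrightarrow> (\<Theta> x, \<Theta> y) \<in> Y.orb" if "x \<in> A1" "y \<in> A1" for x y
    proof -
      have "x \<in> A0" "y \<in> A0" "x \<in> A" "y \<in> A" using that A1(2) by (auto simp: A1_def)
      then show ?thesis using orb by (simp add: \<Theta>_def)
    qed
    show "measure N (\<Theta> ` C) = c * measure M C" if "C \<in> sets M" "C \<subseteq> A1" for C
      using scale[OF that(1)] that(2) A1(2) by blast
    show "A1 \<in> sets M" "B1 \<in> sets N" "\<Theta> \<in> measurable M N" "\<Theta>' \<in> measurable N M" "c > 0"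
      by (fact A1 B1 \<Theta>m \<Theta>'m c)+
    show "A1 \<subseteq> X.free_part" by (auto simp: A1_def)
    show "\<Theta> x \<in> B1" if "x \<in> A1" for x using that by (simp add: B1_def)
    show "\<Theta>' (\<Theta> x) = x" if "x \<in> A1" for x using that A1(2) AB(2) by blast
    show "\<Theta>' y \<in> A1" if "y \<in> B1" for y using that A1(2) AB(2) by (auto simp: B1_def)
    show "\<Theta> (\<Theta>' y) = y" if "y \<in> B1" for y using that B1(2) BA(2) by blast
  qed
  then show ?thesis by blast
qed

section \<open>From the section to its saturation\<close>

locale soe_free_product = soe \<Gamma> M \<phi> "free_product I F" N \<beta> A B \<Theta> \<Theta>' c + group_family I F
  for \<Gamma> :: "'h monoid" and M :: "'x::polish_space measure" and \<phi>
    and I :: "'i set" and F :: "'i \<Rightarrow> 'g monoid" and N :: "'y::polish_space measure" and \<beta> A B \<Theta> \<Theta>' c +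
  assumes countable_I: "countable I" and countable_F: "i \<in> I \<Longrightarrow> countable (carrier (F i))"
begin

definition en :: "nat \<Rightarrow> 'h" where "en = from_nat_into (carrier \<Gamma>)"

lemma en_closed: "en n \<in> carrier \<Gamma>"
  unfolding en_def using X.one_closed by (intro from_nat_into) blast

definition entry :: "'x \<Rightarrow> nat" where "entry x = (LEAST n. \<phi> (en n) x \<in> A)"

text \<open>Extends \<open>\<Theta>\<close> to the saturation of \<open>A\<close>. The value
  \<open>p x\<close> determines the point of \<open>A\<close> that is reached, and
  \<open>entry x\<close> the element reaching it, so \<open>entry\<close> is the label that tells
  apart points with equal image.\<close>

definition p :: "'x \<Rightarrow> 'y" where "p x = \<Theta> (\<phi> (en (entry x)) x)"

lemma entry: "x \<in> X.sat A \<Longrightarrow> \<phi> (en (entry x)) x \<in> A"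
proof -
  assume "x \<in> X.sat A"
  then obtain g where g: "g \<in> carrier \<Gamma>" "\<phi> g x \<in> A" by (auto simp: X.sat_def)
  obtain n where "from_nat_into (carrier \<Gamma>) n = g"
    using from_nat_into_surj[OF X.countable_group g(1)] by blast
  then have "\<phi> (en n) x \<in> A" using g(2) by (simp add: en_def)
  then show ?thesis unfolding entry_def by (rule LeastI)
qed

lemma entry_meas: "entry \<in> measurable M (count_space UNIV)"
proof -
  have "(\<lambda>x. \<phi> (en n) x \<in> A) \<in> measurable M (count_space UNIV)" for n
    using X.act_vimage[OF en_closed A_sets, of n] by (simp add: pred_def vimage_def)
  then show ?thesis unfolding entry_def by (rule measurable_Least)
qed

lemma p_meas: "p \<in> measurable M N"
proof -
  have "(\<lambda>x. \<Theta> (\<phi> (en n) x)) \<in> measurable M N" for n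
    using measurable_compose[OF X.act_measurable[OF en_closed] \<Theta>_meas] .
  then show ?thesis unfolding p_def by (rule measurable_compose_countable[OF _ entry_meas])
qed

text \<open>The Kurosh theorem for a group embedded in the acting group, cut down to a set where
  \<open>entry\<close> is constant; there \<open>p\<close> is \<open>\<Theta>\<close> after a single
  element \<open>d\<close>.\<close>

theorem factor_conjugation:
  assumes G: "group G" "MFI G" "infinite (carrier G)"
    and inc: "inc \<in> hom G \<Gamma>" "inj_on inc (carrier G)"
    and V: "V \<in> sets M" "emeasure M V > 0"
  obtains V' d j l where "V' \<in> sets M" "V' \<subseteq> V" "emeasure M V' > 0" "d \<in> carrier \<Gamma>" "j \<in> I" "l \<in> RW"
    "\<And>x. x \<in> V' \<Longrightarrow> \<phi> d x \<in> A"
    "\<And>x g. x \<in> V' \<Longrightarrow> g \<in> carrier G \<Longrightarrow> \<phi> (inc g) x \<in> V' \<Longrightarrow>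
      \<exists>h\<in>carrier (F j). \<beta> l (\<Theta> (\<phi> d x)) = \<beta> (incl j h) (\<beta> l (\<Theta> (\<phi> d (\<phi> (inc g) x))))"
proof -
  interpret S: pmp_action G M "\<lambda>g. \<phi> (inc g)" by (rule X.pmp_action_hom[OF G(1) inc])
  have incG: "inc g \<in> carrier \<Gamma>" if "g \<in> carrier G" for g using inc(1) that by (auto simp: hom_def)
  interpret K: kurosh G M "\<lambda>g. \<phi> (inc g)" I F N \<beta> p entry "X.sat A"
  proof unfold_locales
    show "countable I" by (rule countable_I)
    show "countable (carrier (F i))" if "i \<in> I" for i using countable_F[OF that] .
    show "X.sat A \<in> sets M" by (rule X.sat_sets[OF A_sets])
    show "UNIV - X.sat A \<in> null_sets M" by (rule A_sat)
    show "p \<in> measurable M N" by (rule p_meas)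
    show "entry \<in> measurable M (count_space UNIV)" by (rule entry_meas)
    fix x assume x: "x \<in> X.sat A"
    show "p x \<in> Y.free_part" using \<Theta>_in[OF entry[OF x]] B_free by (auto simp: p_def)
    fix g assume g: "g \<in> carrier G"
    show gx: "\<phi> (inc g) x \<in> X.sat A" using X.sat_invariant[OF incG[OF g]] x by simp
    let ?x = "\<phi> (en (entry x)) x" and ?y = "\<phi> (en (entry (\<phi> (inc g) x))) (\<phi> (inc g) x)"
    have "(?x, x) \<in> X.orb" "(x, \<phi> (inc g) x) \<in> X.orb" "(\<phi> (inc g) x, ?y) \<in> X.orb"
      by (rule X.orb_sym[OF X.orb_act[OF en_closed]] X.orb_act[OF en_closed] X.orb_act[OF incG[OF g]])+
    then have "(?x, ?y) \<in> X.orb" using X.orb_trans by blast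
    then show "(p x, p (\<phi> (inc g) x)) \<in> Y.orb"
      using \<Theta>_orb[OF entry[OF x] entry[OF gx]] by (simp add: p_def)
    show "\<phi> (inc g) x = x" if "p (\<phi> (inc g) x) = p x" "entry (\<phi> (inc g) x) = entry x"
    proof -
      have "?y = ?x" using that(1) \<Theta>'_\<Theta>[OF entry[OF x]] \<Theta>'_\<Theta>[OF entry[OF gx]] by (simp add: p_def)
      then show ?thesis using that(2) X.act_inj[OF en_closed] by simp
    qed
  qed
  show thesis
  proof (rule K.kurosh_MFI[OF G(2,3) V])
    fix V1 j l assume V1: "V1 \<in> sets M" "V1 \<subseteq> V" "emeasure M V1 > 0" "j \<in> I" "l \<in> RW"
      and V1': "\<And>x g. x \<in> V1 \<Longrightarrow> g \<in> carrier G \<Longrightarrow> \<phi> (inc g) x \<in> V1 \<Longrightarrow>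
        \<exists>h\<in>carrier (F j). \<beta> l (p x) = \<beta> (incl j h) (\<beta> l (p (\<phi> (inc g) x)))"
    note V2 = X.pos_diff_null[OF V1(1,3) A_sat X.sat_sets[OF A_sets]]
    define E where "E n = {x. entry x = n}" for n
    have Es: "E n \<in> sets M" for n
      using measurable_sets[OF entry_meas, of "{n}"] by (simp add: E_def vimage_def)
    have cover: "V1 \<inter> X.sat A \<subseteq> (\<Union>n\<in>UNIV. E n)" by (auto simp: E_def)
    obtain n where n: "V1 \<inter> X.sat A \<inter> E n \<in> sets M" "emeasure M (V1 \<inter> X.sat A \<inter> E n) > 0"
      using X.pos_piece[OF V2 countableI_type cover Es] by blast
    show thesis
    proof (rule that[OF n(1) _ n(2) en_closed[of n] V1(4,5)])
      show "V1 \<inter> X.sat A \<inter> E n \<subseteq> V" using V1 by blast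
      show "\<phi> (en n) x \<in> A" if "x \<in> V1 \<inter> X.sat A \<inter> E n" for x
        using entry[of x] that by (auto simp: E_def)
      show "\<exists>h\<in>carrier (F j). \<beta> l (\<Theta> (\<phi> (en n) x)) = \<beta> (incl j h) (\<beta> l (\<Theta> (\<phi> (en n) (\<phi> (inc g) x))))"
        if "x \<in> V1 \<inter> X.sat A \<inter> E n" "g \<in> carrier G" "\<phi> (inc g) x \<in> V1 \<inter> X.sat A \<inter> E n" for x g
        using V1'[of x g] that by (simp add: p_def E_def)
    qed
  qed
qed

end


section \<open>Malnormality of the factors\<close>

lemma free_product_incl_inj: "inj_on (free_product_incl F i) S"
proof (rule inj_onI)
  fix g h assume "free_product_incl F i g = free_product_incl F i h"
  then show "g = h"
    by (cases "g = \<one>\<^bsub>F i\<^esub>"; cases "h = \<one>\<^bsub>F i\<^esub>") (simp_all add: free_product_incl_def)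
qed

context group_family
begin

lemma incl_hom: "i \<in> I \<Longrightarrow> incl i \<in> hom (G i) W"
  using free_product_incl_hom[where I = I and G = G, OF group_factor] .

lemma countable_reduced:
  assumes "countable I" "\<And>i. i \<in> I \<Longrightarrow> countable (carrier (G i))"
  shows "countable RW"
proof -
  have "RW \<subseteq> lists (SIGMA i:I. carrier (G i))" by (auto simp: reduced_words_def)
  then show ?thesis by (rule countable_subset[OF _ countable_lists[OF countable_SIGMA[OF assms]]])
qed

end

context pmp_action
begin

section \<open>Ergodicity excludes finite groups\<close>

lemma ex_small_set: "\<exists>A\<in>sets M. measure M A > 0 \<and> measure M A \<le> (1 / 2) ^ n"
proof (induction n)
  case 0
  show ?case using prob_space by (intro bexI[of _ "space M"]) auto
next
  case (Suc n)
  then obtain A where A: "A \<in> sets M" "measure M A > 0" "measure M A \<le> (1 / 2) ^ n" by blast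
  then have "0 < emeasure M A" by (simp add: emeasure_eq_measure)
  then obtain B where B: "B \<in> sets M" "B \<subseteq> A" "0 < emeasure M B" "emeasure M B < emeasure M A"
    using nonatomic_M A(1) unfolding nonatomic_def by blast
  then have m: "0 < measure M B" "measure M B < measure M A"
    by (simp_all add: emeasure_eq_measure ennreal_less_iff)
  have d: "measure M (A - B) = measure M A - measure M B" using A(1) B(1,2) by (rule finite_measure_Diff)
  show ?case
  proof (cases "measure M B \<le> measure M A / 2")
    case True
    have "measure M B \<le> (1 / 2) ^ Suc n" using True A(3) by simp
    then show ?thesis using B(1) m(1) by blast
  next
    case False
    have "measure M (A - B) \<le> (1 / 2) ^ Suc n" "measure M (A - B) > 0" using False A(3) m d by simp_all
    moreover have "A - B \<in> sets M" using A(1) B(1) by (rule sets.Diff)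
    ultimately show ?thesis by blast
  qed
qed

lemma ergodic_sat:
  assumes "ergodic_action \<Gamma> M \<phi>" "A \<in> sets M"
  shows "sat A \<in> null_sets M \<or> space M - sat A \<in> null_sets M"
proof -
  have "\<forall>g\<in>carrier \<Gamma>. \<phi> g -` sat A \<inter> space M = sat A"
  proof
    fix g assume "g \<in> carrier \<Gamma>"
    then show "\<phi> g -` sat A \<inter> space M = sat A" by (simp add: vimage_def sat_invariant)
  qed
  then show ?thesis using bspec[OF assms(1)[unfolded ergodic_action_def] sat_sets[OF assms(2)]] by simp
qed

text \<open>Under a finite group a small enough set of positive measure has a saturation of measure
  strictly between 0 and 1. So ergodicity supplies the infinite group that the Kurosh theorem asks
  for.\<close>

lemma ergodic_infinite:
  assumes "ergodic_action \<Gamma> M \<phi>"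
  shows "infinite (carrier \<Gamma>)"
proof
  assume fin: "finite (carrier \<Gamma>)"
  define k where "k = card (carrier \<Gamma>)"
  obtain n where n: "real k * (1 / 2) ^ n < 1"
  proof -
    have "1 / (real k + 1) > 0" by simp
    then have "\<exists>n. (1 / 2 :: real) ^ n < 1 / (real k + 1)" by (rule real_arch_pow_inv) simp
    then obtain n where "(1 / 2 :: real) ^ n < 1 / (real k + 1)" by blast
    then have "(1 / 2) ^ n * (real k + 1) < 1" by (subst (asm) pos_less_divide_eq) auto
    then have "(real k + 1) * (1 / 2) ^ n < 1" by (simp only: mult.commute)
    moreover have "real k * (1 / 2) ^ n \<le> (real k + 1) * (1 / 2) ^ n" by (intro mult_right_mono) auto
    ultimately have "real k * (1 / 2) ^ n < 1" by linarith
    then show thesis by (rule that)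
  qed
  obtain A where A: "A \<in> sets M" "measure M A > 0" "measure M A \<le> (1 / 2) ^ n" using ex_small_set by blast
  have sat: "sat A = (\<Union>g\<in>carrier \<Gamma>. \<phi> g -` A)" by (auto simp: sat_def)
  have "measure M (sat A) \<le> (\<Sum>g\<in>carrier \<Gamma>. measure M (\<phi> g -` A))"
    unfolding sat
    by (rule finite_measure_subadditive_finite[OF fin image_subsetI[OF act_vimage[OF _ A(1)]]])
  also have "\<dots> = real k * measure M A"
  proof -
    have "measure M (\<phi> g -` A) = measure M A" if "g \<in> carrier \<Gamma>" for g
      using emeasure_act_vimage[OF that A(1)] by (simp add: measure_def)
    then show ?thesis by (simp add: k_def)
  qed
  also have "\<dots> \<le> real k * (1 / 2) ^ n" using A(3) by (intro mult_left_mono) auto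
  finally have less: "measure M (sat A) < 1" using n by simp
  have alt: "sat A \<in> null_sets M \<or> space M - sat A \<in> null_sets M" by (rule ergodic_sat[OF assms A(1)])
  have "measure M A \<le> measure M (sat A)" by (rule finite_measure_mono[OF subset_sat sat_sets[OF A(1)]])
  then have "sat A \<notin> null_sets M" using A(2) measure_eq_0_null_sets[of "sat A" M] by linarith
  then have "space M - sat A \<in> null_sets M" using alt by simp
  then have "measure M (space M - sat A) = 0" by (rule measure_eq_0_null_sets)
  then show False using prob_compl[OF sat_sets[OF A(1)]] less by simp
qed

end

locale free_product_soe = S: soe_free_product "free_product I E" M \<alpha> J F N \<beta> A B \<Theta> \<Theta>' c + E: group_family I E
  for I :: "'i set" and E :: "'i \<Rightarrow> 'g monoid" and M :: "'x::polish_space measure" and \<alpha>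
    and J :: "'j set" and F :: "'j \<Rightarrow> 'h monoid" and N :: "'y::polish_space measure" and \<beta> A B \<Theta> \<Theta>' c +
  assumes countable_I': "countable I" and countable_E: "i \<in> I \<Longrightarrow> countable (carrier (E i))"
begin

lemma mirror: "soe_free_product (free_product J F) N \<beta> I E M \<alpha> B A \<Theta>' \<Theta> (1 / c)"
  unfolding soe_free_product_def soe_free_product_axioms_def
  using S.soe_sym E.group_family_axioms countable_I' countable_E by blast

sublocale S': soe_free_product "free_product J F" N \<beta> I E M \<alpha> B A \<Theta>' \<Theta> "1 / c"
  by (rule mirror)

text \<open>
  \<open>\<psi>\<close> carries the \<open>k\<close>-th factor on \<open>V\<close> into \<open>M\<close>; if its composition with \<open>\<Theta>\<close> carries it
  into the \<open>j\<close>-th factor, then malnormality of the factors forces \<open>j = k\<close>, and the composition stays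
  inside the classes of the factor.
\<close>

lemma return_to_factor:
  assumes k: "k \<in> J" "infinite (carrier (F k))" and j: "j \<in> J" and l: "l \<in> S.RW"
    and V: "V \<in> sets N" "emeasure N V > 0" and f: "f \<in> measurable N M"
    and orbit: "\<And>y. y \<in> V \<Longrightarrow> f y \<in> A \<and> (\<exists>b\<in>B. (b, y) \<in> S.Y.orb \<and> (f y, \<Theta>' b) \<in> S.X.orb)"
    and factor: "\<And>y g. y \<in> V \<Longrightarrow> g \<in> carrier (F k) \<Longrightarrow> \<beta> (S.incl k g) y \<in> V \<Longrightarrow>
      \<exists>h\<in>carrier (F j). \<beta> l (\<Theta> (f y)) = \<beta> (S.incl j h) (\<beta> l (\<Theta> (f (\<beta> (S.incl k g) y))))"
  obtains V' w a where "V' \<in> sets N" "V' \<subseteq> V" "emeasure N V' > 0" "w \<in> S.RW"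
    "\<And>y. y \<in> V' \<Longrightarrow> \<Theta> (f y) = \<beta> w y" "j = k" "a \<in> carrier (F k)" "l \<otimes>\<^bsub>S.W\<^esub> w = S.incl k a"
proof -
  have "\<exists>w\<in>S.RW. \<Theta> (f y) = \<beta> w y" if yV: "y \<in> V" for y
  proof -
    obtain b where b: "f y \<in> A" "b \<in> B" "(b, y) \<in> S.Y.orb" "(f y, \<Theta>' b) \<in> S.X.orb" using orbit[OF yV] by blast
    then have "(\<Theta> (f y), b) \<in> S.Y.orb" using S.\<Theta>_orb[of "f y" "\<Theta>' b"] S.\<Theta>'_in S.\<Theta>_\<Theta>' by simp
    then have "(y, \<Theta> (f y)) \<in> S.Y.orb" using S.Y.orb_sym[OF S.Y.orb_trans[OF _ b(3)]] by simp
    then show ?thesis by (simp add: S.Y.orb_iff)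
  qed
  then have cover: "V \<subseteq> (\<Union>w\<in>S.RW. {y. \<Theta> (f y) = \<beta> w y})" by blast
  have "{y. \<Theta> (f y) = \<beta> w y} \<in> sets N" if "w \<in> S.RW" for w
    using S.Y.act_eq_sets[OF measurable_compose[OF f S.\<Theta>_meas] S.Y.act_measurable[of w]] that by simp
  then obtain w where w: "w \<in> S.RW" and V': "V \<inter> {y. \<Theta> (f y) = \<beta> w y} \<in> sets N"
    "emeasure N (V \<inter> {y. \<Theta> (f y) = \<beta> w y}) > 0"
    using S.Y.pos_piece[OF V S.countable_reduced[OF S.countable_I S.countable_F] cover] by blast
  interpret Fk: group "F k" by (rule S.group_factor[OF k(1)])
  interpret K: pmp_action "F k" N "\<lambda>g. \<beta> (S.incl k g)"
    by (rule S.Y.pmp_action_hom[OF Fk.is_group S.incl_hom[OF k(1)] free_product_incl_inj])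
  have UN: "UNIV - S.Y.free_part \<in> null_sets N" by (rule S.Y.free_part_conull)
  \<comment> \<open>Two returns of one point yield a non-trivial \<open>g\<close> in the factor
    \<open>k\<close> such that \<open>y\<close> and its \<open>g\<close>-translate both lie in the
    set where the word \<open>w\<close> describes the map.\<close>
  obtain x P where x: "x \<in> S.Y.free_part" "P \<subseteq> carrier (F k)" "card P = 2"
    "\<And>g. g \<in> P \<Longrightarrow> \<beta> (S.incl k g) x \<in> V \<inter> {y. \<Theta> (f y) = \<beta> w y}"
    using K.many_returns[OF k(2) V' S.Y.free_part_sets UN, of 2] by metis
  obtain g1 g2 where g: "g1 \<in> P" "g2 \<in> P" "g1 \<noteq> g2" using x(3) by (auto simp: card_2_iff)
  have gc: "g1 \<in> carrier (F k)" "g2 \<in> carrier (F k)" using g x(2) by auto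
  define y g where "y = \<beta> (S.incl k g1) x" and "g = g2 \<otimes>\<^bsub>F k\<^esub> inv\<^bsub>F k\<^esub> g1"
  have gF: "g \<in> carrier (F k)" using gc by (simp add: g_def)
  have g1': "g \<noteq> \<one>\<^bsub>F k\<^esub>" using \<open>g1 \<noteq> g2\<close> gc Fk.inv_solve_right'[of "\<one>\<^bsub>F k\<^esub>" g2 g1] by (auto simp: g_def)
  have gy: "\<beta> (S.incl k g) y = \<beta> (S.incl k g2) x"
    using K.act_mult[of g2 "inv\<^bsub>F k\<^esub> g1" y] gc by (simp add: g_def y_def)
  have yV: "y \<in> V" "\<Theta> (f y) = \<beta> w y" "\<beta> (S.incl k g) y \<in> V" "\<Theta> (f (\<beta> (S.incl k g) y)) = \<beta> w (\<beta> (S.incl k g) y)"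
    using x(4)[OF \<open>g1 \<in> P\<close>] x(4)[OF \<open>g2 \<in> P\<close>] unfolding gy by (auto simp: y_def)
  have in1: "S.incl k g1 \<in> S.RW" "S.incl k g \<in> S.RW" using S.incl_closed[OF k(1)] gc gF by auto
  have yfree: "y \<in> S.Y.free_part" unfolding y_def using S.Y.free_part_invariant[OF x(1)] in1 by simp
  obtain h where h: "h \<in> carrier (F j)" "\<beta> l (\<beta> w y) = \<beta> (S.incl j h) (\<beta> l (\<beta> w (\<beta> (S.incl k g) y)))"
    using factor[OF yV(1) gF yV(3)] unfolding yV(2,4) by blast
  have inh: "S.incl j h \<in> S.RW" using S.incl_closed[OF j h(1)] .
  define u where "u = l \<otimes>\<^bsub>S.W\<^esub> w"
  have u: "u \<in> S.RW" using l w by (simp add: u_def)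
  have "\<beta> u y = \<beta> (S.incl j h \<otimes>\<^bsub>S.W\<^esub> (u \<otimes>\<^bsub>S.W\<^esub> S.incl k g)) y"
    using h(2) l w inh in1 by (simp add: u_def S.Y.act_mult)
  \<comment> \<open>Freeness at \<open>y\<close> turns an equality of points into one of words:
    \<open>u\<close> conjugates the non-trivial \<open>g\<close> into the factor \<open>j\<close>,
    so malnormality applies.\<close>
  then have eq: "u = S.incl j h \<otimes>\<^bsub>S.W\<^esub> (u \<otimes>\<^bsub>S.W\<^esub> S.incl k g)"
    using S.Y.free_part_act[OF yfree, of u "S.incl j h \<otimes>\<^bsub>S.W\<^esub> (u \<otimes>\<^bsub>S.W\<^esub> S.incl k g)"] u inh in1 by simp
  interpret Fj: group "F j" by (rule S.group_factor[OF j])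
  have "S.incl j (inv\<^bsub>F j\<^esub> h) \<otimes>\<^bsub>S.W\<^esub> u = S.incl j (inv\<^bsub>F j\<^esub> h) \<otimes>\<^bsub>S.W\<^esub> (S.incl j h \<otimes>\<^bsub>S.W\<^esub> (u \<otimes>\<^bsub>S.W\<^esub> S.incl k g))"
    by (rule arg_cong[OF eq])
  also have "\<dots> = u \<otimes>\<^bsub>S.W\<^esub> S.incl k g"
    using j h(1) u in1 by (simp add: S.incl_mult_mult S.incl_one)
  finally have "u \<otimes>\<^bsub>S.W\<^esub> S.incl k g = S.incl j (inv\<^bsub>F j\<^esub> h) \<otimes>\<^bsub>S.W\<^esub> u" by simp
  from S.conjugate_in_factor[OF k(1) j gF g1' _ u this] h(1)
  obtain a where "k = j" "a \<in> carrier (F k)" "u = S.incl k a" by auto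
  then show thesis using that[OF V'(1) _ V'(2) w] unfolding u_def by blast
qed

end


section \<open>Non-ergodicity of the factor\<close>

context free_product_soe
begin

lemma X_act_measurable: "g \<in> E.RW \<Longrightarrow> \<alpha> g \<in> measurable M M"
  using S.X.act_measurable by simp

lemma Y_act_measurable: "g \<in> S.RW \<Longrightarrow> \<beta> g \<in> measurable N N"
  using S.Y.act_measurable by simp

lemma Y_mult: "g \<in> S.RW \<Longrightarrow> h \<in> S.RW \<Longrightarrow> \<beta> (g \<otimes>\<^bsub>S.W\<^esub> h) y = \<beta> g (\<beta> h y)"
  using S.Y.act_mult by simp

lemma X_factor_action: "i \<in> I \<Longrightarrow> pmp_action (E i) M (\<lambda>g. \<alpha> (E.incl i g))"
  by (rule S.X.pmp_action_hom[OF E.group_factor E.incl_hom free_product_incl_inj])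

lemma Y_factor_action: "k \<in> J \<Longrightarrow> pmp_action (F k) N (\<lambda>g. \<beta> (S.incl k g))"
  by (rule S.Y.pmp_action_hom[OF S.group_factor S.incl_hom free_product_incl_inj])

end

text \<open>The outcome of \<open>factor_conjugation\<close> in the direction from \<open>N\<close>
  to \<open>M\<close>: on \<open>V\<close> the factor \<open>k\<close> is carried into the factor
  \<open>i\<close>.\<close>

locale conjugated_factor = free_product_soe I E M \<alpha> J F N \<beta> A B \<Theta> \<Theta>' c
  for I :: "'i set" and E :: "'i \<Rightarrow> 'g monoid" and M :: "'x::polish_space measure" and \<alpha>
    and J :: "'j set" and F :: "'j \<Rightarrow> 'h monoid" and N :: "'y::polish_space measure" and \<beta> A B \<Theta> \<Theta>' c +
  fixes k :: 'j and V :: "'y set" and d m i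
  assumes k: "k \<in> J" "infinite (carrier (F k))"
    and V: "V \<in> sets N" "emeasure N V > 0" and d: "d \<in> S.RW" and m: "m \<in> E.RW" and i: "i \<in> I"
    and dB: "y \<in> V \<Longrightarrow> \<beta> d y \<in> B"
    and conj: "y \<in> V \<Longrightarrow> g \<in> carrier (F k) \<Longrightarrow> \<beta> (S.incl k g) y \<in> V \<Longrightarrow>
      \<exists>h\<in>carrier (E i). \<alpha> m (\<Theta>' (\<beta> d y)) = \<alpha> (E.incl i h) (\<alpha> m (\<Theta>' (\<beta> d (\<beta> (S.incl k g) y))))"
begin

definition \<psi> :: "'y \<Rightarrow> 'x" where "\<psi> y = \<alpha> m (\<Theta>' (\<beta> d y))"

sublocale Ei: group "E i" by (rule E.group_factor[OF i])
sublocale Fk: group "F k" by (rule S.group_factor[OF k(1)])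
sublocale XA: pmp_action "E i" M "\<lambda>g. \<alpha> (E.incl i g)" by (rule X_factor_action[OF i])
sublocale YA: pmp_action "F k" N "\<lambda>g. \<beta> (S.incl k g)" by (rule Y_factor_action[OF k(1)])

lemma \<psi>_meas: "\<psi> \<in> measurable N M"
  unfolding \<psi>_def
  using measurable_compose[OF measurable_compose[OF Y_act_measurable[OF d] S.\<Theta>'_meas] X_act_measurable[OF m]] .

lemma \<psi>_orb:
  assumes "y \<in> V" "g \<in> carrier (F k)" "\<beta> (S.incl k g) y \<in> V"
  obtains h where "h \<in> carrier (E i)" "\<psi> (\<beta> (S.incl k g) y) = \<alpha> (E.incl i h) (\<psi> y)"
proof -
  obtain h where h: "h \<in> carrier (E i)" "\<psi> y = \<alpha> (E.incl i h) (\<psi> (\<beta> (S.incl k g) y))"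
    using conj[OF assms] unfolding \<psi>_def by blast
  then have "\<psi> (\<beta> (S.incl k g) y) = \<alpha> (E.incl i (inv\<^bsub>E i\<^esub> h)) (\<psi> y)" by simp
  then show thesis using that h(1) Ei.inv_closed by blast
qed

lemma \<psi>_inj: "inj_on \<psi> V"
proof (rule inj_onI)
  fix y z assume yz: "y \<in> V" "z \<in> V" "\<psi> y = \<psi> z"
  then have "\<Theta>' (\<beta> d y) = \<Theta>' (\<beta> d z)" using S.X.act_inj[of m] m by (simp add: \<psi>_def)
  then have "\<beta> d y = \<beta> d z" using S.\<Theta>_\<Theta>' dB yz by metis
  then show "y = z" using S.Y.act_inj[of d] d by simp
qed

lemma \<psi>_scale:
  assumes C: "C \<in> sets N" "C \<subseteq> V"
  shows "\<psi> ` C \<in> sets M" "measure M (\<psi> ` C) = 1 / c * measure N C"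
proof -
  have dc: "\<beta> d ` C \<in> sets N" "measure N (\<beta> d ` C) = measure N C"
    using S.Y.act_image_sets[of d C] S.Y.emeasure_act_image[of d C] d C(1) by (simp_all add: measure_def)
  have sub: "\<beta> d ` C \<subseteq> B" using dB C(2) by blast
  have e: "\<Theta>' ` \<beta> d ` C = A \<inter> \<Theta> -` (\<beta> d ` C)"
  proof (intro equalityI subsetI)
    fix x assume "x \<in> \<Theta>' ` \<beta> d ` C"
    then obtain b where b: "b \<in> \<beta> d ` C" "x = \<Theta>' b" by blast
    then have "b \<in> B" using sub by blast
    then show "x \<in> A \<inter> \<Theta> -` (\<beta> d ` C)" using b S.\<Theta>'_in S.\<Theta>_\<Theta>' by simp
  next
    fix x assume "x \<in> A \<inter> \<Theta> -` (\<beta> d ` C)"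
    then have "x = \<Theta>' (\<Theta> x)" "\<Theta> x \<in> \<beta> d ` C" using S.\<Theta>'_\<Theta>[of x] by simp_all
    then show "x \<in> \<Theta>' ` \<beta> d ` C" by (rule image_eqI)
  qed
  have t: "\<Theta>' ` \<beta> d ` C \<in> sets M"
    unfolding e using measurable_sets[OF S.\<Theta>_meas dc(1)] S.A_sets by auto
  have im: "\<psi> ` C = \<alpha> m ` \<Theta>' ` \<beta> d ` C" by (simp add: image_image \<psi>_def)
  show "\<psi> ` C \<in> sets M" unfolding im using S.X.act_image_sets[OF _ t] m by simp
  have "measure M (\<psi> ` C) = measure M (\<Theta>' ` \<beta> d ` C)"
    unfolding im using S.X.emeasure_act_image[OF _ t] m by (simp add: measure_def)
  also have "\<dots> = 1 / c * measure N C" using S'.scale[OF dc(1) sub] dc(2) by simp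
  finally show "measure M (\<psi> ` C) = 1 / c * measure N C" .
qed

lemma \<psi>_image: "\<psi> ` V \<in> sets M" "emeasure M (\<psi> ` V) > 0"
proof -
  show "\<psi> ` V \<in> sets M" using \<psi>_scale[OF V(1)] by simp
  have "measure N V > 0" using V by (simp add: S.Y.emeasure_eq_measure)
  then have "measure M (\<psi> ` V) > 0" using \<psi>_scale[OF V(1)] S.c_pos by simp
  then show "emeasure M (\<psi> ` V) > 0" by (simp add: S.X.emeasure_eq_measure)
qed

lemma \<psi>_null:
  assumes "Z \<in> null_sets M"
  shows "V \<inter> \<psi> -` Z \<in> null_sets N"
proof -
  have Z: "Z \<in> sets M" using assms by auto
  have s: "V \<inter> \<psi> -` Z \<in> sets N" using measurable_sets[OF \<psi>_meas Z] V(1) by auto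
  have "\<psi> ` (V \<inter> \<psi> -` Z) \<in> null_sets M"
    using \<psi>_scale[OF s] by (intro null_sets_subset[OF assms]) auto
  then have "measure M (\<psi> ` (V \<inter> \<psi> -` Z)) = 0" by (rule measure_eq_0_null_sets)
  then have "measure N (V \<inter> \<psi> -` Z) = 0" using \<psi>_scale[OF s] S.c_pos by simp
  then show ?thesis using s by (simp add: null_sets_def S.Y.emeasure_eq_measure)
qed

lemma \<psi>_class:
  assumes "y \<in> V"
  shows "\<exists>b\<in>B. (b, y) \<in> S.Y.orb \<and> (\<psi> y, \<Theta>' b) \<in> S.X.orb"
proof (rule bexI[OF _ dB[OF assms]], intro conjI)
  show "(\<beta> d y, y) \<in> S.Y.orb" using S.Y.orb_sym[OF S.Y.orb_act[of d y]] d by simp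
  show "(\<psi> y, \<Theta>' (\<beta> d y)) \<in> S.X.orb"
    unfolding \<psi>_def using S.X.orb_sym[OF S.X.orb_act[of m]] m by simp
qed

text \<open>\<open>\<psi>\<close> is injective and takes arbitrarily many points of one orbit of the
  factor \<open>k\<close> into one orbit of the factor \<open>i\<close>. So the Kurosh theorem can
  be applied to the factor \<open>i\<close> in turn.\<close>

lemma infinite_image_factor: "infinite (carrier (E i))"
proof
  assume fin: "finite (carrier (E i))"
  define n where "n = Suc (card (carrier (E i)))"
  obtain x K where x: "x \<in> YA.free_part" "K \<subseteq> carrier (F k)" "finite K" "card K = n"
    "\<And>g. g \<in> K \<Longrightarrow> \<beta> (S.incl k g) x \<in> V"
    using YA.many_returns[OF k(2) V YA.free_part_sets YA.free_part_conull, of n] by metis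
  obtain g0 where g0: "g0 \<in> K" using x(4) by (cases "K = {}") (auto simp: n_def)
  have g0F: "g0 \<in> carrier (F k)" using g0 x(2) by blast
  define y where "y = \<beta> (S.incl k g0) x"
  have "\<psi> (\<beta> (S.incl k g) x) \<in> (\<lambda>h. \<alpha> (E.incl i h) (\<psi> y)) ` carrier (E i)" if g: "g \<in> K" for g
  proof -
    have gF: "g \<in> carrier (F k)" using g x(2) by blast
    have e: "\<beta> (S.incl k (g \<otimes>\<^bsub>F k\<^esub> inv\<^bsub>F k\<^esub> g0)) y = \<beta> (S.incl k g) x"
      using YA.act_mult[of g "inv\<^bsub>F k\<^esub> g0" y] gF g0F by (simp add: y_def)
    have "y \<in> V" "\<beta> (S.incl k (g \<otimes>\<^bsub>F k\<^esub> inv\<^bsub>F k\<^esub> g0)) y \<in> V"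
      unfolding e using x(5)[OF g] x(5)[OF g0] by (simp_all add: y_def)
    then obtain h where "h \<in> carrier (E i)" "\<psi> (\<beta> (S.incl k g) x) = \<alpha> (E.incl i h) (\<psi> y)"
      using \<psi>_orb[of y "g \<otimes>\<^bsub>F k\<^esub> inv\<^bsub>F k\<^esub> g0"] gF g0F unfolding e by blast
    then show ?thesis by blast
  qed
  then have "(\<lambda>g. \<psi> (\<beta> (S.incl k g) x)) ` K \<subseteq> (\<lambda>h. \<alpha> (E.incl i h) (\<psi> y)) ` carrier (E i)" by blast
  from card_mono[OF finite_imageI[OF fin] this]
  have "card ((\<lambda>g. \<psi> (\<beta> (S.incl k g) x)) ` K) \<le> card (carrier (E i))"
    using card_image_le[OF fin] by (rule le_trans)
  moreover have "inj_on (\<lambda>g. \<psi> (\<beta> (S.incl k g) x)) K"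
  proof (rule inj_onI)
    fix g h assume gh: "g \<in> K" "h \<in> K" "\<psi> (\<beta> (S.incl k g) x) = \<psi> (\<beta> (S.incl k h) x)"
    then have "\<beta> (S.incl k g) x = \<beta> (S.incl k h) x" using inj_onD[OF \<psi>_inj gh(3)] x(5) by blast
    then show "g = h" using YA.free_part_act[OF x(1)] gh x(2) by blast
  qed
  ultimately show False using x(4) by (simp add: card_image n_def)
qed

text \<open>
  Free indecomposability carries the \<open>i\<close>-th factor back into some factor of the other
  decomposition, which has to be the \<open>k\<close>-th one; so \<open>\<psi>\<close> identifies the two relations on a set of
  positive measure.
\<close>

lemma factors_measure_equivalent:
  assumes MFI: "MFI (E i)"
  shows "measure_equivalent (E i) (F k)"
proof (rule S.factor_conjugation[OF Ei.is_group MFI infinite_image_factor E.incl_hom[OF i]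
      free_product_incl_inj \<psi>_image])
  fix V4 e j l
  assume V4: "V4 \<in> sets M" "V4 \<subseteq> \<psi> ` V" "emeasure M V4 > 0"
    and "e \<in> carrier (free_product I E)" and j: "j \<in> J" and l: "l \<in> S.RW"
    and eA: "\<And>x. x \<in> V4 \<Longrightarrow> \<alpha> e x \<in> A"
    and V4c: "\<And>x g. x \<in> V4 \<Longrightarrow> g \<in> carrier (E i) \<Longrightarrow> \<alpha> (E.incl i g) x \<in> V4 \<Longrightarrow>
      \<exists>h\<in>carrier (F j). \<beta> l (\<Theta> (\<alpha> e x)) = \<beta> (S.incl j h) (\<beta> l (\<Theta> (\<alpha> e (\<alpha> (E.incl i g) x))))"
  then have e: "e \<in> E.RW" by simp
  define V5 where "V5 = V \<inter> \<psi> -` V4"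
  have V5s: "V5 \<in> sets N" using measurable_sets[OF \<psi>_meas V4(1)] V(1) by (auto simp: V5_def)
  have V5V: "V5 \<subseteq> V" by (simp add: V5_def)
  have "\<psi> ` V5 = V4" using V4(2) by (auto simp: V5_def)
  then have "measure M V4 = 1 / c * measure N V5" using \<psi>_scale(2)[OF V5s V5V] by simp
  moreover have "measure M V4 > 0" using V4(3) by (simp add: S.X.emeasure_eq_measure)
  ultimately have "measure N V5 > 0" using S.c_pos by (simp add: zero_less_divide_iff)
  then have V5p: "emeasure N V5 > 0" by (simp add: S.Y.emeasure_eq_measure)
  show ?thesis
  proof (rule return_to_factor[OF k j l V5s V5p, of "\<lambda>y. \<alpha> e (\<psi> y)"])
    show "(\<lambda>y. \<alpha> e (\<psi> y)) \<in> measurable N M"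
      using measurable_compose[OF \<psi>_meas X_act_measurable[OF e]] .
    show "\<alpha> e (\<psi> y) \<in> A \<and> (\<exists>b\<in>B. (b, y) \<in> S.Y.orb \<and> (\<alpha> e (\<psi> y), \<Theta>' b) \<in> S.X.orb)" if y: "y \<in> V5" for y
    proof
      show "\<alpha> e (\<psi> y) \<in> A" using eA y by (simp add: V5_def)
      obtain b where b: "b \<in> B" "(b, y) \<in> S.Y.orb" "(\<psi> y, \<Theta>' b) \<in> S.X.orb"
        using \<psi>_class V5V y by blast
      have "(\<alpha> e (\<psi> y), \<psi> y) \<in> S.X.orb" using S.X.orb_sym[OF S.X.orb_act[of e]] e by simp
      then have "(\<alpha> e (\<psi> y), \<Theta>' b) \<in> S.X.orb" using b(3) by (rule S.X.orb_trans)
      then show "\<exists>b\<in>B. (b, y) \<in> S.Y.orb \<and> (\<alpha> e (\<psi> y), \<Theta>' b) \<in> S.X.orb" using b by blast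
    qed
    show "\<exists>h\<in>carrier (F j). \<beta> l (\<Theta> (\<alpha> e (\<psi> y))) = \<beta> (S.incl j h) (\<beta> l (\<Theta> (\<alpha> e (\<psi> (\<beta> (S.incl k g) y)))))"
      if y: "y \<in> V5" "g \<in> carrier (F k)" "\<beta> (S.incl k g) y \<in> V5" for y g
    proof -
      have yV: "y \<in> V" "\<beta> (S.incl k g) y \<in> V" using y V5V by auto
      obtain h where h: "h \<in> carrier (E i)" "\<psi> (\<beta> (S.incl k g) y) = \<alpha> (E.incl i h) (\<psi> y)"
        using \<psi>_orb[OF yV(1) y(2) yV(2)] by blast
      have "\<psi> y \<in> V4" "\<alpha> (E.incl i h) (\<psi> y) \<in> V4" using y h(2) by (auto simp: V5_def)
      from V4c[OF this(1) h(1) this(2)] show ?thesis unfolding h(2) .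
    qed
  next
    fix V' w a
    assume V': "V' \<in> sets N" "V' \<subseteq> V5" "emeasure N V' > 0" and w: "w \<in> S.RW"
      and pw: "\<And>y. y \<in> V' \<Longrightarrow> \<Theta> (\<alpha> e (\<psi> y)) = \<beta> w y" and jk: "j = k"
      and a: "a \<in> carrier (F k)" "l \<otimes>\<^bsub>S.W\<^esub> w = S.incl k a"
    have V'V: "V' \<subseteq> V" using V'(2) V5V by blast
    define iw where "iw = inv\<^bsub>S.W\<^esub> w"
    have iw: "iw \<in> S.RW" using w by (simp add: iw_def)
    \<comment> \<open>\<open>\<psi> y\<close>, moved by \<open>e\<close> and sent back by
      \<open>\<Theta>\<close>, arrives at \<open>\<beta> w y\<close>; undoing \<open>w\<close>
      returns to \<open>y\<close>.\<close>
    define \<xi> where "\<xi> x = \<beta> iw (\<Theta> (\<alpha> e x))" for x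
    have \<xi>_\<psi>: "\<xi> (\<psi> y) = y" if "y \<in> V'" for y
      using pw[OF that] w by (simp add: \<xi>_def iw_def)
    note im = \<psi>_scale[OF V'(1) V'V]
    have "measure N V' > 0" using V'(3) by (simp add: S.Y.emeasure_eq_measure)
    then have pos: "emeasure M (\<psi> ` V') > 0" using im S.c_pos by (simp add: S.X.emeasure_eq_measure)
    show ?thesis
    proof (rule measure_equivalentI[OF XA.pmp_action_axioms YA.pmp_action_axioms im(1) pos V'(1)])
      show "\<xi> \<in> measurable M N"
        unfolding \<xi>_def
        using measurable_compose[OF measurable_compose[OF X_act_measurable[OF e] S.\<Theta>_meas] Y_act_measurable[OF iw]] .
      show "\<psi> \<in> measurable N M" by (rule \<psi>_meas)
      show "\<xi> ` \<psi> ` V' = V'" using \<xi>_\<psi> by (force simp: image_image)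
      show "\<psi> (\<xi> x) = x" if "x \<in> \<psi> ` V'" for x using that \<xi>_\<psi> by auto
      show "c > 0" by (rule S.c_pos)
      show "measure N (\<xi> ` C) = c * measure M C" if C: "C \<in> sets M" "C \<subseteq> \<psi> ` V'" for C
      proof -
        have e1: "\<xi> ` C = V' \<inter> \<psi> -` C"
        proof (intro equalityI subsetI)
          fix y assume "y \<in> \<xi> ` C"
          then show "y \<in> V' \<inter> \<psi> -` C" using C(2) \<xi>_\<psi> by auto
        next
          fix y assume "y \<in> V' \<inter> \<psi> -` C"
          then show "y \<in> \<xi> ` C" using \<xi>_\<psi> by (intro image_eqI[of _ _ "\<psi> y"]) auto
        qed
        have s: "V' \<inter> \<psi> -` C \<in> sets N" using measurable_sets[OF \<psi>_meas C(1)] V'(1) by auto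
        have "\<psi> ` (V' \<inter> \<psi> -` C) = C" using C(2) by auto
        then have "measure M C = 1 / c * measure N (V' \<inter> \<psi> -` C)" using \<psi>_scale(2)[OF s] V'V by auto
        then show ?thesis unfolding e1 using S.c_pos by simp
      qed
      show "(x, x') \<in> XA.orb \<longleftrightarrow> (\<xi> x, \<xi> x') \<in> YA.orb" if xx: "x \<in> \<psi> ` V'" "x' \<in> \<psi> ` V'" for x x'
      proof -
        obtain y y' where y: "y \<in> V'" "y' \<in> V'" "x = \<psi> y" "x' = \<psi> y'" using xx by blast
        have "(\<psi> y, \<psi> y') \<in> XA.orb \<longleftrightarrow> (y, y') \<in> YA.orb"
        proof
          assume "(y, y') \<in> YA.orb"
          then obtain g where g: "g \<in> carrier (F k)" "y' = \<beta> (S.incl k g) y" by (auto simp: YA.orb_iff)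
          have yV: "y \<in> V" "\<beta> (S.incl k g) y \<in> V" using y(1,2) V'V unfolding g(2)[symmetric] by auto
          obtain h where "h \<in> carrier (E i)" "\<psi> y' = \<alpha> (E.incl i h) (\<psi> y)"
            using \<psi>_orb[OF yV(1) g(1) yV(2)] unfolding g(2)[symmetric] by blast
          then show "(\<psi> y, \<psi> y') \<in> XA.orb" by (auto simp: XA.orb_iff)
        next
          \<comment> \<open>The way back conjugates the factor \<open>i\<close> into the factor
            \<open>j\<close>, which is \<open>k\<close>. As \<open>l \<otimes> w\<close> is the
            element \<open>a\<close> of that factor, \<open>y\<close> and \<open>y'\<close> are in
            one of its orbits.\<close>
          assume "(\<psi> y, \<psi> y') \<in> XA.orb"
          then obtain g where g: "g \<in> carrier (E i)" "\<psi> y' = \<alpha> (E.incl i g) (\<psi> y)" by (auto simp: XA.orb_iff)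
          have "\<psi> y \<in> V4" "\<alpha> (E.incl i g) (\<psi> y) \<in> V4"
            using y(1,2) V'(2) unfolding g(2)[symmetric] by (auto simp: V5_def)
          from V4c[OF this(1) g(1) this(2)] obtain h where h: "h \<in> carrier (F k)"
            "\<beta> l (\<beta> w y) = \<beta> (S.incl k h) (\<beta> l (\<beta> w y'))"
            unfolding g(2)[symmetric] jk using pw y(1,2) by auto
          have "\<beta> (S.incl k a) y = \<beta> (S.incl k h) (\<beta> (S.incl k a) y')"
            using h(2) unfolding Y_mult[OF l w, symmetric] a(2) .
          then have "(\<beta> (S.incl k a) y', \<beta> (S.incl k a) y) \<in> YA.orb" using h(1) by (auto simp: YA.orb_iff)
          then have "(y', y) \<in> YA.orb"
            using YA.orb_trans[OF YA.orb_trans[OF YA.orb_act[OF a(1)] _] YA.orb_sym[OF YA.orb_act[OF a(1)]]] by blast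
          then show "(y, y') \<in> YA.orb" by (rule YA.orb_sym)
        qed
        then show ?thesis using y \<xi>_\<psi> by simp
      qed
    qed
  qed
qed

end

context free_product_soe
begin

theorem factor_not_ergodic:
  assumes I: "I = {i0, i1}" and MFI: "MFI (E i0)" "MFI (E i1)"
    and k1: "k1 \<in> J" "MFI (F k1)" "infinite (carrier (F k1))" "\<not> measure_equivalent (E i0) (F k1)"
    and k2: "k2 \<in> J" "MFI (F k2)" "infinite (carrier (F k2))" "\<not> measure_equivalent (E i0) (F k2)"
    and "k1 \<noteq> k2"
  shows "\<not> ergodic_action (E i1) M (\<lambda>g. \<alpha> (E.incl i1 g))"
proof
  assume erg: "ergodic_action (E i1) M (\<lambda>g. \<alpha> (E.incl i1 g))"
  have i1: "i1 \<in> I" by (simp add: I)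
  interpret X1: pmp_action "E i1" M "\<lambda>g. \<alpha> (E.incl i1 g)" by (rule X_factor_action[OF i1])
  show False
  proof (rule S.factor_conjugation[OF X1.is_group MFI(2) X1.ergodic_infinite[OF erg] E.incl_hom[OF i1]
        free_product_incl_inj S.A_sets S.A_pos])
    fix V1 e j l
    assume V1: "V1 \<in> sets M" "V1 \<subseteq> A" "emeasure M V1 > 0"
      and "e \<in> carrier (free_product I E)" and j: "j \<in> J" and l: "l \<in> S.RW"
      and eA: "\<And>x. x \<in> V1 \<Longrightarrow> \<alpha> e x \<in> A"
      and V1c: "\<And>x g. x \<in> V1 \<Longrightarrow> g \<in> carrier (E i1) \<Longrightarrow> \<alpha> (E.incl i1 g) x \<in> V1 \<Longrightarrow>
        \<exists>h\<in>carrier (F j). \<beta> l (\<Theta> (\<alpha> e x)) = \<beta> (S.incl j h) (\<beta> l (\<Theta> (\<alpha> e (\<alpha> (E.incl i1 g) x))))"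
    then have e: "e \<in> E.RW" by simp
    \<comment> \<open>Of two distinct copies at least one differs from the factor \<open>j\<close>
      that receives \<open>E i1\<close>.\<close>
    define k where "k = (if j = k1 then k2 else k1)"
    have k: "k \<in> J" "MFI (F k)" "infinite (carrier (F k))" "\<not> measure_equivalent (E i0) (F k)" "k \<noteq> j"
      using k1 k2 \<open>k1 \<noteq> k2\<close> by (auto simp: k_def)
    interpret Fk: group "F k" by (rule S.group_factor[OF k(1)])
    show False
    proof (rule S'.factor_conjugation[OF Fk.is_group k(2,3) S.incl_hom[OF k(1)] free_product_incl_inj
          S'.A_sets S'.A_pos])
      fix V2 d i m
      assume V2: "V2 \<in> sets N" "V2 \<subseteq> B" "emeasure N V2 > 0" and "d \<in> carrier (free_product J F)"
        and i: "i \<in> I" and m: "m \<in> E.RW" and dB: "\<And>y. y \<in> V2 \<Longrightarrow> \<beta> d y \<in> B"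
        and V2c: "\<And>y g. y \<in> V2 \<Longrightarrow> g \<in> carrier (F k) \<Longrightarrow> \<beta> (S.incl k g) y \<in> V2 \<Longrightarrow>
          \<exists>h\<in>carrier (E i). \<alpha> m (\<Theta>' (\<beta> d y)) = \<alpha> (E.incl i h) (\<alpha> m (\<Theta>' (\<beta> d (\<beta> (S.incl k g) y))))"
      then have d: "d \<in> S.RW" by simp
      interpret C: conjugated_factor I E M \<alpha> J F N \<beta> A B \<Theta> \<Theta>' c k V2 d m i
        by unfold_locales (use k V2 d m i dB V2c in auto)
      have "i \<noteq> i0" using C.factors_measure_equivalent MFI(1) k(4) by metis
      then have i1': "i = i1" using i I by auto
      \<comment> \<open>By ergodicity almost every orbit of \<open>E i1\<close> meets
        \<open>V1\<close>. As \<open>C.\<psi>\<close> pulls null sets back to null sets, almost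
        every point of \<open>V2\<close> is sent into such an orbit, and on a part of positive
        measure one element \<open>g\<close> completes the move into \<open>V1\<close>.\<close>
      have conull: "space M - X1.sat V1 \<in> null_sets M"
        using X1.ergodic_sat[OF erg V1(1)] 
      proof
        assume n: "X1.sat V1 \<in> null_sets M"
        have "V1 \<in> null_sets M" by (rule null_sets_subset[OF n V1(1) X1.subset_sat])
        then show ?thesis using V1(3) by (simp add: null_sets_def)
      qed
      define V3 where "V3 = V2 - (V2 \<inter> C.\<psi> -` (space M - X1.sat V1))"
      have V3: "V3 \<in> sets N" "emeasure N V3 > 0"
        using V2 C.\<psi>_null[OF conull] by (auto simp: V3_def emeasure_Diff_null_set)
      define T where "T g = C.\<psi> -` ((\<lambda>x. \<alpha> (E.incl i1 g) x) -` V1)" for g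
      have cover: "V3 \<subseteq> (\<Union>g\<in>carrier (E i1). T g)" by (auto simp: V3_def T_def X1.sat_def)
      have "T g \<in> sets N" if "g \<in> carrier (E i1)" for g
        using measurable_sets[OF C.\<psi>_meas X1.act_vimage[OF that V1(1)]] by (simp add: T_def)
      then obtain g where g: "g \<in> carrier (E i1)" and V4: "V3 \<inter> T g \<in> sets N" "emeasure N (V3 \<inter> T g) > 0"
        using S.Y.pos_piece[OF V3 X1.countable_group cover] by blast
      have V4V: "y \<in> V2" "\<alpha> (E.incl i1 g) (C.\<psi> y) \<in> V1" if "y \<in> V3 \<inter> T g" for y
        using that by (auto simp: V3_def T_def)
      have gE: "E.incl i1 g \<in> E.RW" by (rule E.incl_closed[OF i1 g])
      show False
      proof (rule return_to_factor[OF k(1,3) j l V4, of "\<lambda>y. \<alpha> e (\<alpha> (E.incl i1 g) (C.\<psi> y))"])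
        show "(\<lambda>y. \<alpha> e (\<alpha> (E.incl i1 g) (C.\<psi> y))) \<in> measurable N M"
          using measurable_compose[OF measurable_compose[OF C.\<psi>_meas X_act_measurable[OF gE]] X_act_measurable[OF e]] .
        show "\<alpha> e (\<alpha> (E.incl i1 g) (C.\<psi> y)) \<in> A \<and>
          (\<exists>b\<in>B. (b, y) \<in> S.Y.orb \<and> (\<alpha> e (\<alpha> (E.incl i1 g) (C.\<psi> y)), \<Theta>' b) \<in> S.X.orb)" if y: "y \<in> V3 \<inter> T g" for y
        proof
          show "\<alpha> e (\<alpha> (E.incl i1 g) (C.\<psi> y)) \<in> A" using eA V4V(2)[OF y] by simp
          obtain b where b: "b \<in> B" "(b, y) \<in> S.Y.orb" "(C.\<psi> y, \<Theta>' b) \<in> S.X.orb"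
            using C.\<psi>_class V4V(1)[OF y] by blast
          have "(\<alpha> (E.incl i1 g) (C.\<psi> y), C.\<psi> y) \<in> S.X.orb"
            using S.X.orb_sym[OF S.X.orb_act[of "E.incl i1 g"]] gE by simp
          moreover have "(\<alpha> e (\<alpha> (E.incl i1 g) (C.\<psi> y)), \<alpha> (E.incl i1 g) (C.\<psi> y)) \<in> S.X.orb"
            using S.X.orb_sym[OF S.X.orb_act[of e]] e by simp
          ultimately have "(\<alpha> e (\<alpha> (E.incl i1 g) (C.\<psi> y)), \<Theta>' b) \<in> S.X.orb"
            using b(3) S.X.orb_trans by blast
          then show "\<exists>b\<in>B. (b, y) \<in> S.Y.orb \<and> (\<alpha> e (\<alpha> (E.incl i1 g) (C.\<psi> y)), \<Theta>' b) \<in> S.X.orb"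
            using b by blast
        qed
        show "\<exists>h\<in>carrier (F j). \<beta> l (\<Theta> (\<alpha> e (\<alpha> (E.incl i1 g) (C.\<psi> y)))) =
            \<beta> (S.incl j h) (\<beta> l (\<Theta> (\<alpha> e (\<alpha> (E.incl i1 g) (C.\<psi> (\<beta> (S.incl k f) y))))))"
          if y: "y \<in> V3 \<inter> T g" "f \<in> carrier (F k)" "\<beta> (S.incl k f) y \<in> V3 \<inter> T g" for y f
        proof -
          obtain h where h: "h \<in> carrier (E i1)" "C.\<psi> (\<beta> (S.incl k f) y) = \<alpha> (E.incl i1 h) (C.\<psi> y)"
            using C.\<psi>_orb[OF V4V(1)[OF y(1)] y(2) V4V(1)[OF y(3)]] unfolding i1' by blast
          \<comment> \<open>The element of \<open>E i1\<close> between the two images, conjugated by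
            the \<open>g\<close> that moved both of them into \<open>V1\<close>.\<close>
          define q where "q = g \<otimes>\<^bsub>E i1\<^esub> h \<otimes>\<^bsub>E i1\<^esub> inv\<^bsub>E i1\<^esub> g"
          have q: "q \<in> carrier (E i1)" using g h(1) by (simp add: q_def)
          have qe: "\<alpha> (E.incl i1 q) (\<alpha> (E.incl i1 g) (C.\<psi> y)) = \<alpha> (E.incl i1 g) (C.\<psi> (\<beta> (S.incl k f) y))"
            using g h(1) X1.act_mult by (simp add: q_def h(2))
          show ?thesis
            using V1c[OF V4V(2)[OF y(1)] q] V4V(2)[OF y(3)] unfolding qe by blast
        qed
      next
        assume "j = k"
        then show False using k(5) by simp
      qed
    qed
  qed
qed

end

theorem corollary1p4:
  fixes \<Gamma>1 \<Gamma>2 :: "'g monoid" and H :: "'g set" and \<kappa> :: nat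
    and M :: "'x::polish_space measure" and N :: "'y::polish_space measure"
    and \<alpha> :: "(nat \<times> 'g) list \<Rightarrow> 'x \<Rightarrow> 'x" and \<beta> :: "(nat \<times> 'g) list \<Rightarrow> 'y \<Rightarrow> 'y"
  defines "\<Gamma>1' \<equiv> \<Gamma>1\<lparr>carrier := H\<rparr>"
  defines "F \<equiv> (\<lambda>i::nat. if i = 0 then \<Gamma>1 else \<Gamma>2)"
  defines "F' \<equiv> (\<lambda>i::nat. if i = 0 then \<Gamma>1' else \<Gamma>2)"
  defines "\<Gamma> \<equiv> free_product {0, 1} F"
  defines "\<Lambda> \<equiv> free_product {0..\<kappa>} F'"
  assumes "group \<Gamma>1" "countable (carrier \<Gamma>1)" "MFI \<Gamma>1"
    and "group \<Gamma>2" "countable (carrier \<Gamma>2)" "MFI \<Gamma>2"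
    and "\<not> measure_equivalent \<Gamma>1 \<Gamma>2"
    and "subgroup H \<Gamma>1" "card (rcosets\<^bsub>\<Gamma>1\<^esub> H) = \<kappa>" "\<kappa> \<ge> 2"
    and "free_pmp_action \<Gamma> M \<alpha>" "free_pmp_action \<Lambda> N \<beta>"
    and "stably_orbit_equivalent M (orbit_relation \<Gamma> M \<alpha>) N (orbit_relation \<Lambda> N \<beta>)"
  shows "\<not> ergodic_action \<Gamma>2 M (\<lambda>g. \<alpha> (free_product_incl F 1 g))"
proof
  assume erg: "ergodic_action \<Gamma>2 M (\<lambda>g. \<alpha> (free_product_incl F 1 g))"
  have F1: "F 0 = \<Gamma>1" "F 1 = \<Gamma>2" "F' 1 = \<Gamma>2" "F' 2 = \<Gamma>2" by (simp_all add: F_def F'_def)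
  have "group \<Gamma>1'" unfolding \<Gamma>1'_def using \<open>subgroup H \<Gamma>1\<close> \<open>group \<Gamma>1\<close> by (rule subgroup.subgroup_is_group)
  moreover have "countable (carrier \<Gamma>1')"
    using countable_subset[OF subgroup.subset[OF \<open>subgroup H \<Gamma>1\<close>] \<open>countable (carrier \<Gamma>1)\<close>] by (simp add: \<Gamma>1'_def)
  ultimately have gF': "group (F' i)" "countable (carrier (F' i))" for i
    using \<open>group \<Gamma>2\<close> \<open>countable (carrier \<Gamma>2)\<close> by (simp_all add: F'_def)
  have gF: "group (F i)" "countable (carrier (F i))" for i
    using \<open>group \<Gamma>1\<close> \<open>countable (carrier \<Gamma>1)\<close> \<open>group \<Gamma>2\<close> \<open>countable (carrier \<Gamma>2)\<close> by (simp_all add: F_def)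
  interpret E: group_family "{0, 1}" F by (rule group_family.intro) (rule gF)
  interpret E': group_family "{0..\<kappa>}" F' by (rule group_family.intro) (rule gF')
  interpret X: pmp_action \<Gamma> M \<alpha>
  proof
    show "countable (carrier \<Gamma>)" unfolding \<Gamma>_def carrier_free_product by (rule E.countable_reduced) (auto simp: gF)
  qed fact
  interpret Y: pmp_action \<Lambda> N \<beta>
  proof
    show "countable (carrier \<Lambda>)" unfolding \<Lambda>_def carrier_free_product by (rule E'.countable_reduced) (auto simp: gF')
  qed fact
  obtain A B \<Theta> \<Theta>' c where soe: "soe \<Gamma> M \<alpha> \<Lambda> N \<beta> A B \<Theta> \<Theta>' c"
    using ex_soe[OF X.pmp_action_axioms Y.pmp_action_axioms] assms by blast
  interpret S: soe "free_product {0, 1} F" M \<alpha> "free_product {0..\<kappa>} F'" N \<beta> A B \<Theta> \<Theta>' c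
    using soe unfolding \<Gamma>_def \<Lambda>_def .
  interpret free_product_soe "{0, 1}" F M \<alpha> "{0..\<kappa>}" F' N \<beta> A B \<Theta> \<Theta>' c
    by unfold_locales (auto simp: gF gF')
  interpret X2: pmp_action \<Gamma>2 M "\<lambda>g. \<alpha> (free_product_incl F 1 g)"
    using X_factor_action[of 1] by (simp add: F1 del: One_nat_def)
  have "infinite (carrier \<Gamma>2)" by (rule X2.ergodic_infinite[OF erg])
  then have "\<not> ergodic_action (F 1) M (\<lambda>g. \<alpha> (free_product_incl F 1 g))"
    \<comment> \<open>The indices 1 and 2 are two copies of \<open>\<Gamma>2\<close>; both lie in
      \<open>{0..\<kappa>}\<close> since \<open>\<kappa> \<ge> 2\<close>. On the other side 0 is
      \<open>\<Gamma>1\<close> and 1 is the factor assumed ergodic.\<close>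
    using assms by (intro factor_not_ergodic[of 0 1 1 2]) (simp_all add: F1 del: One_nat_def)
  then show False using erg by (simp add: F1 del: One_nat_def)
qed

end
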